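(* Let $p\geq1$. Assume $f:\mathbb{R}^d\to\mathbb{R}^d$ and $g:\mathbb{R}^d\to\mathbb{M}^d$ satisfy: (H1) $f$ is continuous with $|f(x)|\leq L(1+|x|)$ for some $L>0$ and all $x$, and $\|g(x)-g(y)\|\leq C_\alpha|x-y|^\alpha$ for some $\alpha\in(p-1,1]$, $C_\alpha>0$ and all $x,y$; (H2) for every $k\in\mathbb{N}$ there is $L_k>0$ with $|f(x)-f(y)|\leq L_k|x-y|$ for $|x|,|y|\leq k$; each component $g_{i,j}$ is differentiable and there is $\gamma\in(p-1,1]$ such that for every $k\in\mathbb{N}$ there is $C_{k,\gamma}>0$ with $|\nabla g_{i,j}(x)-\nabla g_{i,j}(y)|\leq C_{k,\gamma}|x-y|^\gamma$ for $|x|,|y|\leq k$, $i,j=1,\dots,d$. Let $a\in D(\mathbb{R}^+,\mathbb{R})$, $z,l\in D(\mathbb{R}^+,\mathbb{R}^d)$ with $V_1(a)_T<\infty$, $V_p(z)_T<\infty$ for all $T$, and $x_0\in\mathbb{R}^d$ with $x_0\geq l_0$. Then there exists a unique solution $(x,k)$ of \[ x_t=x_0+\int_0^tf(x_{s-})\,da_s+\int_0^tg(x_{s-})\,dz_s+k_t,\quad t\in\mathbb{R}^+. \]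
   Context: $\mathbb{R}^+=[0,\infty)$; $\mathbb{M}^d$ = real $d\times d$ matrices with operator norm. $D(\mathbb{R}^+,\mathbb{R}^m)$ is the space of càdlàg functions. For càdlàg $x$, $v_p(x)_{[a,b]}=\sup\sum_i|x_{t_i}-x_{t_{i-1}}|^p$ over subdivisions of $[a,b]$, $V_p=v_p^{1/p}$, subscript $T$ meaning $[0,T]$. Integrals are Riemann–Stieltjes. Inequalities between vectors are componentwise. Skorokhod problem: for $y,l\in D(\mathbb{R}^+,\mathbb{R}^d)$ with $l_0\leq y_0$, $(x,k)=SP_l(y)$ means (i) $x_t=y_t+k_t\geq l_t$ for all $t$; (ii) $k_0=0$, each $k^i$ nondecreasing with $\int_0^t(x^i_s-l^i_s)dk^i_s=0$ for all $t,i$. A solution of the equation is a pair $(x,k)\in D(\mathbb{R}^+,\mathbb{R}^d)^2$ with $V_p(x)_T<\infty$ for all $T$ and $(x,k)=SP_l(y)$, $y_t=x_0+\int_0^tf(x_{s-})da_s+\int_0^tg(x_{s-})dz_s$. *)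

theory Defs
  imports "HOL-Analysis.Analysis"
begin

definition cadlag :: "(real \<Rightarrow> 'a::topological_space) \<Rightarrow> bool" where
  "cadlag x \<longleftrightarrow>
     (\<forall>t\<ge>0. (x \<longlongrightarrow> x t) (at_right t)) \<and>
     (\<forall>t>0. \<exists>L. (x \<longlongrightarrow> L) (at_left t))"

definition left_lim :: "(real \<Rightarrow> 'a::t2_space) \<Rightarrow> real \<Rightarrow> 'a" where
  "left_lim x t = (if t \<le> 0 then x 0 else Lim (at_left t) x)"

definition is_partition :: "real \<Rightarrow> real \<Rightarrow> real list \<Rightarrow> bool" where
  "is_partition a b P \<longleftrightarrow> P \<noteq> [] \<and> hd P = a \<and> last P = b \<and> sorted_wrt (<) P"

definition pvar_sum :: "real \<Rightarrow> (real \<Rightarrow> 'a::real_normed_vector) \<Rightarrow> real list \<Rightarrow> real" where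
  "pvar_sum p x P = (\<Sum>i<length P - 1. norm (x (P ! Suc i) - x (P ! i)) powr p)"

definition pvar :: "real \<Rightarrow> (real \<Rightarrow> 'a::real_normed_vector) \<Rightarrow> real \<Rightarrow> real \<Rightarrow> ereal" where
  "pvar p x a b = (SUP P \<in> {P. is_partition a b P}. ereal (pvar_sum p x P))"

definition rs_tags :: "real list \<Rightarrow> (nat \<Rightarrow> real) \<Rightarrow> bool" where
  "rs_tags P \<xi> \<longleftrightarrow> (\<forall>i < length P - 1. P ! i \<le> \<xi> i \<and> \<xi> i \<le> P ! Suc i)"

definition rs_sum ::
  "('a \<Rightarrow> 'b::ab_group_add \<Rightarrow> 'c::real_normed_vector) \<Rightarrow> (real \<Rightarrow> 'a) \<Rightarrow> (real \<Rightarrow> 'b)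
     \<Rightarrow> real list \<Rightarrow> (nat \<Rightarrow> real) \<Rightarrow> 'c" where
  "rs_sum mul h a P \<xi> = (\<Sum>i<length P - 1. mul (h (\<xi> i)) (a (P ! Suc i) - a (P ! i)))"

definition has_rs_integral ::
  "('a \<Rightarrow> 'b::ab_group_add \<Rightarrow> 'c::real_normed_vector) \<Rightarrow> (real \<Rightarrow> 'a) \<Rightarrow> (real \<Rightarrow> 'b)
     \<Rightarrow> real \<Rightarrow> real \<Rightarrow> 'c \<Rightarrow> bool" where
  "has_rs_integral mul h a s t I \<longleftrightarrow>
     (\<forall>\<epsilon>>0. \<exists>Q. is_partition s t Q \<and>
        (\<forall>P \<xi>. is_partition s t P \<and> set Q \<subseteq> set P \<and> rs_tags P \<xi> \<longrightarrow>
               norm (rs_sum mul h a P \<xi> - I) < \<epsilon>))"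

text \<open>(x,k) = SP_l(y). The condition \<open>\<integral>_0^t (x^i - l^i) dk^i = 0\<close> is taken
  as a Lebesgue--Stieltjes integral w.r.t. the measure dk^i on [0,t]
  (k extended by k_0 = 0 to negative times).\<close>
definition skorokhod :: "(real \<Rightarrow> real^'d) \<Rightarrow> (real \<Rightarrow> real^'d) \<Rightarrow> (real \<Rightarrow> real^'d)
     \<Rightarrow> (real \<Rightarrow> real^'d) \<Rightarrow> bool" where
  "skorokhod l y x k \<longleftrightarrow>
     (\<forall>t\<ge>0. x t = y t + k t \<and> (\<forall>i. l t $ i \<le> x t $ i)) \<and>
     k 0 = 0 \<and>
     (\<forall>i s t. 0 \<le> s \<and> s \<le> t \<longrightarrow> k s $ i \<le> k t $ i) \<and>
     (\<forall>i. \<forall>t\<ge>0. (\<integral>\<^sup>+ s \<in> {0..t}. ennreal (x s $ i - l s $ i)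
                     \<partial>interval_measure (\<lambda>s. k (max 0 s) $ i)) = 0)"

definition is_solution :: "real \<Rightarrow> (real^'d \<Rightarrow> real^'d) \<Rightarrow> (real^'d \<Rightarrow> real^'d^'d)
     \<Rightarrow> (real \<Rightarrow> real) \<Rightarrow> (real \<Rightarrow> real^'d) \<Rightarrow> (real \<Rightarrow> real^'d) \<Rightarrow> real^'d
     \<Rightarrow> (real \<Rightarrow> real^'d) \<Rightarrow> (real \<Rightarrow> real^'d) \<Rightarrow> bool" where
  "is_solution p f g a z l x0 x k \<longleftrightarrow>
     cadlag x \<and> cadlag k \<and> (\<forall>T\<ge>0. pvar p x 0 T < \<infinity>) \<and>
     (\<exists>y. skorokhod l y x k \<and>
        (\<forall>t\<ge>0. \<exists>I1 I2.
            has_rs_integral (\<lambda>u v. v *\<^sub>R u) (\<lambda>s. f (left_lim x s)) a 0 t I1 \<and>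
            has_rs_integral (\<lambda>M v. M *v v) (\<lambda>s. g (left_lim x s)) z 0 t I2 \<and>
            y t = x0 + I1 + I2))"

end

theory Submission
  imports Defs
begin

text \<open>Componentwise the Skorokhod problem is solved by \<open>k t = sup {max 0 (l s - y s) | s \<le> t}\<close>, and along any
  partition every increase (decrease) of the difference of two such running suprema is dominated by a value of
  the difference of the inputs inside the same subinterval; hence \<open>y \<mapsto> k\<close> is Lipschitz in \<open>p\<close>-variation as long as the
  starting values agree. So solutions are fixed points of the causal map
  \<open>\<Phi> x = Y x + kmap (l - Y x)\<close>, where \<open>Y x\<close> consists of the two integrals. These exist as Young integrals
  because \<open>p < 1 + \<alpha>\<close> and because the integrands are left continuous while the integrators are right continuous.

  The variation of \<open>\<Phi> x - \<Phi> x'\<close> after time \<open>u\<close> carries the factor \<open>W u v\<close>, the variation of the drivers, which tends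
  to zero as \<open>v\<close> decreases to \<open>u\<close>: this gives uniqueness, and Picard iteration continues a solution past any time. The linear
  growth of the coefficients bounds the variation of a solution on \<open>[s, v]\<close> uniformly in \<open>v < t\<close> once \<open>W s v\<close> is small,
  so a solution on \<open>[0, t)\<close> has a left limit at \<open>t\<close> and extends to \<open>[0, t]\<close>. Real induction on time concludes.\<close>

section \<open>p-variation and controls\<close>

text \<open>All estimates bound p-th powers of increments by superadditive functions of intervals,
  so that a bound on single increments becomes a bound on the variation (\<open>pv_control\<close>);
  the price is the factor \<open>2 powr p\<close> of \<open>powr_add_le\<close> in place of the
  triangle inequality. Three obstacles shape the argument. The drivers may jump, so refining a
  partition does not make their variation small on every cell. Young sums are therefore compared
  after a cut at a point, on each side of which only one of integrand and integrator is known to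
  vary little (\<open>powr_product_le\<close>). The barrier \<open>l\<close> is merely cadlag, so
  \<open>l - Y x\<close> may have infinite variation. In differences \<open>l\<close> cancels; for a
  single path only the oscillation of \<open>l\<close> enters, because the reflection term is
  monotone (\<open>kmap_osc\<close>). The difference of \<open>g\<close> along two paths is
  controlled in \<open>p / \<gamma>\<close>-variation only, through second differences and with a
  constant that depends on the size of both paths. The contraction thus holds on sets of bounded
  variation, and a separate growth bound has to keep the paths inside such sets.\<close>

definition fv :: "real \<Rightarrow> (real \<Rightarrow> 'a::real_normed_vector) \<Rightarrow> real \<Rightarrow> real \<Rightarrow> bool" where
  "fv p x s t \<longleftrightarrow> bdd_above (pvar_sum p x ` {P. is_partition s t P})"

text \<open>Junk unless \<open>fv p x s t\<close> holds: the supremum of an unbounded set of reals is unspecified.\<close>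

definition pv :: "real \<Rightarrow> (real \<Rightarrow> 'a::real_normed_vector) \<Rightarrow> real \<Rightarrow> real \<Rightarrow> real" where
  "pv p x s t = (SUP P\<in>{P. is_partition s t P}. pvar_sum p x P)"

text \<open>Controls in the sense of rough path theory, without continuity at the diagonal because
  paths with jumps are allowed. Superadditivity and nonnegativity still force
  \<open>w u u = 0\<close>.\<close>

definition super_on :: "real \<Rightarrow> real \<Rightarrow> (real \<Rightarrow> real \<Rightarrow> real) \<Rightarrow> bool" where
  "super_on s t w \<longleftrightarrow> (\<forall>u v. s \<le> u \<longrightarrow> u \<le> v \<longrightarrow> v \<le> t \<longrightarrow> 0 \<le> w u v) \<and>
     (\<forall>u v r. s \<le> u \<longrightarrow> u \<le> v \<longrightarrow> v \<le> r \<longrightarrow> r \<le> t \<longrightarrow> w u v + w v r \<le> w u r)"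

lemma super_onD:
  assumes "super_on s t w"
  shows "s \<le> u \<Longrightarrow> u \<le> v \<Longrightarrow> v \<le> t \<Longrightarrow> 0 \<le> w u v"
    and "s \<le> u \<Longrightarrow> u \<le> v \<Longrightarrow> v \<le> r \<Longrightarrow> r \<le> t \<Longrightarrow> w u v + w v r \<le> w u r"
  using assms unfolding super_on_def by blast+

lemma super_on_mono:
  assumes "super_on s t w" "s \<le> a" "a \<le> u" "u \<le> v" "v \<le> b" "b \<le> t"
  shows "w u v \<le> w a b"
proof -
  have "w a u + w u b \<le> w a b" "0 \<le> w a u" "w u v + w v b \<le> w u b" "0 \<le> w v b"
    using super_onD[OF assms(1)] assms by auto
  then show ?thesis by linarith
qed

lemma super_on_add: "super_on s t w \<Longrightarrow> super_on s t w' \<Longrightarrow> super_on s t (\<lambda>u v. w u v + w' u v)"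
  unfolding super_on_def by (smt (verit))

lemma super_on_cmult: "super_on s t w \<Longrightarrow> 0 \<le> (c::real) \<Longrightarrow> super_on s t (\<lambda>u v. c * w u v)"
  unfolding super_on_def by (metis distrib_left mult_left_mono mult_nonneg_nonneg)

lemma super_on_subset: "super_on s t w \<Longrightarrow> s \<le> s' \<Longrightarrow> t' \<le> t \<Longrightarrow> super_on s' t' w"
  unfolding super_on_def by (meson order_trans)

text \<open>With the time changes \<open>min _ u\<close> and \<open>max _ u\<close> this restricts a
  control to the times before and after \<open>u\<close>.\<close>

lemma super_on_comp:
  assumes "super_on s' t' w" "\<And>u v. s \<le> u \<Longrightarrow> u \<le> v \<Longrightarrow> v \<le> t \<Longrightarrow> m u \<le> m v"
    "\<And>u. s \<le> u \<Longrightarrow> u \<le> t \<Longrightarrow> s' \<le> m u \<and> m u \<le> t'"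
  shows "super_on s t (\<lambda>u v. w (m u) (m v))"
  unfolding super_on_def
proof (intro conjI allI impI)
  fix u v assume "s \<le> u" "u \<le> v" "v \<le> t"
  then show "0 \<le> w (m u) (m v)" using super_onD(1)[OF assms(1), of "m u" "m v"] assms by simp
next
  fix u v r assume "s \<le> u" "u \<le> v" "v \<le> r" "r \<le> t"
  then show "w (m u) (m v) + w (m v) (m r) \<le> w (m u) (m r)"
    using super_onD(2)[OF assms(1), of "m u" "m v" "m r"] assms by simp
qed

text \<open>For \<open>c = a\<close> and for \<open>c = b\<close> one has
  \<open>c powr p \<le> c * (a + b) powr (p - 1)\<close>; the sum of the two is the claim.\<close>

lemma powr_superadd:
  assumes "1 \<le> p" "0 \<le> a" "0 \<le> (b::real)"
  shows "a powr p + b powr p \<le> (a + b) powr p"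
proof (cases "a + b = 0")
  case True
  then show ?thesis using assms by (simp add: add_nonneg_eq_0_iff)
next
  case False
  then have pos: "a + b > 0" using assms by linarith
  have *: "c powr p \<le> c * (a + b) powr (p - 1)" if "0 \<le> c" "c \<le> a + b" for c
  proof (cases "c = 0")
    case False
    then have "c powr p = c * c powr (p - 1)" using that by (simp add: powr_mult_base)
    also have "\<dots> \<le> c * (a + b) powr (p - 1)"
      using that assms by (intro mult_left_mono powr_mono2) auto
    finally show ?thesis .
  qed (use assms in simp)
  have "a powr p + b powr p \<le> (a + b) * (a + b) powr (p - 1)"
    using *[of a] *[of b] assms by (simp add: distrib_right)
  also have "\<dots> = (a + b) powr p" using pos by (simp add: powr_mult_base)
  finally show ?thesis .
qed

lemma super_on_powr:
  assumes "super_on s t w" "1 \<le> p"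
  shows "super_on s t (\<lambda>u v. w u v powr p)"
  unfolding super_on_def
proof (intro conjI allI impI)
  fix u v r assume h: "s \<le> u" "u \<le> v" "v \<le> r" "r \<le> t"
  have n: "0 \<le> w u v" "0 \<le> w v r" using super_onD(1)[OF assms(1)] h by auto
  have "w u v powr p + w v r powr p \<le> (w u v + w v r) powr p"
    using powr_superadd n assms by blast
  also have "\<dots> \<le> w u r powr p"
    using n assms super_onD(2)[OF assms(1) h] by (intro powr_mono2) auto
  finally show "w u v powr p + w v r powr p \<le> w u r powr p" .
qed simp

text \<open>Replaces the triangle inequality wherever p-th powers of sums occur. The estimate
  through \<open>max a b\<close> is not sharp but serves every \<open>p \<ge> 0\<close>.\<close>

lemma powr_add_le:
  assumes "0 \<le> p" "0 \<le> a" "0 \<le> (b::real)"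
  shows "(a + b) powr p \<le> 2 powr p * (a powr p + b powr p)"
proof -
  have "(a + b) powr p \<le> (2 * max a b) powr p" using assms by (intro powr_mono2) auto
  also have "\<dots> = 2 powr p * max a b powr p" using assms by (simp add: powr_mult)
  also have "\<dots> \<le> 2 powr p * (a powr p + b powr p)"
    by (intro mult_left_mono) (auto simp: max_def)
  finally show ?thesis .
qed

section \<open>Partitions as strictly increasing lists\<close>

lemma is_partition_single [simp]: "is_partition s t [r] \<longleftrightarrow> r = s \<and> r = t"
  by (auto simp: is_partition_def)

lemma is_partition_Cons:
  assumes "P \<noteq> []"
  shows "is_partition s t (r # P) \<longleftrightarrow> r = s \<and> s < hd P \<and> is_partition (hd P) t P"
proof -
  obtain b Q where P: "P = b # Q" using assms by (cases P) auto
  show ?thesis unfolding is_partition_def P by auto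
qed

text \<open>Peels off the left end while the right end \<open>t\<close> stays fixed, which matches
  the recursion over \<open>Cons\<close> of both \<open>pvar_sum\<close> and
  \<open>rs_sum\<close>.\<close>

lemma is_partition_induct [consumes 1, case_names single Cons]:
  assumes "is_partition s t P"
    and "R t [t]"
    and "\<And>s u P. s < u \<Longrightarrow> u \<le> t \<Longrightarrow> is_partition u t P \<Longrightarrow> hd P = u \<Longrightarrow> P \<noteq> [] \<Longrightarrow> R u P \<Longrightarrow> R s (s # P)"
  shows "R s P"
proof -
  have "s \<le> t \<and> R s P" using assms(1)
  proof (induction P arbitrary: s)
    case Nil
    then show ?case by (simp add: is_partition_def)
  next
    case (Cons r P)
    show ?case
    proof (cases "P = []")
      case True
      then show ?thesis using Cons.prems assms(2) by auto
    next
      case False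
      then have *: "r = s" "s < hd P" "is_partition (hd P) t P"
        using Cons.prems is_partition_Cons by auto
      then have "hd P \<le> t" "R (hd P) P" using Cons.IH by auto
      then show ?thesis using assms(3)[of s "hd P" P] * False by auto
    qed
  qed
  then show ?thesis by simp
qed

lemma is_partition_le: "is_partition s t P \<Longrightarrow> s \<le> t"
  by (induction rule: is_partition_induct) auto

lemma is_partition_ne: "is_partition s t P \<Longrightarrow> P \<noteq> []"
  by (simp add: is_partition_def)

lemma is_partition_hd: "is_partition s t P \<Longrightarrow> hd P = s"
  by (simp add: is_partition_def)

lemma is_partition_set: "is_partition s t P \<Longrightarrow> set P \<subseteq> {s..t}"
  by (induction rule: is_partition_induct) auto

lemma partition_ends: "is_partition s t P \<Longrightarrow> s \<in> set P \<and> t \<in> set P"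
  unfolding is_partition_def by auto

lemma partition_exists: "s \<le> t \<Longrightarrow> \<exists>P. is_partition s t P"
proof (cases "s = t")
  case True then show ?thesis by (intro exI[of _ "[s]"]) auto
next
  case False assume "s \<le> t"
  then show ?thesis using False by (intro exI[of _ "[s,t]"]) (auto simp: is_partition_def)
qed

lemma partition_degenerate: "is_partition s s P \<Longrightarrow> P = [s]"
proof -
  assume P: "is_partition s s P"
  show "P = [s]"
  proof (cases P)
    case (Cons r Q)
    then show ?thesis using P is_partition_Cons[of Q s s r] is_partition_le[of "hd Q" s Q] by (cases "Q = []") auto
  qed (use P in \<open>simp add: is_partition_def\<close>)
qed

text \<open>Turns finite sets into partitions, so that a common refinement is a union of
  sets.\<close>

lemma partition_of_set:
  assumes "finite A" "s \<in> A" "t \<in> A" "A \<subseteq> {s..t}"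
  shows "is_partition s t (sorted_list_of_set A)"
proof -
  have ne: "A \<noteq> {}" using assms by auto
  have "hd (sorted_list_of_set A) = Min A"
    using assms(1) ne by (simp add: sorted_list_of_set_nonempty)
  moreover have "Min A = s" using assms by (intro Min_eqI) auto
  moreover have "last (sorted_list_of_set A) = t"
  proof -
    define L where "L = sorted_list_of_set A"
    have eq: "butlast L @ [last L] = L" using assms ne by (simp add: L_def)
    have "sorted L" by (simp add: L_def)
    then have "sorted (butlast L @ [last L])" using eq by simp
    then have "\<forall>y\<in>set (butlast L). y \<le> last L" unfolding sorted_append by simp
    then have "\<forall>y\<in>set (butlast L @ [last L]). y \<le> last L" by auto
    then have "\<forall>y\<in>set L. y \<le> last L" unfolding eq .
    then have "t \<le> last (sorted_list_of_set A)" using assms by (simp add: L_def)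
    moreover have "last (sorted_list_of_set A) \<in> A"
      using assms(1) ne by (metis last_in_set set_sorted_list_of_set sorted_list_of_set_eq_Nil_iff)
    ultimately show ?thesis using assms by force
  qed
  ultimately show ?thesis unfolding is_partition_def
    using assms ne by simp
qed

section \<open>Variation: controls, restriction, concatenation, limits\<close>

lemma pvar_sum_single [simp]: "pvar_sum p x [s] = 0"
  by (simp add: pvar_sum_def)

lemma pvar_sum_Cons:
  assumes "P \<noteq> []"
  shows "pvar_sum p x (s # P) = norm (x (hd P) - x s) powr p + pvar_sum p x P"
proof -
  obtain b Q where P: "P = b # Q" using assms by (cases P) auto
  show ?thesis unfolding pvar_sum_def P by (simp add: sum.lessThan_Suc_shift del: sum.lessThan_Suc)
qed

lemma pvar_sum_nonneg: "0 \<le> pvar_sum p x P"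
  unfolding pvar_sum_def by (intro sum_nonneg) auto

lemma pvar_sum_le_control:
  assumes "super_on s t w" "\<And>u v. s \<le> u \<Longrightarrow> u < v \<Longrightarrow> v \<le> t \<Longrightarrow> norm (x v - x u) powr p \<le> w u v"
    "is_partition s t P"
  shows "pvar_sum p x P \<le> w s t"
proof -
  have "s \<le> a \<longrightarrow> pvar_sum p x P \<le> w a t" if "is_partition a t P" for a P
    using that
  proof (induction rule: is_partition_induct)
    case single
    then show ?case using super_onD(1)[OF assms(1), of t t] by simp
  next
    case (Cons a u P)
    show ?case
    proof
      assume "s \<le> a"
      then have "norm (x u - x a) powr p \<le> w a u" "w a u + w u t \<le> w a t" "pvar_sum p x P \<le> w u t"
        using Cons assms(2) super_onD(2)[OF assms(1), of a u t] by auto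
      then show "pvar_sum p x (a # P) \<le> w a t" using Cons by (simp add: pvar_sum_Cons)
    qed
  qed
  then show ?thesis using assms(3) by blast
qed

text \<open>\<open>tl Q\<close> drops the point \<open>u\<close>, which both partitions
  contain.\<close>

lemma partition_join:
  assumes "is_partition s u P" "is_partition u t Q"
  shows "is_partition s t (P @ tl Q) \<and> set (P @ tl Q) = set P \<union> set Q \<and>
         pvar_sum p x (P @ tl Q) = pvar_sum p x P + pvar_sum p x Q"
  using assms(1)
proof (induction rule: is_partition_induct)
  case single
  have eq: "[u] @ tl Q = Q" using assms(2) by (cases Q) (auto simp: is_partition_def)
  have "u \<in> set Q" using partition_ends assms(2) by blast
  then show ?case unfolding eq using assms(2) by auto
next
  case (Cons s v P)
  then have ne: "P @ tl Q \<noteq> []" "hd (P @ tl Q) = v" by auto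
  show ?case using Cons ne is_partition_Cons[OF ne(1), of s t s]
    by (simp add: pvar_sum_Cons)
qed

lemma fvI:
  assumes "\<And>P. is_partition s t P \<Longrightarrow> pvar_sum p x P \<le> B"
  shows "fv p x s t"
  unfolding fv_def using assms by (auto intro!: bdd_aboveI2)

lemma pv_le:
  assumes "s \<le> t" "\<And>P. is_partition s t P \<Longrightarrow> pvar_sum p x P \<le> B"
  shows "pv p x s t \<le> B"
  unfolding pv_def using assms partition_exists[of s t] by (intro cSUP_least) auto

lemma le_pv: "fv p x s t \<Longrightarrow> is_partition s t P \<Longrightarrow> pvar_sum p x P \<le> pv p x s t"
  unfolding pv_def fv_def by (intro cSUP_upper) auto

lemma pv_nonneg: "fv p x s t \<Longrightarrow> s \<le> t \<Longrightarrow> 0 \<le> pv p x s t"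
  by (meson le_pv order_trans partition_exists pvar_sum_nonneg)

text \<open>The main tool for variation bounds: only single increments need to be dominated by a
  control.\<close>

lemma pv_control:
  assumes "super_on s t w" "\<And>u v. s \<le> u \<Longrightarrow> u < v \<Longrightarrow> v \<le> t \<Longrightarrow> norm (x v - x u) powr p \<le> w u v"
  shows "fv p x s t" and "s \<le> t \<Longrightarrow> pv p x s t \<le> w s t"
  using pvar_sum_le_control[OF assms] by (auto intro: fvI pv_le)

lemma fv_subset:
  assumes "fv p x s t" "s \<le> u" "u \<le> v" "v \<le> t"
  shows "fv p x u v"
proof (rule fvI)
  fix P assume P: "is_partition u v P"
  obtain P1 P2 where P12: "is_partition s u P1" "is_partition v t P2"
    using partition_exists assms by metis
  have j1: "is_partition s v (P1 @ tl P)" "pvar_sum p x (P1 @ tl P) = pvar_sum p x P1 + pvar_sum p x P"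
    using partition_join[OF P12(1) P] by auto
  have "is_partition s t ((P1 @ tl P) @ tl P2)" "pvar_sum p x ((P1 @ tl P) @ tl P2) = pvar_sum p x P1 + pvar_sum p x P + pvar_sum p x P2"
    using partition_join[OF j1(1) P12(2), of p x] j1(2) by auto
  then show "pvar_sum p x P \<le> pv p x s t"
    using le_pv[OF assms(1)] pvar_sum_nonneg[of p x P1] pvar_sum_nonneg[of p x P2] by fastforce
qed

lemma pv_superadd:
  assumes "fv p x s t" "s \<le> u" "u \<le> t"
  shows "pv p x s u + pv p x u t \<le> pv p x s t"
proof -
  have "pv p x u t \<le> pv p x s t - pvar_sum p x P1" if P1: "is_partition s u P1" for P1
  proof (rule pv_le[OF assms(3)])
    fix P2 assume "is_partition u t P2"
    then show "pvar_sum p x P2 \<le> pv p x s t - pvar_sum p x P1"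
      using partition_join[OF P1, of t P2 p x] le_pv[OF assms(1)] by fastforce
  qed
  then have "pv p x s u \<le> pv p x s t - pv p x u t"
    using assms by (intro pv_le) (auto simp: algebra_simps)
  then show ?thesis by simp
qed

lemma super_on_pv: "fv p x s t \<Longrightarrow> super_on s t (pv p x)"
  unfolding super_on_def
  by (metis fv_subset order_trans pv_nonneg pv_superadd)

lemma pv_mono: "fv p x s t \<Longrightarrow> s \<le> u \<Longrightarrow> u \<le> v \<Longrightarrow> v \<le> t \<Longrightarrow> pv p x u v \<le> pv p x s t"
  using super_on_mono[OF super_on_pv] by blast

lemma incr_le_pv:
  assumes "fv p x s t" "s \<le> u" "u \<le> v" "v \<le> t"
  shows "norm (x v - x u) powr p \<le> pv p x u v"
proof (cases "u = v")
  case True then show ?thesis using pv_nonneg[OF fv_subset[OF assms]] by simp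
next
  case False
  then have "is_partition u v [u,v]" using assms by (simp add: is_partition_def)
  then have "pvar_sum p x [u,v] \<le> pv p x u v" using le_pv fv_subset[OF assms] by blast
  then show ?thesis by (simp add: pvar_sum_def)
qed

lemma incr_le_pv_root:
  assumes "fv p x s t" "s \<le> u" "u \<le> v" "v \<le> t" "0 < p"
  shows "norm (x v - x u) \<le> pv p x u v powr (1/p)"
proof -
  have "norm (x v - x u) = (norm (x v - x u) powr p) powr (1/p)"
    using assms by (simp add: powr_powr)
  also have "\<dots> \<le> pv p x u v powr (1/p)"
    using incr_le_pv[OF assms(1-4)] assms by (intro powr_mono2) auto
  finally show ?thesis .
qed

lemma pvar_sum_cong: "(\<And>u. u \<in> set P \<Longrightarrow> x u = y u) \<Longrightarrow> pvar_sum p x P = pvar_sum p y P"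
  unfolding pvar_sum_def by (intro sum.cong) auto

lemma fv_pv_cong:
  assumes "\<And>u. s \<le> u \<Longrightarrow> u \<le> t \<Longrightarrow> x u = y u"
  shows "fv p x s t = fv p y s t" "pv p x s t = pv p y s t"
proof -
  have "pvar_sum p x P = pvar_sum p y P" if "is_partition s t P" for P
    using is_partition_set[OF that] assms by (intro pvar_sum_cong) auto
  then show "fv p x s t = fv p y s t" "pv p x s t = pv p y s t"
    unfolding fv_def pv_def by (simp_all cong: image_cong_simp)
qed

text \<open>An increment straddling \<open>u\<close> is cut there, at the cost of
  \<open>2 powr p\<close>. Clamping both endpoints with \<open>min _ u\<close> and
  \<open>max _ u\<close> lets one formula also cover the increments on either side.\<close>

lemma fv_pv_concat:
  assumes "fv p x s u" "fv p x u t" "s \<le> u" "u \<le> t" "0 \<le> p"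
  shows "fv p x s t" "pv p x s t \<le> 2 powr p * (pv p x s u + pv p x u t)"
proof -
  let ?w = "\<lambda>a b. 2 powr p * (pv p x (min a u) (min b u) + pv p x (max a u) (max b u))"
  have sup: "super_on s t ?w"
    by (intro super_on_cmult super_on_add super_on_comp[OF super_on_pv[OF assms(1)], of s t "\<lambda>a. min a u"]
       super_on_comp[OF super_on_pv[OF assms(2)], of s t "\<lambda>a. max a u"]) (use assms in auto)
  have inc: "norm (x b - x a) powr p \<le> ?w a b" if "s \<le> a" "a < b" "b \<le> t" for a b
  proof -
    have "x b - x a = (x (min b u) - x (min a u)) + (x (max b u) - x (max a u))"
      using that by (auto simp: min_def max_def)
    then have "norm (x b - x a) \<le> norm (x (min b u) - x (min a u)) + norm (x (max b u) - x (max a u))"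
      by (metis norm_triangle_ineq)
    then have "norm (x b - x a) powr p \<le> (norm (x (min b u) - x (min a u)) + norm (x (max b u) - x (max a u))) powr p"
      using assms by (intro powr_mono2) auto
    also have "\<dots> \<le> 2 powr p * (norm (x (min b u) - x (min a u)) powr p + norm (x (max b u) - x (max a u)) powr p)"
      using assms by (intro powr_add_le) auto
    also have "\<dots> \<le> ?w a b"
      using that assms by (intro mult_left_mono add_mono incr_le_pv[OF assms(1)] incr_le_pv[OF assms(2)]) auto
    finally show ?thesis .
  qed
  show "fv p x s t" using pv_control(1)[OF sup inc] .
  have "pv p x s t \<le> ?w s t" using pv_control(2)[OF sup inc] assms by auto
  then show "pv p x s t \<le> 2 powr p * (pv p x s u + pv p x u t)" using assms by (simp add: min_absorb1 min_absorb2 max_absorb1 max_absorb2)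
qed

lemma fv_pv_add:
  assumes "fv p x s t" "fv p y s t" "s \<le> t" "0 \<le> p"
  shows "fv p (\<lambda>r. x r + y r) s t" "pv p (\<lambda>r. x r + y r) s t \<le> 2 powr p * (pv p x s t + pv p y s t)"
proof -
  let ?w = "\<lambda>a b. 2 powr p * (pv p x a b + pv p y a b)"
  have sup: "super_on s t ?w"
    using assms by (intro super_on_cmult super_on_add super_on_pv) auto
  have inc: "norm ((x b + y b) - (x a + y a)) powr p \<le> ?w a b" if "s \<le> a" "a < b" "b \<le> t" for a b
  proof -
    have "norm ((x b + y b) - (x a + y a)) powr p \<le> (norm (x b - x a) + norm (y b - y a)) powr p"
      using assms norm_triangle_ineq[of "x b - x a" "y b - y a"] by (intro powr_mono2) (auto simp: algebra_simps)
    also have "\<dots> \<le> 2 powr p * (norm (x b - x a) powr p + norm (y b - y a) powr p)"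
      using assms by (intro powr_add_le) auto
    also have "\<dots> \<le> ?w a b"
      using that assms by (intro mult_left_mono add_mono incr_le_pv[OF assms(1)] incr_le_pv[OF assms(2)]) auto
    finally show ?thesis .
  qed
  show "fv p (\<lambda>r. x r + y r) s t" using pv_control(1)[OF sup inc] .
  show "pv p (\<lambda>r. x r + y r) s t \<le> 2 powr p * (pv p x s t + pv p y s t)"
    using pv_control(2)[OF sup inc] assms by auto
qed

lemma fv_pv_uminus: "fv p (\<lambda>r. - x r) s t = fv p x s t" "pv p (\<lambda>r. - x r) s t = pv p x s t"
proof -
  have "norm (- x b - - x a) = norm (x b - x a)" for a b
    by (metis minus_diff_eq norm_minus_cancel uminus_add_conv_diff add.commute diff_minus_eq_add)
  then have "pvar_sum p (\<lambda>r. - x r) P = pvar_sum p x P" for P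
    unfolding pvar_sum_def by simp
  then show "fv p (\<lambda>r. - x r) s t = fv p x s t" "pv p (\<lambda>r. - x r) s t = pv p x s t"
    unfolding fv_def pv_def by auto
qed

lemma fv_pv_diff:
  assumes "fv p x s t" "fv p y s t" "s \<le> t" "0 \<le> p"
  shows "fv p (\<lambda>r. x r - y r) s t" "pv p (\<lambda>r. x r - y r) s t \<le> 2 powr p * (pv p x s t + pv p y s t)"
  using fv_pv_add[OF assms(1) _ assms(3,4), of "\<lambda>r. - y r"] assms by (auto simp: fv_pv_uminus)

text \<open>Since \<open>x u = 0\<close>, an increment straddling \<open>u\<close> equals its part
  after \<open>u\<close>, so the factor \<open>2 powr p\<close> of a concatenation is
  avoided.\<close>

lemma fv_pv_vanish:
  assumes "\<And>r. s \<le> r \<Longrightarrow> r \<le> u \<Longrightarrow> x r = 0" "fv p x u t" "s \<le> u" "u \<le> t"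
  shows "fv p x s t" "pv p x s t \<le> pv p x u t"
proof -
  let ?w = "\<lambda>a b. pv p x (max a u) (max b u)"
  have sup: "super_on s t ?w"
    by (intro super_on_comp[OF super_on_pv[OF assms(2)], of s t "\<lambda>a. max a u"]) (use assms in auto)
  have inc: "norm (x b - x a) powr p \<le> ?w a b" if "s \<le> a" "a < b" "b \<le> t" for a b
  proof -
    have "x b - x a = x (max b u) - x (max a u)" using that assms(1)[of a] assms(1)[of b] assms(1)[of u] assms(3)
      by (auto simp: max_def)
    then show ?thesis using that assms incr_le_pv[OF assms(2), of "max a u" "max b u"] by auto
  qed
  show "fv p x s t" using pv_control(1)[OF sup inc] .
  show "pv p x s t \<le> pv p x u t" using pv_control(2)[OF sup inc] assms by (simp add: max_def)
qed

lemma fv_pv_compose_mono: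
  assumes "fv p x s' t'" "\<And>u v. s \<le> u \<Longrightarrow> u \<le> v \<Longrightarrow> v \<le> t \<Longrightarrow> m u \<le> m v"
    "\<And>u. s \<le> u \<Longrightarrow> u \<le> t \<Longrightarrow> s' \<le> m u \<and> m u \<le> t'" "s \<le> t"
  shows "fv p (\<lambda>u. x (m u)) s t" "pv p (\<lambda>u. x (m u)) s t \<le> pv p x (m s) (m t)"
proof -
  have sup: "super_on s t (\<lambda>u v. pv p x (m u) (m v))"
    using super_on_comp[OF super_on_pv[OF assms(1)]] assms(2,3) by blast
  have inc: "norm (x (m v) - x (m u)) powr p \<le> pv p x (m u) (m v)" if "s \<le> u" "u < v" "v \<le> t" for u v
    using that assms incr_le_pv[OF assms(1), of "m u" "m v"] by auto
  show "fv p (\<lambda>u. x (m u)) s t" "pv p (\<lambda>u. x (m u)) s t \<le> pv p x (m s) (m t)"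
    using pv_control[OF sup inc] assms(4) by auto
qed

lemma pvar_less_infinity_iff:
  assumes "s \<le> t"
  shows "pvar p x s t < \<infinity> \<longleftrightarrow> fv p x s t"
proof
  assume "pvar p x s t < \<infinity>"
  moreover have "ereal (pvar_sum p x P) \<le> pvar p x s t" if "is_partition s t P" for P
    unfolding pvar_def using that by (intro SUP_upper) auto
  moreover obtain P0 where "is_partition s t P0" using partition_exists assms by blast
  ultimately have le: "\<bar>pvar p x s t\<bar> \<noteq> \<infinity>" "\<And>P. is_partition s t P \<Longrightarrow> ereal (pvar_sum p x P) \<le> pvar p x s t"
    by fastforce+
  then obtain B where "pvar p x s t = ereal B" by (cases "pvar p x s t") auto
  then show "fv p x s t" using le(2) by (intro fvI[of _ _ _ _ B]) auto
next
  assume "fv p x s t"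
  then have "pvar p x s t \<le> ereal (pv p x s t)"
    unfolding pvar_def by (intro SUP_least) (auto intro: le_pv)
  then show "pvar p x s t < \<infinity>" by auto
qed

text \<open>Lower semicontinuity of the variation under pointwise limits: the sum over a fixed
  partition involves finitely many values.\<close>

lemma fv_pv_tendsto:
  assumes "\<And>u. s \<le> u \<Longrightarrow> u \<le> t \<Longrightarrow> ((\<lambda>n. X n u) \<longlongrightarrow> x u) F" "F \<noteq> bot" "0 < p" "s \<le> t"
    "eventually (\<lambda>n. fv p (X n) s t \<and> pv p (X n) s t \<le> B) F"
  shows "fv p x s t" "pv p x s t \<le> B"
proof -
  have "pvar_sum p x P \<le> B" if P: "is_partition s t P" for P
  proof (rule tendsto_upperbound[OF _ _ assms(2)])
    have mem: "s \<le> P ! i \<and> P ! i \<le> t" if "i < length P" for i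
      using is_partition_set[OF P] nth_mem[OF that] by auto
    show "((\<lambda>n. pvar_sum p (X n) P) \<longlongrightarrow> pvar_sum p x P) F"
      unfolding pvar_sum_def
      by (intro tendsto_sum tendsto_powr' tendsto_norm tendsto_diff assms(1) tendsto_const)
         (use mem assms(3) in auto)
    show "eventually (\<lambda>n. pvar_sum p (X n) P \<le> B) F"
      using assms(5) by eventually_elim (use le_pv[OF _ P] in fastforce)
  qed
  then show "fv p x s t" "pv p x s t \<le> B" using assms by (auto intro: fvI pv_le)
qed

section \<open>One-sided limits and small variation\<close>

lemma fv_pv_same: "fv p x s s" "pv p x s s = 0"
proof -
  have *: "pvar_sum p x P = 0" if "is_partition s s P" for P
    using partition_degenerate[OF that] by simp
  show "fv p x s s" using * by (intro fvI[of _ _ _ _ 0]) auto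
  then show "pv p x s s = 0" using pv_le[of s s p x 0] pv_nonneg[of p x s s] * by force
qed

text \<open>Away from \<open>t\<close> finiteness suffices: if \<open>pv p x v0 T\<close> nearly
  exhausts its supremum over \<open>v > t\<close>, superadditivity leaves at most \<open>e\<close>
  between \<open>u\<close> and \<open>v0\<close> for every \<open>u > t\<close>. Right continuity
  then lets the first point of a partition slide down to \<open>t\<close>.\<close>

lemma pv_right_small:
  assumes lim: "(x \<longlongrightarrow> x t) (at_right t)" and fv: "fv p x t T" and "t < T" "0 < e" "0 < p"
  shows "\<exists>d>0. t + d \<le> T \<and> pv p x t (t + d) \<le> e"
proof -
  let ?L = "SUP v\<in>{t<..T}. pv p x v T"
  have bdd: "bdd_above ((\<lambda>v. pv p x v T) ` {t<..T})"
    by (rule bdd_aboveI2[of _ _ "pv p x t T"]) (auto intro: pv_mono[OF fv])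
  have "?L - e < ?L" using \<open>0 < e\<close> by simp
  then obtain v0 where v0: "t < v0" "v0 \<le> T" "?L - e < pv p x v0 T"
    using less_cSUP_iff[OF _ bdd] \<open>t < T\<close> by auto
  have small: "pv p x u v0 \<le> e" if "t < u" "u \<le> v0" for u
  proof -
    have "pv p x u v0 + pv p x v0 T \<le> pv p x u T"
      using that v0 fv_subset[OF fv, of u T] by (intro pv_superadd) auto
    moreover have "pv p x u T \<le> ?L" using that v0 by (intro cSUP_upper bdd) auto
    ultimately show ?thesis using v0 by linarith
  qed
  have "pv p x t v0 \<le> e"
  proof (rule pv_le)
    fix P assume P: "is_partition t v0 P"
    obtain Q where Q: "P = t # Q" "Q \<noteq> []"
      using P v0 by (cases P) (auto simp: is_partition_def split: if_splits)
    define u where "u = hd Q"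
    have u: "t < u" "is_partition u v0 Q" using P Q is_partition_Cons u_def by auto
    then have uv: "u \<le> v0" using is_partition_le by blast
    have "((\<lambda>r. norm (x u - x r) powr p + pvar_sum p x Q) \<longlongrightarrow> norm (x u - x t) powr p + pvar_sum p x Q) (at_right t)"
      by (intro tendsto_intros tendsto_powr' lim) (use \<open>0 < p\<close> in auto)
    moreover have "eventually (\<lambda>r. norm (x u - x r) powr p + pvar_sum p x Q \<le> e) (at_right t)"
      using eventually_at_right_real[OF u(1)]
    proof eventually_elim
      case (elim r)
      then have "is_partition r v0 (r # Q)" using Q u by (simp add: is_partition_Cons u_def)
      then have "pvar_sum p x (r # Q) \<le> pv p x r v0"
        using elim uv v0 fv_subset[OF fv, of r v0] by (intro le_pv) auto
      also have "\<dots> \<le> e" using small elim uv by auto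
      finally show ?case using Q by (simp add: pvar_sum_Cons u_def)
    qed
    ultimately have "norm (x u - x t) powr p + pvar_sum p x Q \<le> e"
      by (rule tendsto_upperbound) simp
    then show "pvar_sum p x P \<le> e" using Q by (simp add: pvar_sum_Cons u_def)
  qed (use v0 in simp)
  then show ?thesis using v0 by (intro exI[of _ "v0 - t"]) auto
qed

text \<open>The variation from \<open>r\<close> is increasing and bounded, so little of it remains
  near \<open>t\<close>. The endpoint \<open>t\<close> is excluded, hence a jump there does no
  harm.\<close>

lemma pv_left_half_small:
  assumes bd: "\<And>v. r \<le> v \<Longrightarrow> v < t \<Longrightarrow> fv p x r v \<and> pv p x r v \<le> B" and "r < t" "0 < e"
  shows "\<exists>s. r \<le> s \<and> s < t \<and> (\<forall>u v. s \<le> u \<longrightarrow> u \<le> v \<longrightarrow> v < t \<longrightarrow> pv p x u v \<le> e)"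
proof -
  let ?L = "SUP v\<in>{r..<t}. pv p x r v"
  have bdd: "bdd_above ((\<lambda>v. pv p x r v) ` {r..<t})"
    by (rule bdd_aboveI2[of _ _ B]) (use bd in auto)
  have "?L - e < ?L" using \<open>0 < e\<close> by simp
  then obtain s where s: "r \<le> s" "s < t" "?L - e < pv p x r s"
    using less_cSUP_iff[OF _ bdd] \<open>r < t\<close> by auto
  have "pv p x u v \<le> e" if "s \<le> u" "u \<le> v" "v < t" for u v
  proof -
    have "pv p x u v \<le> pv p x s v"
      using fv_subset[of p x r v s v] bd s that by (intro pv_mono) auto
    moreover have "pv p x r s + pv p x s v \<le> pv p x r v" using bd s that by (intro pv_superadd) auto
    moreover have "pv p x r v \<le> ?L" using that s by (intro cSUP_upper bdd) auto
    ultimately show ?thesis using s by linarith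
  qed
  then show ?thesis using s by auto
qed

lemma fv_left_limit:
  fixes x :: "real \<Rightarrow> 'a::banach"
  assumes bd: "\<And>v. r \<le> v \<Longrightarrow> v < t \<Longrightarrow> fv p x r v \<and> pv p x r v \<le> B" and "r < t" "0 < p"
  shows "\<exists>L. (x \<longlongrightarrow> L) (at_left t)"
proof -
  have "\<exists>P. eventually P (at_left t) \<and> (\<forall>u v. P u \<and> P v \<longrightarrow> dist (x u) (x v) < e)" if "0 < e" for e
  proof -
    have "0 < (e / 2) powr p" using that by simp
    then obtain s where s: "r \<le> s" "s < t"
      "\<And>u v. s \<le> u \<Longrightarrow> u \<le> v \<Longrightarrow> v < t \<Longrightarrow> pv p x u v \<le> (e / 2) powr p"
      using pv_left_half_small[of r t p x B "(e / 2) powr p"] bd assms(2) by metis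
    have *: "norm (x v - x u) < e" if "s < u" "u \<le> v" "v < t" for u v
    proof -
      have "norm (x v - x u) \<le> pv p x u v powr (1/p)"
        using bd[of v] that s assms(3) by (intro incr_le_pv_root[of p x r v]) auto
      also have "\<dots> \<le> ((e / 2) powr p) powr (1/p)"
        using s that assms(3) bd[of v] fv_subset[of p x r v u v]
        by (intro powr_mono2 s pv_nonneg) auto
      also have "\<dots> = e / 2" using \<open>0 < e\<close> assms(3) by (simp add: powr_powr)
      finally show ?thesis using \<open>0 < e\<close> by simp
    qed
    have "dist (x u) (x v) < e" if "s < u" "u < t" "s < v" "v < t" for u v
      using *[of u v] *[of v u] that by (cases "u \<le> v") (auto simp: dist_norm norm_minus_commute)
    then show ?thesis
      using eventually_at_left_real[OF s(2)] by (intro exI[of _ "\<lambda>u. u \<in> {s<..<t}"]) auto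
  qed
  then have "cauchy_filter (filtermap x (at_left t))"
    unfolding cauchy_filter_metric_filtermap by blast
  moreover have "complete (UNIV::'a set)"
    by (meson Cauchy_convergent UNIV_I complete_def convergent_def)
  ultimately obtain L where "(x \<longlongrightarrow> L) (at_left t)"
    using complete_uniform[where S="UNIV::'a set"] by (force simp add: filterlim_def trivial_limit_at_left_real)
  then show ?thesis by blast
qed

section \<open>Left limits and cadlag paths\<close>

lemma left_lim_eqI:
  fixes x :: "real \<Rightarrow> 'a::t2_space"
  shows "(x \<longlongrightarrow> L) (at_left t) \<Longrightarrow> 0 < t \<Longrightarrow> left_lim x t = L"
  unfolding left_lim_def by (simp add: tendsto_Lim trivial_limit_at_left_real)

lemma tendsto_left_lim:
  fixes x :: "real \<Rightarrow> 'a::t2_space"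
  assumes "cadlag x" "0 < t"
  shows "(x \<longlongrightarrow> left_lim x t) (at_left t)"
  using assms left_lim_eqI unfolding cadlag_def by metis

lemma cadlag_right: "cadlag x \<Longrightarrow> 0 \<le> t \<Longrightarrow> (x \<longlongrightarrow> x t) (at_right t)"
  unfolding cadlag_def by blast

lemma cadlagI:
  "(\<And>t. 0 \<le> t \<Longrightarrow> (x \<longlongrightarrow> x t) (at_right t)) \<Longrightarrow> (\<And>t. 0 < t \<Longrightarrow> \<exists>L. (x \<longlongrightarrow> L) (at_left t)) \<Longrightarrow> cadlag x"
  unfolding cadlag_def by blast

lemma left_lim_0 [simp]: "left_lim x 0 = x 0"
  by (simp add: left_lim_def)

text \<open>Only values strictly before \<open>t\<close> count, which is the source of the causality
  of the solution map. For \<open>t \<le> 0\<close> the convention \<open>left_lim x t = x 0\<close>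
  has to be matched separately.\<close>

lemma left_lim_cong:
  fixes x y :: "real \<Rightarrow> 'a::t2_space"
  assumes "\<And>s. 0 \<le> s \<Longrightarrow> s < t \<Longrightarrow> x s = y s" "t \<le> 0 \<Longrightarrow> x 0 = y 0"
  shows "left_lim x t = left_lim y t"
proof (cases "t \<le> 0")
  case False
  then have "eventually (\<lambda>s. x s = y s) (at_left t)"
    using eventually_at_left_real[of 0 t] assms(1) by (auto elim!: eventually_mono)
  then have "(x \<longlongrightarrow> l) (at_left t) = (y \<longlongrightarrow> l) (at_left t)" for l
    by (rule tendsto_cong)
  then show ?thesis unfolding left_lim_def Topological_Spaces.Lim_def using False by simp
qed (use assms in \<open>simp add: left_lim_def\<close>)

lemma cadlag_compose:
  fixes x :: "real \<Rightarrow> 'a::t2_space" and \<phi> :: "'a \<Rightarrow> 'b::t2_space"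
  assumes "continuous_on UNIV \<phi>" "cadlag x"
  shows "cadlag (\<lambda>t. \<phi> (x t))"
proof (rule cadlagI)
  have *: "isCont \<phi> u" for u using assms(1) by (simp add: continuous_on_eq_continuous_at)
  show "((\<lambda>t. \<phi> (x t)) \<longlongrightarrow> \<phi> (x t)) (at_right t)" if "0 \<le> t" for t
    by (rule isCont_tendsto_compose[OF * cadlag_right[OF assms(2) that]])
  show "\<exists>L. ((\<lambda>t. \<phi> (x t)) \<longlongrightarrow> L) (at_left t)" if "0 < t" for t
    using isCont_tendsto_compose[OF * tendsto_left_lim[OF assms(2) that]] by blast
qed

lemma left_lim_compose:
  fixes x :: "real \<Rightarrow> 'a::t2_space" and \<phi> :: "'a \<Rightarrow> 'b::t2_space"
  assumes "continuous_on UNIV \<phi>" "cadlag x" "0 \<le> t"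
  shows "left_lim (\<lambda>t. \<phi> (x t)) t = \<phi> (left_lim x t)"
proof (cases "t = 0")
  case False
  then have "((\<lambda>t. \<phi> (x t)) \<longlongrightarrow> \<phi> (left_lim x t)) (at_left t)"
    using assms tendsto_left_lim[of x t] unfolding continuous_on_eq_continuous_at[OF open_UNIV]
    by (auto intro: isCont_tendsto_compose)
  then show ?thesis using False assms by (intro left_lim_eqI) auto
qed simp

lemma cadlag_const: "cadlag (\<lambda>_. c)"
  unfolding cadlag_def by (auto intro!: exI tendsto_const)

lemma cadlag_add:
  fixes x y :: "real \<Rightarrow> 'a::real_normed_vector"
  assumes "cadlag x" "cadlag y" shows "cadlag (\<lambda>t. x t + y t)"
proof (rule cadlagI)
  show "\<exists>L. ((\<lambda>t. x t + y t) \<longlongrightarrow> L) (at_left t)" if "0 < t" for t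
    using tendsto_add[OF assms[THEN tendsto_left_lim[OF _ that]]] by blast
qed (intro tendsto_add cadlag_right assms)

lemma cadlag_diff:
  fixes x y :: "real \<Rightarrow> 'a::real_normed_vector"
  assumes "cadlag x" "cadlag y" shows "cadlag (\<lambda>t. x t - y t)"
proof (rule cadlagI)
  show "\<exists>L. ((\<lambda>t. x t - y t) \<longlongrightarrow> L) (at_left t)" if "0 < t" for t
    using tendsto_diff[OF assms[THEN tendsto_left_lim[OF _ that]]] by blast
qed (intro tendsto_diff cadlag_right assms)

lemma left_lim_diff:
  fixes x y :: "real \<Rightarrow> 'a::real_normed_vector"
  assumes "cadlag x" "cadlag y" "0 \<le> t"
  shows "left_lim (\<lambda>t. x t - y t) t = left_lim x t - left_lim y t"
proof (cases "t = 0")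
  case False
  then show ?thesis using assms by (intro left_lim_eqI tendsto_diff tendsto_left_lim) auto
qed simp

lemma left_lim_in_closed:
  fixes x :: "real \<Rightarrow> 'a::t2_space"
  assumes "cadlag x" "0 \<le> t" "closed S" "\<And>u. 0 \<le> u \<Longrightarrow> u \<le> t \<Longrightarrow> x u \<in> S"
  shows "left_lim x t \<in> S"
proof (cases "t = 0")
  case True then show ?thesis using assms by simp
next
  case False
  then have "eventually (\<lambda>u. x u \<in> S) (at_left t)"
    using eventually_at_left_real[of 0 t] assms by (auto elim!: eventually_mono)
  then show ?thesis
    using assms False tendsto_left_lim[of x t] Lim_in_closed_set[of S x "at_left t" "left_lim x t"]
    by (simp add: trivial_limit_at_left_real)
qed

lemma left_lim_bound:
  fixes x :: "real \<Rightarrow> 'a::real_normed_vector"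
  assumes "cadlag x" "0 \<le> t" "\<And>u. 0 \<le> u \<Longrightarrow> u \<le> t \<Longrightarrow> norm (x u) \<le> B"
  shows "norm (left_lim x t) \<le> B"
  using left_lim_in_closed[OF assms(1,2), of "cball 0 B"] assms(3) by simp

text \<open>Bisection: near each \<open>r\<close> the path stays within distance 1 of
  \<open>x r\<close> on the right and of its left limit on the left. The guards
  \<open>0 \<le> u\<close> are there because \<open>cadlag\<close> says nothing about negative
  times.\<close>

lemma cadlag_bounded:
  fixes x :: "real \<Rightarrow> 'a::real_normed_vector"
  assumes "cadlag x" "0 \<le> T"
  shows "\<exists>B. \<forall>t. 0 \<le> t \<longrightarrow> t \<le> T \<longrightarrow> norm (x t) \<le> B"
proof -
  let ?P = "\<lambda>u v. 0 \<le> u \<longrightarrow> (\<exists>B. \<forall>t. u \<le> t \<longrightarrow> t \<le> v \<longrightarrow> norm (x t) \<le> B)"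
  have "?P 0 T"
  proof (rule Bolzano[of 0 T ?P, OF assms(2)])
    fix a b c :: real assume h: "?P a b" "?P b c" "a \<le> b" "b \<le> c"
    show "?P a c"
    proof
      assume "0 \<le> a"
      then obtain B1 B2 where B: "\<forall>t. a \<le> t \<longrightarrow> t \<le> b \<longrightarrow> norm (x t) \<le> B1" "\<forall>t. b \<le> t \<longrightarrow> t \<le> c \<longrightarrow> norm (x t) \<le> B2"
        using h by (meson order_trans)
      have "norm (x t) \<le> max B1 B2" if "a \<le> t" "t \<le> c" for t
        using B that by (cases "t \<le> b") (force intro: max.coboundedI1 max.coboundedI2)+
      then show "\<exists>B. \<forall>t. a \<le> t \<longrightarrow> t \<le> c \<longrightarrow> norm (x t) \<le> B" by blast
    qed
  next
    fix r :: real assume r: "0 \<le> r" "r \<le> T"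
    have "eventually (\<lambda>u. dist (x u) (x r) < 1) (at_right r)"
      using cadlag_right[OF assms(1) r(1)] by (simp add: tendsto_iff)
    then obtain d1 where d1: "d1 > r" "\<And>u. r < u \<Longrightarrow> u < d1 \<Longrightarrow> dist (x u) (x r) < 1"
      unfolding eventually_at_right_field by blast
    have "\<exists>d2<r. \<forall>u. d2 < u \<longrightarrow> u < r \<longrightarrow> 0 \<le> u \<longrightarrow> dist (x u) (left_lim x r) < 1"
    proof (cases "r = 0")
      case True
      then show ?thesis by (intro exI[of _ "-1"]) auto
    next
      case False
      then have "eventually (\<lambda>u. dist (x u) (left_lim x r) < 1) (at_left r)"
        using tendsto_left_lim[OF assms(1)] r by (simp add: tendsto_iff)
      then show ?thesis unfolding eventually_at_left_field by blast
    qed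
    then obtain d2 where d2: "d2 < r" "\<And>u. d2 < u \<Longrightarrow> u < r \<Longrightarrow> 0 \<le> u \<Longrightarrow> dist (x u) (left_lim x r) < 1" by blast
    show "\<exists>d>0. \<forall>a b. a \<le> r \<and> r \<le> b \<and> b - a < d \<longrightarrow> ?P a b"
    proof (rule exI[of _ "min (d1 - r) (r - d2)"], intro conjI allI impI)
      show "0 < min (d1 - r) (r - d2)" using d1 d2 by auto
    next
      fix a b assume ab: "a \<le> r \<and> r \<le> b \<and> b - a < min (d1 - r) (r - d2)" "0 \<le> a"
      have "norm (x t) \<le> norm (x r) + norm (left_lim x r) + 1" if "a \<le> t" "t \<le> b" for t
      proof -
        consider "t = r" | "t < r" | "t > r" by linarith
        then show ?thesis
        proof cases
          case 2
          then have "dist (x t) (left_lim x r) < 1" using d2 ab that by auto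
          then show ?thesis using norm_triangle_sub[of "x t" "left_lim x r"] norm_ge_zero[of "x r"]
            unfolding dist_norm by linarith
        next
          case 3
          then have "dist (x t) (x r) < 1" using d1 ab that by auto
          then show ?thesis using norm_triangle_sub[of "x t" "x r"] norm_ge_zero[of "left_lim x r"]
            unfolding dist_norm by linarith
        qed (simp add: add_increasing2)
      qed
      then show "\<exists>B. \<forall>t. a \<le> t \<longrightarrow> t \<le> b \<longrightarrow> norm (x t) \<le> B" by blast
    qed
  qed
  then show ?thesis by simp
qed

text \<open>Finite variation supplies the left limits, so that only right continuity has to be
  checked.\<close>

lemma cadlag_of_fv:
  fixes x :: "real \<Rightarrow> 'a::banach"
  assumes "\<And>t. 0 \<le> t \<Longrightarrow> (x \<longlongrightarrow> x t) (at_right t)" "\<And>T. 0 \<le> T \<Longrightarrow> fv p x 0 T" "0 < p"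
  shows "cadlag x"
  unfolding cadlag_def
proof (intro conjI allI impI)
  fix t :: real assume "0 < t"
  then show "\<exists>L. (x \<longlongrightarrow> L) (at_left t)"
    using assms pv_mono[of p x 0 t 0] by (intro fv_left_limit[of 0 t p x "pv p x 0 t"]) auto
qed (use assms in auto)

text \<open>\<open>left_lim x\<close> is the pointwise limit of the delayed paths
  \<open>x (u - e)\<close> as \<open>e\<close> decreases to 0, and a delay does not increase the
  variation; \<open>fv_pv_tendsto\<close> concludes. Only intervals ending before \<open>t\<close>
  are used, so a jump of \<open>x\<close> at \<open>t\<close> is not counted. The alternative
  \<open>r = 0 \<and> s = 0\<close> covers time 0, where the left limit is
  \<open>x 0\<close>.\<close>

lemma fv_pv_left_lim_gen:
  fixes x :: "real \<Rightarrow> 'a::real_normed_vector"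
  assumes x: "cadlag x" and r: "0 \<le> r" "r < s \<or> r = 0 \<and> s = 0" "s \<le> t"
    and bd: "\<And>v. r \<le> v \<Longrightarrow> v < t \<Longrightarrow> fv p x r v \<and> pv p x r v \<le> B" and "0 \<le> B" "0 < p"
  shows "fv p (left_lim x) s t" "pv p (left_lim x) s t \<le> B"
proof -
  have "fv p (left_lim x) s t \<and> pv p (left_lim x) s t \<le> B"
  proof (cases "t = 0")
    case True
    then have "s = t" using r by auto
    then show ?thesis using fv_pv_same assms by metis
  next
    case False
    then have t: "r < t" using r by auto
    \<comment> \<open>Clamping at \<open>r\<close> keeps the delayed times in the range where the
      variation is controlled.\<close>
    let ?X = "\<lambda>e u. x (max r (u - e))"
    have lim: "((\<lambda>e. ?X e u) \<longlongrightarrow> left_lim x u) (at_right 0)" if "s \<le> u" "u \<le> t" for u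
    proof (cases "u = 0")
      case True
      then have "r = 0" using r that by auto
      moreover have "eventually (\<lambda>e. x (max 0 (- e)) = x 0) (at_right (0::real))"
        using eventually_at_right_less[of "0::real"] by eventually_elim (simp add: max_def)
      ultimately show ?thesis using True by (simp add: tendsto_eventually)
    next
      case False
      then have u: "r < u" using r that by auto
      have "filterlim (\<lambda>e. u - e) (at_left u) (at_right 0)"
        unfolding filterlim_at using eventually_at_right_less[of "0::real"]
        by (auto intro!: tendsto_eq_intros elim!: eventually_mono)
      then have "((\<lambda>e. x (u - e)) \<longlongrightarrow> left_lim x u) (at_right 0)"
        using tendsto_left_lim[OF x, of u] u r by (auto intro: filterlim_compose)
      moreover have "eventually (\<lambda>e. x (u - e) = ?X e u) (at_right 0)"
        using eventually_at_right_real[of 0 "u - r"] u by (auto elim!: eventually_mono simp: max_def)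
      ultimately show ?thesis by (rule Lim_transform_eventually)
    qed
    have ev: "eventually (\<lambda>e. fv p (?X e) s t \<and> pv p (?X e) s t \<le> B) (at_right 0)"
      using eventually_at_right_less[of "0::real"]
    proof eventually_elim
      case (elim e)
      let ?t = "max r (t - e)"
      have b: "fv p x r ?t" "pv p x r ?t \<le> B" using bd[of ?t] t elim by auto
      have "fv p (?X e) s t" "pv p (?X e) s t \<le> pv p x (max r (s - e)) ?t"
        using fv_pv_compose_mono[OF b(1), of s t "\<lambda>u. max r (u - e)"] r by auto
      moreover have "pv p x (max r (s - e)) ?t \<le> pv p x r ?t"
        using r by (intro pv_mono[OF b(1)]) auto
      ultimately show ?case using b by linarith
    qed
    show ?thesis using fv_pv_tendsto[OF lim _ \<open>0 < p\<close> \<open>s \<le> t\<close> ev] trivial_limit_at_right_real by metis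
  qed
  then show "fv p (left_lim x) s t" "pv p (left_lim x) s t \<le> B" by auto
qed

lemma fv_pv_left_lim:
  fixes x :: "real \<Rightarrow> 'a::real_normed_vector"
  assumes "cadlag x" "fv p x 0 t" "0 \<le> t" "0 < p"
  shows "fv p (left_lim x) 0 t" "pv p (left_lim x) 0 t \<le> pv p x 0 t"
  using fv_pv_left_lim_gen[OF assms(1), of 0 0 t p "pv p x 0 t"] fv_subset[OF assms(2)] pv_mono[OF assms(2)]
    pv_nonneg[OF assms(2)] assms by auto

lemma pv_left_lim_left_small:
  fixes x :: "real \<Rightarrow> 'a::real_normed_vector"
  assumes "cadlag x" "fv p x 0 t" "0 < t" "0 < p" "0 < e"
  shows "\<exists>d>0. d \<le> t \<and> pv p (left_lim x) (t - d) t \<le> e"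
proof -
  obtain s where s: "0 \<le> s" "s < t" "\<And>u v. s \<le> u \<Longrightarrow> u \<le> v \<Longrightarrow> v < t \<Longrightarrow> pv p x u v \<le> e"
    using pv_left_half_small[of 0 t p x "pv p x 0 t" e] fv_subset[OF assms(2)] pv_mono[OF assms(2)] assms by force
  \<comment> \<open>\<open>fv_pv_left_lim_gen\<close> needs a start strictly after \<open>s\<close>,
    hence the midpoint.\<close>
  have "pv p (left_lim x) ((s + t) / 2) t \<le> e"
    by (rule fv_pv_left_lim_gen(2)[OF assms(1), of s]) (use s assms fv_subset[OF assms(2)] in auto)
  moreover have "t - (t - s) / 2 = (s + t) / 2" by (simp add: field_simps)
  ultimately have "pv p (left_lim x) (t - (t - s) / 2) t \<le> e" by metis
  moreover have "0 < (t - s) / 2" "(t - s) / 2 \<le> t" using s by auto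
  ultimately show ?thesis by blast
qed

section \<open>Young estimate for Riemann--Stieltjes sums\<close>

lemma rs_sum_single [simp]: "rs_sum mul h z [s] \<xi> = 0"
  by (simp add: rs_sum_def)

lemma rs_tags_single [simp]: "rs_tags [s] \<xi>"
  by (simp add: rs_tags_def)

lemma rs_sum_Cons:
  assumes "P \<noteq> []"
  shows "rs_sum mul h z (s # P) \<xi> = mul (h (\<xi> 0)) (z (hd P) - z s) + rs_sum mul h z P (\<lambda>i. \<xi> (Suc i))"
proof -
  obtain b Q where P: "P = b # Q" using assms by (cases P) auto
  show ?thesis unfolding rs_sum_def P by (simp add: sum.lessThan_Suc_shift del: sum.lessThan_Suc)
qed

lemma rs_tags_Cons:
  assumes "P \<noteq> []"
  shows "rs_tags (s # P) \<xi> \<longleftrightarrow> s \<le> \<xi> 0 \<and> \<xi> 0 \<le> hd P \<and> rs_tags P (\<lambda>i. \<xi> (Suc i))"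
proof -
  obtain b Q where P: "P = b # Q" using assms by (cases P) auto
  show ?thesis unfolding rs_tags_def P by (auto simp: less_Suc_eq_0_disj)
qed

text \<open>The two pieces are separated by a gap with tag \<open>\<xi> (length P - 1)\<close>, in
  contrast to \<open>rs_split\<close>, where they share a point.\<close>

lemma rs_append:
  assumes "P \<noteq> []" "Q \<noteq> []"
  shows "rs_sum mul h z (P @ Q) \<xi> = rs_sum mul h z P \<xi> + mul (h (\<xi> (length P - 1))) (z (hd Q) - z (last P))
           + rs_sum mul h z Q (\<lambda>i. \<xi> (i + length P))"
    and "rs_tags (P @ Q) \<xi> \<longleftrightarrow> rs_tags P \<xi> \<and> last P \<le> \<xi> (length P - 1) \<and> \<xi> (length P - 1) \<le> hd Q
           \<and> rs_tags Q (\<lambda>i. \<xi> (i + length P))"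
  using assms(1)
proof (induction P arbitrary: \<xi>)
  case (Cons a P)
  {
    case 1
    then show ?case using Cons(1)[of "\<lambda>i. \<xi> (Suc i)"] assms(2)
      by (cases "P = []") (auto simp: rs_sum_Cons Suc_diff_Suc add.assoc)
  next
    case 2
    then show ?case using Cons(2)[of "\<lambda>i. \<xi> (Suc i)"] assms(2)
      by (cases "P = []") (auto simp: rs_tags_Cons)
  }
qed auto

lemma rs_left_tags: "is_partition s t P \<Longrightarrow> rs_tags P (\<lambda>i. P ! i)"
  unfolding rs_tags_def is_partition_def
  by (auto simp: sorted_wrt_iff_nth_less order_less_imp_le)

text \<open>Tags are indexed by position, so the right piece carries them shifted by
  \<open>n\<close>. The set equations ensure that a refinement of a joined partition splits into
  refinements of its two parts.\<close>

lemma rs_split: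
  assumes "is_partition s t P" "u \<in> set P"
  shows "\<exists>P1 P2 n. is_partition s u P1 \<and> is_partition u t P2 \<and> set P1 = set P \<inter> {..u} \<and> set P2 = set P \<inter> {u..} \<and>
    (\<forall>\<xi>. rs_tags P \<xi> \<longrightarrow> rs_tags P1 \<xi> \<and> rs_tags P2 (\<lambda>i. \<xi> (i + n)) \<and>
        rs_sum mul h z P \<xi> = rs_sum mul h z P1 \<xi> + rs_sum mul h z P2 (\<lambda>i. \<xi> (i + n)))"
  using assms
proof (induction rule: is_partition_induct)
  case single
  then show ?case by (intro exI[of _ "[t]"] exI[of _ 0]) auto
next
  case (Cons s v P)
  note Pset = is_partition_set[OF Cons.hyps(3)]
  show ?case
  proof (cases "u = s")
    case True
    then show ?thesis using Cons Pset
      by (intro exI[of _ "[s]"] exI[of _ "s # P"] exI[of _ 0]) (auto simp: is_partition_Cons)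
  next
    case False
    then have "u \<in> set P" using Cons.prems by simp
    then obtain P1 P2 n where IH: "is_partition v u P1" "is_partition u t P2" "set P1 = set P \<inter> {..u}" "set P2 = set P \<inter> {u..}"
      "\<And>\<xi>. rs_tags P \<xi> \<Longrightarrow> rs_tags P1 \<xi> \<and> rs_tags P2 (\<lambda>i. \<xi> (i + n)) \<and>
        rs_sum mul h z P \<xi> = rs_sum mul h z P1 \<xi> + rs_sum mul h z P2 (\<lambda>i. \<xi> (i + n))"
      using Cons.IH by blast
    have ne: "P1 \<noteq> []" "hd P1 = v" using IH(1) by (auto simp: is_partition_def)
    have su: "s < u" using \<open>u \<in> set P\<close> Pset Cons.hyps by auto
    show ?thesis
    proof (rule exI[of _ "s # P1"], rule exI[of _ P2], rule exI[of _ "Suc n"], intro conjI allI impI)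
      show "is_partition s u (s # P1)" using IH(1) ne Cons.hyps by (simp add: is_partition_Cons)
      show "is_partition u t P2" by fact
      show "set (s # P1) = set (s # P) \<inter> {..u}" "set P2 = set (s # P) \<inter> {u..}" using IH su by auto
      fix \<xi> assume "rs_tags (s # P) \<xi>"
      then have tg: "s \<le> \<xi> 0" "\<xi> 0 \<le> v" "rs_tags P (\<lambda>i. \<xi> (Suc i))" using Cons.hyps by (auto simp: rs_tags_Cons)
      show "rs_tags (s # P1) \<xi>" "rs_tags P2 (\<lambda>i. \<xi> (i + Suc n))"
        using tg IH(5)[OF tg(3)] ne by (auto simp: rs_tags_Cons)
      show "rs_sum mul h z (s # P) \<xi> = rs_sum mul h z (s # P1) \<xi> + rs_sum mul h z P2 (\<lambda>i. \<xi> (i + Suc n))"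
        using IH(5)[OF tg(3)] ne Cons.hyps by (simp add: rs_sum_Cons add.assoc)
    qed
  qed
qed

text \<open>Split the partition where the control \<open>w s\<close> first exceeds half of \<open>w s t\<close>: both parts are estimated inductively, and
  the constant solves \<open>C = C * 2 powr (1 - \<theta>) + 3\<close>.\<close>

lemma young_sum_bound:
  fixes w :: "real \<Rightarrow> real \<Rightarrow> real"
  assumes mul: "bounded_bilinear mul" and w: "super_on s t w" and \<theta>: "1 < \<theta>" and A: "0 \<le> A"
    and bd: "\<And>u v c c' b b'. \<lbrakk>s \<le> u; v \<le> t; u \<le> c; c \<le> v; u \<le> c'; c' \<le> v; u \<le> b; b \<le> v; u \<le> b'; b' \<le> v\<rbrakk>
       \<Longrightarrow> norm (mul (h c - h c') (z b - z b')) \<le> A * w u v powr \<theta>"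
    and P: "is_partition s t P" "rs_tags P \<xi>" and c: "s \<le> c" "c \<le> t"
  shows "norm (rs_sum mul h z P \<xi> - mul (h c) (z t - z s)) \<le> 3 / (1 - 2 powr (1 - \<theta>)) * (A * w s t powr \<theta>)"
proof -
  interpret bounded_bilinear mul by fact
  define C where "C = 3 / (1 - 2 powr (1 - \<theta>))"
  have den: "0 < 1 - 2 powr (1 - \<theta>)" using \<theta> powr_less_mono[of "1-\<theta>" 0 2] by simp
  then have "C * (1 - 2 powr (1 - \<theta>)) = 3" unfolding C_def by (intro nonzero_eq_divide_eq[THEN iffD1] refl) (use \<theta> in simp)
  then have C: "C * 2 powr (1 - \<theta>) + 3 = C" "0 \<le> C"
    using den by (simp add: right_diff_distrib, simp add: C_def)
  show ?thesis unfolding C_def[symmetric]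
    using P w bd c
  proof (induction "length P" arbitrary: P s t \<xi> c rule: less_induct)
    case less
    note P = \<open>is_partition s t P\<close> and tg = \<open>rs_tags P \<xi>\<close> and w = \<open>super_on s t w\<close>
      and bd = less.prems(4) and c = \<open>s \<le> c\<close> \<open>c \<le> t\<close>
    let ?W = "w s t"
    show ?case
    proof (cases "length P = 1")
      case True
      then obtain r where "P = [r]" by (cases P) auto
      then have "s = t" "P = [s]" using P by auto
      then show ?thesis using C(2) A by (simp add: zero_right)
    next
      case False
      then have len: "length P \<ge> 2" using is_partition_ne[OF P] by (cases P) (auto simp: Suc_le_eq)
      \<comment> \<open>The endpoint \<open>t\<close> is set aside so that it always falls into
        \<open>P2\<close>, which is then nonempty.\<close>
      define B where "B = butlast P"
      have PB: "P = B @ [t]" "B \<noteq> []" using P len unfolding B_def is_partition_def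
        by (metis append_butlast_last_id) (metis Suc_1 Suc_n_not_le_n append_butlast_last_id append_self_conv2 len length_Cons list.size(3) One_nat_def is_partition_ne P)
      let ?q = "\<lambda>u. w s u \<le> ?W / 2"
      define P1 where "P1 = takeWhile ?q B"
      define P2 where "P2 = dropWhile ?q B @ [t]"
      have P12: "P = P1 @ P2" "P2 \<noteq> []" using PB by (auto simp: P1_def P2_def)
      have st: "s \<le> t" using is_partition_le P by auto
      have w0: "w u u = 0" if "s \<le> u" "u \<le> t" for u
        using super_onD(1)[OF w, of u u] super_onD(2)[OF w, of u u u] that by simp
      have Wnn: "0 \<le> ?W" using super_onD(1)[OF w, of s t] st by auto
      have hdB: "hd B = s" using PB P by (metis hd_append2 is_partition_hd)
      have P1ne: "P1 \<noteq> []" using PB(2) hdB w0[of s] st Wnn unfolding P1_def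
        by (cases B) auto
      have lens: "length P1 < length P" "length P2 < length P" using P12 P1ne by auto
      define a b where "a = last P1" and "b = hd P2"
      have srt: "sorted_wrt (<) P1" "sorted_wrt (<) P2" "\<And>x y. x \<in> set P1 \<Longrightarrow> y \<in> set P2 \<Longrightarrow> x < y"
        using P unfolding is_partition_def P12(1) sorted_wrt_append by auto
      have part: "is_partition s a P1" "is_partition b t P2" "a < b"
        using srt P12 P1ne hdB P by (auto simp: is_partition_def a_def b_def)
      then have ord: "s \<le> a" "a \<le> b" "b \<le> t" using is_partition_le by auto
      have wa: "w s a \<le> ?W / 2"
        using P1ne unfolding P1_def a_def by (metis last_in_set set_takeWhileD)
      \<comment> \<open>Either \<open>b\<close> is the first point beyond the threshold, and
        superadditivity leaves at most half of \<open>w s t\<close> from \<open>b\<close> to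
        \<open>t\<close>, or no point of \<open>B\<close> exceeds it and
        \<open>b = t\<close>.\<close>
      have wb: "w b t \<le> ?W / 2"
      proof (cases "dropWhile ?q B = []")
        case True
        have "b = t" unfolding b_def P2_def True by simp
        then show ?thesis using w0[of t] st Wnn by simp
      next
        case False
        then have "\<not> ?q b" unfolding b_def P2_def using hd_dropWhile[OF False] by simp
        then show ?thesis using super_onD(2)[OF w, of s b t] ord by auto
      qed
      define \<eta> where "\<eta> = (\<lambda>i. \<xi> (i + length P1))"
      define m where "m = \<xi> (length P1 - 1)"
      have tags: "rs_tags P1 \<xi>" "rs_tags P2 \<eta>" "a \<le> m" "m \<le> b"
        using tg rs_append(2)[OF P1ne P12(2)] unfolding P12(1) a_def b_def m_def \<eta>_def by auto
      have sumeq: "rs_sum mul h z P \<xi> = rs_sum mul h z P1 \<xi> + mul (h m) (z b - z a) + rs_sum mul h z P2 \<eta>"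
        using rs_append(1)[OF P1ne P12(2)] unfolding P12(1) a_def b_def m_def \<eta>_def by auto
      have half: "A * w u v powr \<theta> \<le> A * (?W powr \<theta> * 2 powr - \<theta>)" if "w u v \<le> ?W / 2" "0 \<le> w u v" for u v
      proof -
        have "w u v powr \<theta> \<le> (?W / 2) powr \<theta>" using that \<theta> by (intro powr_mono2) auto
        also have "\<dots> = ?W powr \<theta> * 2 powr - \<theta>" using Wnn by (simp add: powr_divide powr_minus_divide)
        finally show ?thesis using A by (intro mult_left_mono) auto
      qed
      have "norm (rs_sum mul h z P1 \<xi> - mul (h s) (z a - z s)) \<le> C * (A * w s a powr \<theta>)"
        by (rule less.hyps[OF lens(1) part(1) tags(1) super_on_subset[OF w]]) (use bd ord in auto)
      also have "\<dots> \<le> C * (A * (?W powr \<theta> * 2 powr - \<theta>))"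
        using wa C(2) super_onD(1)[OF w, of s a] ord by (intro mult_left_mono half) auto
      finally have e1: "norm (rs_sum mul h z P1 \<xi> - mul (h s) (z a - z s)) \<le> C * (A * (?W powr \<theta> * 2 powr - \<theta>))" .
      have "norm (rs_sum mul h z P2 \<eta> - mul (h b) (z t - z b)) \<le> C * (A * w b t powr \<theta>)"
        by (rule less.hyps[OF lens(2) part(2) tags(2) super_on_subset[OF w]]) (use bd ord in auto)
      also have "\<dots> \<le> C * (A * (?W powr \<theta> * 2 powr - \<theta>))"
        using wb C(2) super_onD(1)[OF w, of b t] ord by (intro mult_left_mono half) auto
      finally have e2: "norm (rs_sum mul h z P2 \<eta> - mul (h b) (z t - z b)) \<le> C * (A * (?W powr \<theta> * 2 powr - \<theta>))" .
      \<comment> \<open>Changing the tag to \<open>c\<close> on the left piece, on the right piece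
        and on the gap produces the three terms behind the constant 3.\<close>
      have e3: "norm (mul (h s - h c) (z a - z s)) \<le> A * ?W powr \<theta>"
        "norm (mul (h b - h c) (z t - z b)) \<le> A * ?W powr \<theta>"
        "norm (mul (h m - h c) (z b - z a)) \<le> A * ?W powr \<theta>"
        using ord c tags st by (auto intro!: bd)
      have "mul (h c) (z t - z s) = mul (h c) (z a - z s) + mul (h c) (z b - z a) + mul (h c) (z t - z b)"
        by (simp add: add_right[symmetric])
      then have "rs_sum mul h z P \<xi> - mul (h c) (z t - z s) =
         (rs_sum mul h z P1 \<xi> - mul (h s) (z a - z s)) + (rs_sum mul h z P2 \<eta> - mul (h b) (z t - z b))
         + mul (h s - h c) (z a - z s) + mul (h b - h c) (z t - z b) + mul (h m - h c) (z b - z a)"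
        unfolding sumeq by (simp add: diff_left algebra_simps)
      also have "norm \<dots> \<le> norm (rs_sum mul h z P1 \<xi> - mul (h s) (z a - z s)) + norm (rs_sum mul h z P2 \<eta> - mul (h b) (z t - z b))
         + norm (mul (h s - h c) (z a - z s)) + norm (mul (h b - h c) (z t - z b)) + norm (mul (h m - h c) (z b - z a))"
        by (intro norm_triangle_mono order_refl)
      also have "\<dots> \<le> C * (A * (?W powr \<theta> * 2 powr - \<theta>)) + C * (A * (?W powr \<theta> * 2 powr - \<theta>)) + A * ?W powr \<theta> + A * ?W powr \<theta> + A * ?W powr \<theta>"
        using e1 e2 e3 by linarith
      also have "\<dots> = (C * (2 * 2 powr - \<theta>) + 3) * (A * ?W powr \<theta>)" by (simp add: algebra_simps)
      also have "2 * 2 powr - \<theta> = 2 powr (1 - \<theta>)" by (simp add: powr_diff powr_minus_divide)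
      finally show ?thesis unfolding C(1) .
    qed
  qed
qed

text \<open>The quotient is the constant of \<open>young_sum_bound\<close> for
  \<open>\<theta> = 1/p + 1/q\<close>. The last factor arises because the control, a sum of two
  variations normalised to at most 1, is bounded by 2.\<close>

definition young_const :: "real \<Rightarrow> real \<Rightarrow> real" where
  "young_const p q = 3 / (1 - 2 powr (1 - (1/p + 1/q))) * 2 powr (1/p + 1/q)"

lemma young_const_nonneg: "1 / p + 1 / q > 1 \<Longrightarrow> 0 \<le> young_const p q"
  using powr_less_mono[of "1 - (1/p + 1/q)" 0 2] unfolding young_const_def by simp

text \<open>Dividing each variation by its own bound before adding them makes the estimate linear in
  \<open>H\<close> and in \<open>Z\<close> separately; the division is the reason for requiring both
  to be positive.\<close>

lemma young_pv_pos:
  assumes mul: "bounded_bilinear mul" and K: "0 \<le> K" "\<And>a b. norm (mul a b) \<le> norm a * norm b * K"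
    and pq: "1 \<le> p" "1 \<le> q" "1 / p + 1 / q > 1"
    and h: "fv q h s t" "pv q h s t \<le> H powr q" "0 < H" and z: "fv p z s t" "pv p z s t \<le> Z powr p" "0 < Z"
    and P: "is_partition s t P" "rs_tags P \<xi>" and c: "s \<le> c" "c \<le> t"
  shows "norm (rs_sum mul h z P \<xi> - mul (h c) (z t - z s)) \<le> young_const p q * (K * H * Z)"
proof -
  let ?\<theta> = "1 / p + 1 / q"
  define w where "w = (\<lambda>u v. 1 / H powr q * pv q h u v + 1 / Z powr p * pv p z u v)"
  have st: "s \<le> t" using is_partition_le[OF P(1)] .
  have w: "super_on s t w" unfolding w_def
    using h z by (intro super_on_add super_on_cmult super_on_pv) auto
  have w2: "w s t \<le> 2"
  proof -
    have "1 / H powr q * pv q h s t \<le> 1" "1 / Z powr p * pv p z s t \<le> 1"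
      using h z by (auto simp: field_simps)
    then show ?thesis unfolding w_def by linarith
  qed
  have inc: "norm (f b - f b') \<le> F * w u v powr (1/r)"
    if f: "fv r f s t" "0 < F" "1 \<le> r" "\<And>u v. s \<le> u \<Longrightarrow> u \<le> v \<Longrightarrow> v \<le> t \<Longrightarrow> 1 / F powr r * pv r f u v \<le> w u v"
      and uv: "s \<le> u" "v \<le> t" "u \<le> b" "b \<le> v" "u \<le> b'" "b' \<le> v"
    for f :: "real \<Rightarrow> 'z::real_normed_vector" and F r u v b b'
  proof -
    have main: "norm (f d - f d') \<le> F * w u v powr (1/r)" if "u \<le> d'" "d' \<le> d" "d \<le> v" for d d'
    proof -
      have "pv r f d' d \<le> pv r f u v" using fv_subset[OF f(1), of u v] uv that by (intro pv_mono) auto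
      also have "\<dots> \<le> F powr r * w u v" using f(4)[of u v] f(2) uv by (simp add: field_simps)
      finally have "pv r f d' d \<le> F powr r * w u v" .
      then have "pv r f d' d powr (1/r) \<le> (F powr r * w u v) powr (1/r)"
        using f uv that fv_subset[OF f(1), of d' d] by (intro powr_mono2 pv_nonneg) auto
      also have "\<dots> = F * w u v powr (1/r)"
        using f(2,3) super_onD(1)[OF w, of u v] uv by (simp add: powr_mult powr_powr)
      finally show ?thesis using incr_le_pv_root[OF f(1), of d' d] uv that f(3) by linarith
    qed
    show ?thesis using main[of b b'] main[of b' b] uv by (cases "b \<le> b'") (auto simp: norm_minus_commute)
  qed
  have bd: "norm (mul (h c - h c') (z b - z b')) \<le> (K * H * Z) * w u v powr ?\<theta>"
    if uv: "s \<le> u" "v \<le> t" "u \<le> c" "c \<le> v" "u \<le> c'" "c' \<le> v" "u \<le> b" "b \<le> v" "u \<le> b'" "b' \<le> v"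
    for u v c c' b b'
  proof -
    have 1: "norm (h c - h c') \<le> H * w u v powr (1/q)"
      by (rule inc) (use h z pq uv in \<open>auto simp: w_def intro!: divide_nonneg_nonneg pv_nonneg intro: fv_subset\<close>)
    have 2: "norm (z b - z b') \<le> Z * w u v powr (1/p)"
      by (rule inc) (use h z pq uv in \<open>auto simp: w_def intro!: divide_nonneg_nonneg pv_nonneg intro: fv_subset\<close>)
    have "norm (mul (h c - h c') (z b - z b')) \<le> norm (h c - h c') * norm (z b - z b') * K" by (rule K)
    also have "\<dots> \<le> (H * w u v powr (1/q)) * (Z * w u v powr (1/p)) * K"
      using 1 2 K h z by (intro mult_right_mono mult_mono) auto
    also have "\<dots> = (K * H * Z) * (w u v powr (1/p) * w u v powr (1/q))" by (simp add: algebra_simps)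
    also have "\<dots> = (K * H * Z) * w u v powr ?\<theta>" by (simp add: powr_add)
    finally show ?thesis .
  qed
  have "norm (rs_sum mul h z P \<xi> - mul (h c) (z t - z s)) \<le> 3 / (1 - 2 powr (1 - ?\<theta>)) * ((K * H * Z) * w s t powr ?\<theta>)"
    using K h z by (intro young_sum_bound[OF mul w pq(3) _ bd P c]) auto
  also have "\<dots> \<le> 3 / (1 - 2 powr (1 - ?\<theta>)) * ((K * H * Z) * 2 powr ?\<theta>)"
    using w2 K h z pq powr_less_mono[of "1 - ?\<theta>" 0 2] super_onD(1)[OF w, of s t] st by (intro mult_left_mono powr_mono2) auto
  finally show ?thesis by (simp add: young_const_def mult_ac)
qed

text \<open>Applies the positive case to \<open>H + e\<close> and \<open>Z + e\<close> and lets
  \<open>e\<close> tend to 0, which admits bounds equal to 0.\<close>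

lemma young_pv:
  assumes mul: "bounded_bilinear mul" and K: "0 \<le> K" "\<And>a b. norm (mul a b) \<le> norm a * norm b * K"
    and pq: "1 \<le> p" "1 \<le> q" "1 / p + 1 / q > 1"
    and h: "fv q h s t" "pv q h s t \<le> H powr q" "0 \<le> H" and z: "fv p z s t" "pv p z s t \<le> Z powr p" "0 \<le> Z"
    and P: "is_partition s t P" "rs_tags P \<xi>" and c: "s \<le> c" "c \<le> t"
  shows "norm (rs_sum mul h z P \<xi> - mul (h c) (z t - z s)) \<le> young_const p q * (K * H * Z)"
proof (rule tendsto_lowerbound)
  show "((\<lambda>e. young_const p q * (K * (H + e) * (Z + e))) \<longlongrightarrow> young_const p q * (K * H * Z)) (at_right 0)"
    by (auto intro!: tendsto_eq_intros)
  show "eventually (\<lambda>e. norm (rs_sum mul h z P \<xi> - mul (h c) (z t - z s)) \<le> young_const p q * (K * (H + e) * (Z + e))) (at_right 0)"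
    using eventually_at_right_less[of "0::real"]
  proof eventually_elim
    case (elim e)
    have "H powr q \<le> (H + e) powr q" "Z powr p \<le> (Z + e) powr p"
      using elim h z pq by (auto intro!: powr_mono2)
    then show ?case using elim h z by (intro young_pv_pos[OF mul K pq h(1) _ _ z(1) _ _ P c]) auto
  qed
qed simp

section \<open>Existence of Young integrals\<close>

lemma has_rs_integralD:
  assumes "has_rs_integral mul h a s t I" "0 < e"
  obtains Q where "is_partition s t Q"
    "\<And>P \<xi>. is_partition s t P \<Longrightarrow> set Q \<subseteq> set P \<Longrightarrow> rs_tags P \<xi> \<Longrightarrow> norm (rs_sum mul h a P \<xi> - I) < e"
  using assms unfolding has_rs_integral_def by blast

lemma common_refinement:
  assumes "is_partition s t Q" "is_partition s t Q'"
  obtains P where "is_partition s t P" "set Q \<subseteq> set P" "set Q' \<subseteq> set P"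
proof
  show "is_partition s t (sorted_list_of_set (set Q \<union> set Q'))"
    using assms[THEN partition_ends] assms[THEN is_partition_set] by (intro partition_of_set) auto
qed auto

lemma has_rs_integral_unique:
  assumes "has_rs_integral mul h a s t I" "has_rs_integral mul h a s t J"
  shows "I = J"
proof (rule ccontr)
  assume "I \<noteq> J"
  then have e: "0 < norm (I - J) / 2" by simp
  obtain Q where Q: "is_partition s t Q" "\<And>P \<xi>. is_partition s t P \<Longrightarrow> set Q \<subseteq> set P \<Longrightarrow> rs_tags P \<xi> \<Longrightarrow> norm (rs_sum mul h a P \<xi> - I) < norm (I - J) / 2"
    using has_rs_integralD[OF assms(1) e] by blast
  obtain Q' where Q': "is_partition s t Q'" "\<And>P \<xi>. is_partition s t P \<Longrightarrow> set Q' \<subseteq> set P \<Longrightarrow> rs_tags P \<xi> \<Longrightarrow> norm (rs_sum mul h a P \<xi> - J) < norm (I - J) / 2"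
    using has_rs_integralD[OF assms(2) e] by blast
  obtain P where P: "is_partition s t P" "set Q \<subseteq> set P" "set Q' \<subseteq> set P" using common_refinement Q Q' by blast
  let ?S = "rs_sum mul h a P (\<lambda>i. P ! i)"
  have "norm (?S - I) < norm (I - J) / 2" "norm (?S - J) < norm (I - J) / 2"
    using P Q Q' rs_left_tags by blast+
  moreover have "norm (I - J) \<le> norm (?S - I) + norm (?S - J)"
    by (metis norm_minus_commute norm_triangle_sub diff_add_cancel norm_diff_triangle_le order_refl)
  ultimately show False by linarith
qed

lemma has_rs_integral_norm_le:
  assumes "has_rs_integral mul h a s t I"
    "\<And>P \<xi>. is_partition s t P \<Longrightarrow> rs_tags P \<xi> \<Longrightarrow> norm (rs_sum mul h a P \<xi> - c) \<le> B"
  shows "norm (I - c) \<le> B"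
proof (rule field_le_epsilon)
  fix e :: real assume "0 < e"
  then obtain Q where Q: "is_partition s t Q" "\<And>P \<xi>. is_partition s t P \<Longrightarrow> set Q \<subseteq> set P \<Longrightarrow> rs_tags P \<xi> \<Longrightarrow> norm (rs_sum mul h a P \<xi> - I) < e"
    using has_rs_integralD[OF assms(1)] by blast
  let ?S = "rs_sum mul h a Q (\<lambda>i. Q ! i)"
  have "norm (?S - I) < e" "norm (?S - c) \<le> B" using Q assms(2) rs_left_tags[OF Q(1)] by auto
  moreover have "norm (I - c) \<le> norm (?S - I) + norm (?S - c)"
    using norm_triangle_ineq4[of "?S - c" "?S - I"] by simp
  ultimately show "norm (I - c) \<le> B + e" by linarith
qed

lemma has_rs_integral_concat:
  assumes I: "has_rs_integral mul h a s u I" and J: "has_rs_integral mul h a u t J"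
  shows "has_rs_integral mul h a s t (I + J)"
  unfolding has_rs_integral_def
proof (intro allI impI)
  fix e :: real assume "0 < e"
  then have e: "0 < e / 2" by simp
  obtain Q where Q: "is_partition s u Q" "\<And>P \<xi>. is_partition s u P \<Longrightarrow> set Q \<subseteq> set P \<Longrightarrow> rs_tags P \<xi> \<Longrightarrow> norm (rs_sum mul h a P \<xi> - I) < e / 2"
    using has_rs_integralD[OF I e] by blast
  obtain Q' where Q': "is_partition u t Q'" "\<And>P \<xi>. is_partition u t P \<Longrightarrow> set Q' \<subseteq> set P \<Longrightarrow> rs_tags P \<xi> \<Longrightarrow> norm (rs_sum mul h a P \<xi> - J) < e / 2"
    using has_rs_integralD[OF J e] by blast
  have QQ: "is_partition s t (Q @ tl Q')" "set (Q @ tl Q') = set Q \<union> set Q'" using partition_join[OF Q(1) Q'(1)] by auto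
  have "norm (rs_sum mul h a P \<xi> - (I + J)) < e"
    if P: "is_partition s t P" "set (Q @ tl Q') \<subseteq> set P" "rs_tags P \<xi>" for P \<xi>
  proof -
    have "u \<in> set P" using P QQ partition_ends[OF Q(1)] by auto
    then obtain P1 P2 n where P12: "is_partition s u P1" "is_partition u t P2" "set P1 = set P \<inter> {..u}" "set P2 = set P \<inter> {u..}"
      "rs_tags P1 \<xi>" "rs_tags P2 (\<lambda>i. \<xi> (i + n))"
      "rs_sum mul h a P \<xi> = rs_sum mul h a P1 \<xi> + rs_sum mul h a P2 (\<lambda>i. \<xi> (i + n))"
      using rs_split[OF P(1), of u mul h a] P(3) by blast
    have "set Q \<subseteq> set P1" "set Q' \<subseteq> set P2"
      using P(2) QQ(2) P12 is_partition_set[OF Q(1)] is_partition_set[OF Q'(1)] by auto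
    then have "norm (rs_sum mul h a P1 \<xi> - I) < e / 2" "norm (rs_sum mul h a P2 (\<lambda>i. \<xi> (i + n)) - J) < e / 2"
      using Q(2) Q'(2) P12 by auto
    then show ?thesis unfolding P12(7) by (intro norm_diff_triangle_ineq[THEN order.strict_trans1]) linarith
  qed
  then show "\<exists>Q. is_partition s t Q \<and> (\<forall>P \<xi>. is_partition s t P \<and> set Q \<subseteq> set P \<and> rs_tags P \<xi> \<longrightarrow> norm (rs_sum mul h a P \<xi> - (I + J)) < e)"
    using QQ(1) by blast
qed

lemma has_rs_integral_diff:
  assumes mul: "bounded_bilinear mul" and I: "has_rs_integral mul h a s t I" and J: "has_rs_integral mul h' a s t J"
  shows "has_rs_integral mul (\<lambda>r. h r - h' r) a s t (I - J)"
  unfolding has_rs_integral_def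
proof (intro allI impI)
  interpret bounded_bilinear mul by fact
  fix e :: real assume "0 < e"
  then have e: "0 < e / 2" by simp
  obtain Q where Q: "is_partition s t Q" "\<And>P \<xi>. is_partition s t P \<Longrightarrow> set Q \<subseteq> set P \<Longrightarrow> rs_tags P \<xi> \<Longrightarrow> norm (rs_sum mul h a P \<xi> - I) < e / 2"
    using has_rs_integralD[OF I e] by blast
  obtain Q' where Q': "is_partition s t Q'" "\<And>P \<xi>. is_partition s t P \<Longrightarrow> set Q' \<subseteq> set P \<Longrightarrow> rs_tags P \<xi> \<Longrightarrow> norm (rs_sum mul h' a P \<xi> - J) < e / 2"
    using has_rs_integralD[OF J e] by blast
  obtain R where R: "is_partition s t R" "set Q \<subseteq> set R" "set Q' \<subseteq> set R" using common_refinement Q Q' by blast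
  have "norm (rs_sum mul (\<lambda>r. h r - h' r) a P \<xi> - (I - J)) < e"
    if P: "is_partition s t P" "set R \<subseteq> set P" "rs_tags P \<xi>" for P \<xi>
  proof -
    have eq: "rs_sum mul (\<lambda>r. h r - h' r) a P \<xi> = rs_sum mul h a P \<xi> - rs_sum mul h' a P \<xi>"
      unfolding rs_sum_def by (simp add: diff_left sum_subtractf)
    have "norm (rs_sum mul h a P \<xi> - I) < e / 2" "norm (rs_sum mul h' a P \<xi> - J) < e / 2"
      using P R Q(2) Q'(2) by auto
    then show ?thesis unfolding eq
      using norm_triangle_ineq4[of "rs_sum mul h a P \<xi> - I" "rs_sum mul h' a P \<xi> - J"] by (simp add: algebra_simps)
  qed
  then show "\<exists>Q. is_partition s t Q \<and> (\<forall>P \<xi>. is_partition s t P \<and> set Q \<subseteq> set P \<and> rs_tags P \<xi> \<longrightarrow> norm (rs_sum mul (\<lambda>r. h r - h' r) a P \<xi> - (I - J)) < e)"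
    using R(1) by blast
qed

lemma rs_sum_cong:
  assumes "is_partition s t P" "rs_tags P \<xi>" "\<And>r. s \<le> r \<Longrightarrow> r \<le> t \<Longrightarrow> h r = h' r"
  shows "rs_sum mul h a P \<xi> = rs_sum mul h' a P \<xi>"
  unfolding rs_sum_def
proof (intro sum.cong refl)
  fix i assume i: "i \<in> {..<length P - 1}"
  then have "P ! i \<in> set P" "P ! Suc i \<in> set P" by auto
  then have "s \<le> P ! i" "P ! Suc i \<le> t" using is_partition_set[OF assms(1)] by auto
  then show "mul (h (\<xi> i)) (a (P ! Suc i) - a (P ! i)) = mul (h' (\<xi> i)) (a (P ! Suc i) - a (P ! i))"
    using assms(2,3) i unfolding rs_tags_def by (metis lessThan_iff order_trans)
qed

lemma has_rs_integral_cong: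
  assumes "\<And>r. s \<le> r \<Longrightarrow> r \<le> t \<Longrightarrow> h r = h' r"
  shows "has_rs_integral mul h a s t I \<longleftrightarrow> has_rs_integral mul h' a s t I"
proof -
  have dir: "has_rs_integral mul h2 a s t I"
    if I: "has_rs_integral mul h1 a s t I" and eq: "\<And>r. s \<le> r \<Longrightarrow> r \<le> t \<Longrightarrow> h1 r = h2 r" for h1 h2
    unfolding has_rs_integral_def
  proof (intro allI impI)
    fix e :: real assume "0 < e"
    then obtain Q where Q: "is_partition s t Q" "\<And>P \<xi>. is_partition s t P \<Longrightarrow> set Q \<subseteq> set P \<Longrightarrow> rs_tags P \<xi> \<Longrightarrow> norm (rs_sum mul h1 a P \<xi> - I) < e"
      using has_rs_integralD[OF I] by blast
    have "norm (rs_sum mul h2 a P \<xi> - I) < e" if "is_partition s t P" "set Q \<subseteq> set P" "rs_tags P \<xi>" for P \<xi>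
      using Q(2)[OF that] rs_sum_cong[OF that(1,3), of h1 h2 mul a] eq by simp
    then show "\<exists>Q. is_partition s t Q \<and> (\<forall>P \<xi>. is_partition s t P \<and> set Q \<subseteq> set P \<and> rs_tags P \<xi> \<longrightarrow> norm (rs_sum mul h2 a P \<xi> - I) < e)"
      using Q(1) by blast
  qed
  show ?thesis using dir[of h h'] dir[of h' h] assms by auto
qed

lemma has_rs_integral_Cauchy:
  fixes mul :: "'a \<Rightarrow> 'b::ab_group_add \<Rightarrow> 'c::banach"
  assumes st: "s \<le> t" and C: "\<And>e. 0 < e \<Longrightarrow> \<exists>Q. is_partition s t Q \<and> (\<forall>P \<xi> P' \<xi>'. is_partition s t P \<longrightarrow> set Q \<subseteq> set P \<longrightarrow> rs_tags P \<xi> \<longrightarrow>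
      is_partition s t P' \<longrightarrow> set Q \<subseteq> set P' \<longrightarrow> rs_tags P' \<xi>' \<longrightarrow> norm (rs_sum mul h a P \<xi> - rs_sum mul h a P' \<xi>') \<le> e)"
  shows "\<exists>I. has_rs_integral mul h a s t I"
proof -
  let ?S = "\<lambda>P \<xi>. rs_sum mul h a P \<xi>"
  have "\<forall>n. \<exists>Q. is_partition s t Q \<and> (\<forall>P \<xi> P' \<xi>'. is_partition s t P \<longrightarrow> set Q \<subseteq> set P \<longrightarrow> rs_tags P \<xi> \<longrightarrow>
      is_partition s t P' \<longrightarrow> set Q \<subseteq> set P' \<longrightarrow> rs_tags P' \<xi>' \<longrightarrow> norm (?S P \<xi> - ?S P' \<xi>') \<le> 1 / Suc n)"
    using C by simp
  then obtain Q where Q: "\<And>n. is_partition s t (Q n)"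
    "\<And>n P \<xi> P' \<xi>'. is_partition s t P \<Longrightarrow> set (Q n) \<subseteq> set P \<Longrightarrow> rs_tags P \<xi> \<Longrightarrow>
      is_partition s t P' \<Longrightarrow> set (Q n) \<subseteq> set P' \<Longrightarrow> rs_tags P' \<xi>' \<Longrightarrow> norm (?S P \<xi> - ?S P' \<xi>') \<le> 1 / Suc n"
    by metis
  \<comment> \<open>The partitions \<open>Q n\<close> need not be nested; the unions refine every
    earlier \<open>Q k\<close> and so reduce the limit along refinement to a Cauchy
    sequence.\<close>
  define R where "R n = sorted_list_of_set (\<Union>k\<le>n. set (Q k))" for n
  have R: "is_partition s t (R n)" for n
    unfolding R_def using Q(1)[THEN partition_ends] Q(1)[THEN is_partition_set] by (intro partition_of_set) auto
  have RQ: "set (Q k) \<subseteq> set (R n)" if "k \<le> n" for k n using that unfolding R_def by auto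
  define X where "X n = ?S (R n) (\<lambda>i. R n ! i)" for n
  have close: "norm (?S P \<xi> - X n) \<le> 1 / Suc N"
    if "is_partition s t P" "set (Q N) \<subseteq> set P" "rs_tags P \<xi>" "N \<le> n" for P \<xi> N n
    unfolding X_def using that R RQ rs_left_tags[OF R] by (intro Q(2)) auto
  have "Cauchy X"
  proof (rule CauchyI)
    fix e :: real assume "0 < e"
    then obtain N where N: "1 / Suc N < e" using nat_approx_posE by blast
    have "norm (X m - X n) < e" if "m \<ge> N" "n \<ge> N" for m n
      using close[OF R[of m] RQ[OF that(1)] rs_left_tags[OF R] that(2)] N by (simp add: X_def)
    then show "\<exists>M. \<forall>m\<ge>M. \<forall>n\<ge>M. norm (X m - X n) < e" by blast
  qed
  then obtain I where I: "X \<longlonglongrightarrow> I" using Cauchy_convergent convergent_def by blast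
  have "has_rs_integral mul h a s t I"
    unfolding has_rs_integral_def
  proof (intro allI impI)
    fix e :: real assume "0 < e"
    then obtain N where N: "1 / Suc N < e" using nat_approx_posE by blast
    have "norm (?S P \<xi> - I) < e" if "is_partition s t P" "set (Q N) \<subseteq> set P" "rs_tags P \<xi>" for P \<xi>
    proof -
      have "norm (?S P \<xi> - I) \<le> 1 / Suc N"
        using close[OF that] by (intro Lim_bounded[of "\<lambda>n. norm (?S P \<xi> - X n)" _ N]) (auto intro!: tendsto_intros I)
      then show ?thesis using N by simp
    qed
    then show "\<exists>Q. is_partition s t Q \<and> (\<forall>P \<xi>. is_partition s t P \<and> set Q \<subseteq> set P \<and> rs_tags P \<xi> \<longrightarrow> norm (?S P \<xi> - I) < e)"
      using Q(1) by blast
  qed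
  then show ?thesis by blast
qed

text \<open>The exponents add up to more than 1. The surplus \<open>1 / p + 1 / q - 1\<close> is
  spent on the small factor and what remains is at most \<open>A + B\<close>; it suffices that one
  of the two is small.\<close>

lemma powr_product_le:
  assumes "0 \<le> A" "0 \<le> (B::real)" "1 \<le> p" "1 \<le> q" "1 < 1 / p + 1 / q" "A \<le> \<eta> \<or> B \<le> \<eta>"
  shows "A powr (1 / q) * B powr (1 / p) \<le> \<eta> powr (1 / p + 1 / q - 1) * (A + B)"
proof -
  have main: "A powr (1 / q) * B powr (1 / p) \<le> \<eta> powr (1 / p + 1 / q - 1) * (A + B)"
    if "A \<le> \<eta>" "0 \<le> A" "0 \<le> B" "1 \<le> p" "1 \<le> q" "1 < 1 / p + 1 / q" for A B p q :: real
  proof -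
    let ?k = "1 / p + 1 / q - 1"
    have "A powr (1 / q) = A powr (?k + (1 - 1 / p))" by simp
    also have "\<dots> = A powr ?k * A powr (1 - 1 / p)" by (rule powr_add)
    finally have "A powr (1 / q) * B powr (1 / p) = A powr ?k * (A powr (1 - 1 / p) * B powr (1 / p))" by simp
    also have "\<dots> \<le> \<eta> powr ?k * ((A + B) powr (1 - 1 / p) * (A + B) powr (1 / p))"
      using that by (intro mult_mono powr_mono2) auto
    also have "(A + B) powr (1 - 1 / p) * (A + B) powr (1 / p) = A + B"
      using that by (simp add: powr_add[symmetric])
    finally show ?thesis .
  qed
  show ?thesis
    using main[of A B p q] main[of B A q p] assms by (auto simp: mult.commute add.commute)
qed

text \<open>Where one of the two variations is at most \<open>\<eta>\<close>, the Young bound makes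
  any two sums differ by a small multiple of \<open>w\<close>. Around a point \<open>x\<close> the
  hypotheses provide this for \<open>h\<close> on the left and for \<open>z\<close> on the right, so
  a cut at \<open>x\<close> makes every short interval \<open>good\<close>, and bisection reaches
  the whole interval. The errors do not accumulate because they are proportional to the
  superadditive \<open>w\<close>.\<close>

lemma young_integral_exists:
  fixes mul :: "'a::real_normed_vector \<Rightarrow> 'b::real_normed_vector \<Rightarrow> 'c::banach"
  assumes mul: "bounded_bilinear mul" and pq: "1 \<le> p" "1 \<le> q" "1 < 1 / p + 1 / q" and st: "s \<le> t"
    and h: "fv q h s t" and z: "fv p z s t"
    and hl: "\<And>r e. s < r \<Longrightarrow> r \<le> t \<Longrightarrow> 0 < e \<Longrightarrow> \<exists>d>0. d \<le> r - s \<and> pv q h (r - d) r \<le> e"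
    and zr: "\<And>r e. s \<le> r \<Longrightarrow> r < t \<Longrightarrow> 0 < e \<Longrightarrow> \<exists>d>0. r + d \<le> t \<and> pv p z r (r + d) \<le> e"
  shows "\<exists>I. has_rs_integral mul h z s t I"
proof (rule has_rs_integral_Cauchy[OF st])
  fix e :: real assume "0 < e"
  interpret bounded_bilinear mul by fact
  obtain K where K: "0 < K" "\<And>a b. norm (mul a b) \<le> norm a * norm b * K" using pos_bounded by blast
  let ?S = "\<lambda>P \<xi>. rs_sum mul h z P \<xi>"
  define Y where "Y = young_const p q * K"
  define k where "k = 1 / p + 1 / q - 1"
  define w where "w u v = pv q h u v + pv p z u v" for u v
  have w: "super_on s t w" unfolding w_def using h z by (intro super_on_add super_on_pv) auto
  have Y: "0 \<le> Y" using young_const_nonneg pq K by (simp add: Y_def)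
  have k: "0 < k" using pq by (simp add: k_def)
  \<comment> \<open>Solves for \<open>2 * Y * \<eta> powr k * w s t \<le> e\<close>; the summands 1
    protect against \<open>Y = 0\<close> and \<open>w s t = 0\<close>.\<close>
  define \<eta> where "\<eta> = (e / (2 * (Y + 1) * (w s t + 1))) powr (1 / k)"
  have wst: "0 \<le> w s t" using super_onD(1)[OF w] st by auto
  have \<eta>: "0 < \<eta>" using \<open>0 < e\<close> Y wst by (simp add: \<eta>_def)
  have \<eta>k: "\<eta> powr k = e / (2 * (Y + 1) * (w s t + 1))"
    using k \<open>0 < e\<close> Y wst by (simp add: \<eta>_def powr_powr)
  define good where "good u v \<longleftrightarrow> (\<exists>Q. is_partition u v Q \<and> (\<forall>P \<xi> P' \<xi>'. is_partition u v P \<longrightarrow> set Q \<subseteq> set P \<longrightarrow> rs_tags P \<xi> \<longrightarrow>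
      is_partition u v P' \<longrightarrow> set Q \<subseteq> set P' \<longrightarrow> rs_tags P' \<xi>' \<longrightarrow> norm (?S P \<xi> - ?S P' \<xi>') \<le> 2 * Y * \<eta> powr k * w u v))" for u v
  let ?P = "\<lambda>u v. s \<le> u \<longrightarrow> u \<le> v \<longrightarrow> v \<le> t \<longrightarrow> good u v"
  have goodE: "\<exists>Q. is_partition u v Q \<and> (\<forall>P \<xi> P' \<xi>'. is_partition u v P \<longrightarrow> set Q \<subseteq> set P \<longrightarrow> rs_tags P \<xi> \<longrightarrow>
      is_partition u v P' \<longrightarrow> set Q \<subseteq> set P' \<longrightarrow> rs_tags P' \<xi>' \<longrightarrow> norm (?S P \<xi> - ?S P' \<xi>') \<le> 2 * Y * \<eta> powr k * w u v)"
    if "good u v" for u v using that by (simp only: good_def)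
  have trans: "good u v" if gux: "good u x" and gxv: "good x v" and uxv: "u \<le> x" "x \<le> v" and suv: "s \<le> u" "v \<le> t" for u x v
  proof -
    obtain Q1 where Q1: "is_partition u x Q1" "\<And>P \<xi> P' \<xi>'. is_partition u x P \<Longrightarrow> set Q1 \<subseteq> set P \<Longrightarrow> rs_tags P \<xi> \<Longrightarrow>
      is_partition u x P' \<Longrightarrow> set Q1 \<subseteq> set P' \<Longrightarrow> rs_tags P' \<xi>' \<Longrightarrow> norm (?S P \<xi> - ?S P' \<xi>') \<le> 2 * Y * \<eta> powr k * w u x"
      using goodE[OF gux] by blast
    obtain Q2 where Q2: "is_partition x v Q2" "\<And>P \<xi> P' \<xi>'. is_partition x v P \<Longrightarrow> set Q2 \<subseteq> set P \<Longrightarrow> rs_tags P \<xi> \<Longrightarrow>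
      is_partition x v P' \<Longrightarrow> set Q2 \<subseteq> set P' \<Longrightarrow> rs_tags P' \<xi>' \<Longrightarrow> norm (?S P \<xi> - ?S P' \<xi>') \<le> 2 * Y * \<eta> powr k * w x v"
      using goodE[OF gxv] by blast
    have QQ: "is_partition u v (Q1 @ tl Q2)" "set (Q1 @ tl Q2) = set Q1 \<union> set Q2" using partition_join[OF Q1(1) Q2(1)] by auto
    have split: "\<exists>P1 P2 n. is_partition u x P1 \<and> is_partition x v P2 \<and> set Q1 \<subseteq> set P1 \<and> set Q2 \<subseteq> set P2 \<and>
        rs_tags P1 \<xi> \<and> rs_tags P2 (\<lambda>i. \<xi> (i + n)) \<and> ?S P \<xi> = ?S P1 \<xi> + ?S P2 (\<lambda>i. \<xi> (i + n))"
      if P: "is_partition u v P" "set (Q1 @ tl Q2) \<subseteq> set P" "rs_tags P \<xi>" for P \<xi>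
    proof -
      have "x \<in> set P" using P QQ partition_ends[OF Q1(1)] by auto
      then obtain P1 P2 n where P12: "is_partition u x P1" "is_partition x v P2" "set P1 = set P \<inter> {..x}" "set P2 = set P \<inter> {x..}"
        "rs_tags P1 \<xi>" "rs_tags P2 (\<lambda>i. \<xi> (i + n))" "?S P \<xi> = ?S P1 \<xi> + ?S P2 (\<lambda>i. \<xi> (i + n))"
        using rs_split[OF P(1), of x mul h z] P(3) by blast
      moreover have "set Q1 \<subseteq> set P1" "set Q2 \<subseteq> set P2"
        using P(2) QQ(2) P12 is_partition_set[OF Q1(1)] is_partition_set[OF Q2(1)] by auto
      ultimately show ?thesis by blast
    qed
    have "norm (?S P \<xi> - ?S P' \<xi>') \<le> 2 * Y * \<eta> powr k * w u v"
      if P: "is_partition u v P" "set (Q1 @ tl Q2) \<subseteq> set P" "rs_tags P \<xi>"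
        "is_partition u v P'" "set (Q1 @ tl Q2) \<subseteq> set P'" "rs_tags P' \<xi>'" for P \<xi> P' \<xi>'
    proof -
      obtain P1 P2 n where a: "is_partition u x P1" "is_partition x v P2" "set Q1 \<subseteq> set P1" "set Q2 \<subseteq> set P2"
        "rs_tags P1 \<xi>" "rs_tags P2 (\<lambda>i. \<xi> (i + n))" "?S P \<xi> = ?S P1 \<xi> + ?S P2 (\<lambda>i. \<xi> (i + n))"
        using split[OF P(1-3)] by blast
      obtain P1' P2' n' where b: "is_partition u x P1'" "is_partition x v P2'" "set Q1 \<subseteq> set P1'" "set Q2 \<subseteq> set P2'"
        "rs_tags P1' \<xi>'" "rs_tags P2' (\<lambda>i. \<xi>' (i + n'))" "?S P' \<xi>' = ?S P1' \<xi>' + ?S P2' (\<lambda>i. \<xi>' (i + n'))"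
        using split[OF P(4-6)] by blast
      have "norm (?S P \<xi> - ?S P' \<xi>') \<le> norm (?S P1 \<xi> - ?S P1' \<xi>') + norm (?S P2 (\<lambda>i. \<xi> (i + n)) - ?S P2' (\<lambda>i. \<xi>' (i + n')))"
        unfolding a(7) b(7) by (rule norm_diff_triangle_ineq)
      also have "\<dots> \<le> 2 * Y * \<eta> powr k * w u x + 2 * Y * \<eta> powr k * w x v"
        using a b by (intro add_mono Q1(2) Q2(2)) auto
      also have "\<dots> = 2 * Y * \<eta> powr k * (w u x + w x v)" by (simp add: algebra_simps)
      also have "\<dots> \<le> 2 * Y * \<eta> powr k * w u v"
        using super_onD(2)[OF w, of u x v] suv uxv Y by (intro mult_left_mono) auto
      finally show ?thesis .
    qed
    then show ?thesis unfolding good_def using QQ(1) by blast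
  qed
  have small: "good u v" if "pv q h u v \<le> \<eta> \<or> pv p z u v \<le> \<eta>" and uv: "s \<le> u" "u \<le> v" "v \<le> t" for u v
  proof -
    have fuv: "fv q h u v" "fv p z u v" using fv_subset[OF h] fv_subset[OF z] uv by auto
    have nn: "0 \<le> pv q h u v" "0 \<le> pv p z u v" using pv_nonneg fuv uv by auto
    have one: "norm (?S P \<xi> - mul (h u) (z v - z u)) \<le> Y * (\<eta> powr k * w u v)"
      if P: "is_partition u v P" "rs_tags P \<xi>" for P \<xi>
    proof -
      have "norm (?S P \<xi> - mul (h u) (z v - z u)) \<le> young_const p q * (K * pv q h u v powr (1 / q) * pv p z u v powr (1 / p))"
        using K nn pq uv by (intro young_pv[OF mul _ _ pq fuv(1) _ _ fuv(2) _ _ P]) (auto simp: powr_powr)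
      also have "\<dots> = Y * (pv q h u v powr (1 / q) * pv p z u v powr (1 / p))" by (simp add: Y_def)
      also have "\<dots> \<le> Y * (\<eta> powr k * w u v)"
        unfolding k_def w_def using nn pq \<open>pv q h u v \<le> \<eta> \<or> pv p z u v \<le> \<eta>\<close> Y
        by (intro mult_left_mono powr_product_le) auto
      finally show ?thesis .
    qed
    have "norm (?S P \<xi> - ?S P' \<xi>') \<le> 2 * Y * \<eta> powr k * w u v"
      if "is_partition u v P" "rs_tags P \<xi>" "is_partition u v P'" "rs_tags P' \<xi>'" for P \<xi> P' \<xi>'
      using one[OF that(1,2)] one[OF that(3,4)] norm_triangle_ineq4[of "?S P \<xi> - mul (h u) (z v - z u)" "?S P' \<xi>' - mul (h u) (z v - z u)"]
      by simp
    then show ?thesis unfolding good_def using partition_exists[OF uv(2)] by blast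
  qed
  have "?P s t"
  proof (rule Bolzano[of s t ?P, OF st])
    fix u x v assume "?P u x" "?P x v" "u \<le> x" "x \<le> v"
    then show "?P u v" using trans[of u x v] by auto
  next
    fix x assume x: "s \<le> x" "x \<le> t"
    have "\<exists>d>0. \<forall>u. s \<le> u \<longrightarrow> u \<le> x \<longrightarrow> x - u < d \<longrightarrow> pv q h u x \<le> \<eta>"
    proof (cases "s = x")
      case True
      then have "pv q h u x \<le> \<eta>" if "s \<le> u" "u \<le> x" for u using that \<eta> by (simp add: fv_pv_same)
      then show ?thesis by (intro exI[of _ 1]) auto
    next
      case False
      then obtain d where d: "0 < d" "d \<le> x - s" "pv q h (x - d) x \<le> \<eta>" using hl[of x \<eta>] x \<eta> by auto
      have "pv q h u x \<le> \<eta>" if "s \<le> u" "u \<le> x" "x - u < d" for u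
        using pv_mono[of q h "x - d" x u x] fv_subset[OF h, of "x - d" x] d that x by auto
      then show ?thesis using d by blast
    qed
    then obtain d1 where d1: "0 < d1" "\<And>u. s \<le> u \<Longrightarrow> u \<le> x \<Longrightarrow> x - u < d1 \<Longrightarrow> pv q h u x \<le> \<eta>" by blast
    have "\<exists>d>0. \<forall>v. x \<le> v \<longrightarrow> v \<le> t \<longrightarrow> v - x < d \<longrightarrow> pv p z x v \<le> \<eta>"
    proof (cases "x = t")
      case True
      then have "pv p z x v \<le> \<eta>" if "x \<le> v" "v \<le> t" for v using that \<eta> by (simp add: fv_pv_same)
      then show ?thesis by (intro exI[of _ 1]) auto
    next
      case False
      then obtain d where d: "0 < d" "x + d \<le> t" "pv p z x (x + d) \<le> \<eta>" using zr[of x \<eta>] x \<eta> by auto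
      have "pv p z x v \<le> \<eta>" if "x \<le> v" "v \<le> t" "v - x < d" for v
        using pv_mono[of p z x "x + d" x v] fv_subset[OF z, of x "x + d"] d that x by auto
      then show ?thesis using d by blast
    qed
    then obtain d2 where d2: "0 < d2" "\<And>v. x \<le> v \<Longrightarrow> v \<le> t \<Longrightarrow> v - x < d2 \<Longrightarrow> pv p z x v \<le> \<eta>" by blast
    have "good u v" if "u \<le> x" "x \<le> v" "v - u < min d1 d2" and uv: "s \<le> u" "u \<le> v" "v \<le> t" for u v
    proof (rule trans)
      show "good u x" using d1(2)[of u] that by (intro small) auto
      show "good x v" using d2(2)[of v] that by (intro small) auto
    qed (use that in auto)
    then show "\<exists>d>0. \<forall>u v. u \<le> x \<and> x \<le> v \<and> v - u < d \<longrightarrow> ?P u v" using d1 d2 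
      by (intro exI[of _ "min d1 d2"] conjI allI impI) (simp, blast)
  qed
  then obtain Q where Q: "is_partition s t Q" "\<And>P \<xi> P' \<xi>'. is_partition s t P \<Longrightarrow> set Q \<subseteq> set P \<Longrightarrow> rs_tags P \<xi> \<Longrightarrow>
      is_partition s t P' \<Longrightarrow> set Q \<subseteq> set P' \<Longrightarrow> rs_tags P' \<xi>' \<Longrightarrow> norm (?S P \<xi> - ?S P' \<xi>') \<le> 2 * Y * \<eta> powr k * w s t"
    using goodE[of s t] st by blast
  have "2 * Y * \<eta> powr k * w s t = e * ((Y / (Y + 1)) * (w s t / (w s t + 1)))"
  proof -
    have "2 * Y * (e / (2 * a * b)) * c = e * ((Y / a) * (c / b))" for a b c :: real by simp
    then show ?thesis unfolding \<eta>k .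
  qed
  also have "\<dots> \<le> e * (1 * 1)"
    using Y wst \<open>0 < e\<close> by (intro mult_left_mono mult_mono) auto
  finally have "2 * Y * \<eta> powr k * w s t \<le> e" by simp
  then show "\<exists>Q. is_partition s t Q \<and> (\<forall>P \<xi> P' \<xi>'. is_partition s t P \<longrightarrow> set Q \<subseteq> set P \<longrightarrow> rs_tags P \<xi> \<longrightarrow>
      is_partition s t P' \<longrightarrow> set Q \<subseteq> set P' \<longrightarrow> rs_tags P' \<xi>' \<longrightarrow> norm (?S P \<xi> - ?S P' \<xi>') \<le> e)"
    using Q by (meson order_trans)
qed

section \<open>Integrals of left limits and their size\<close>

definition rsi ::
  "('a \<Rightarrow> 'b::ab_group_add \<Rightarrow> 'c::real_normed_vector) \<Rightarrow> (real \<Rightarrow> 'a) \<Rightarrow> (real \<Rightarrow> 'b) \<Rightarrow> real \<Rightarrow> real \<Rightarrow> 'c" where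
  "rsi mul h a s t = (THE I. has_rs_integral mul h a s t I)"

lemma rsi_eqI: "has_rs_integral mul h a s t I \<Longrightarrow> rsi mul h a s t = I"
  unfolding rsi_def using has_rs_integral_unique by blast

lemma rsi_cong:
  "(\<And>r. s \<le> r \<Longrightarrow> r \<le> t \<Longrightarrow> h r = h' r) \<Longrightarrow> rsi mul h a s t = rsi mul h' a s t"
  unfolding rsi_def by (intro arg_cong[of _ _ The] ext has_rs_integral_cong)

lemma has_rs_integral_left_lim:
  fixes mul :: "'a::real_normed_vector \<Rightarrow> 'b::real_normed_vector \<Rightarrow> 'c::banach"
  assumes mul: "bounded_bilinear mul" and pq: "1 \<le> p" "1 \<le> q" "1 < 1 / p + 1 / q"
    and X: "cadlag X" "fv q X 0 v" and z: "cadlag z" "fv p z 0 v" and uv: "0 \<le> u" "u \<le> v"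
  shows "has_rs_integral mul (left_lim X) z u v (rsi mul (left_lim X) z u v)"
proof -
  have fL: "fv q (left_lim X) 0 v" using X pq uv fv_pv_left_lim[of X q v] by auto
  have "\<exists>I. has_rs_integral mul (left_lim X) z u v I"
  proof (rule young_integral_exists[OF mul pq uv(2)])
    show "fv q (left_lim X) u v" using fL uv by (intro fv_subset[OF fL]) auto
    show "fv p z u v" using uv by (intro fv_subset[OF z(2)]) auto
    fix r e :: real assume r: "u < r" "r \<le> v" "0 < e"
    then obtain d where d: "0 < d" "d \<le> r" "pv q (left_lim X) (r - d) r \<le> e"
      using pv_left_lim_left_small[OF X(1) fv_subset[OF X(2)], of r e] uv pq by auto
    have "pv q (left_lim X) (r - min d (r - u)) r \<le> e"
      using d r uv pv_mono[of q "left_lim X" "r - d" r "r - min d (r - u)" r] fv_subset[OF fL, of "r - d" r] by auto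
    then show "\<exists>d>0. d \<le> r - u \<and> pv q (left_lim X) (r - d) r \<le> e"
      using d r by (intro exI[of _ "min d (r - u)"]) auto
  next
    fix r e :: real assume r: "u \<le> r" "r < v" "0 < e"
    then show "\<exists>d>0. r + d \<le> v \<and> pv p z r (r + d) \<le> e"
      using uv pq by (intro pv_right_small cadlag_right[OF z(1)] fv_subset[OF z(2)]) auto
  qed
  then show ?thesis using rsi_eqI by metis
qed

text \<open>The left limits stay within \<open>H\<close> of \<open>X 0\<close>, so
  \<open>K * (norm (X 0) + H)\<close> accounts for the term with the integrand frozen at
  \<open>u\<close>; the Young remainder adds the summand with
  \<open>young_const p q\<close>.\<close>

lemma rsi_young_bound:
  fixes mul :: "'a::real_normed_vector \<Rightarrow> 'b::real_normed_vector \<Rightarrow> 'c::banach"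
  assumes mul: "bounded_bilinear mul" and K: "0 \<le> K" "\<And>a b. norm (mul a b) \<le> norm a * norm b * K"
    and pq: "1 \<le> p" "1 \<le> q" "1 < 1 / p + 1 / q"
    and X: "cadlag X" "fv q X 0 v" "pv q X 0 v \<le> H powr q" "0 \<le> H" and z: "cadlag z" "fv p z 0 v" and uv: "0 \<le> u" "u \<le> v"
  shows "norm (rsi mul (left_lim X) z u v) \<le> K * (norm (X 0) + (1 + young_const p q) * H) * pv p z u v powr (1 / p)"
proof -
  let ?I = "rsi mul (left_lim X) z u v" and ?Z = "pv p z u v powr (1 / p)" and ?L = "left_lim X"
  have fL: "fv q ?L 0 v" "pv q ?L 0 v \<le> H powr q" using X pq uv fv_pv_left_lim[of X q v] by auto
  have fz: "fv p z u v" using uv by (intro fv_subset[OF z(2)]) auto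
  have nz: "0 \<le> pv p z u v" using pv_nonneg fz uv by auto
  have Z: "norm (z v - z u) \<le> ?Z" using uv pq by (intro incr_le_pv_root[OF z(2)]) auto
  have L: "norm (?L u) \<le> norm (X 0) + H"
  proof -
    have "norm (?L u - ?L 0) \<le> pv q ?L 0 u powr (1 / q)" using uv pq by (intro incr_le_pv_root[OF fL(1)]) auto
    also have "\<dots> \<le> (H powr q) powr (1 / q)"
      using pq uv fL pv_mono[OF fL(1), of 0 u] fv_subset[OF fL(1), of 0 u] by (intro powr_mono2 pv_nonneg) auto
    also have "\<dots> = H" using X pq by (simp add: powr_powr)
    finally show ?thesis using norm_triangle_sub[of "?L u" "?L 0"] by simp
  qed
  have "norm (?I - mul (?L u) (z v - z u)) \<le> young_const p q * (K * H * ?Z)"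
  proof (rule has_rs_integral_norm_le[OF has_rs_integral_left_lim[OF mul pq X(1,2) z uv]])
    fix P \<xi> assume P: "is_partition u v P" "rs_tags P \<xi>"
    have "fv q ?L u v" "pv q ?L u v \<le> H powr q"
      using uv fL fv_subset[OF fL(1), of u v] pv_mono[OF fL(1), of u v] by auto
    then show "norm (rs_sum mul ?L z P \<xi> - mul (?L u) (z v - z u)) \<le> young_const p q * (K * H * ?Z)"
      using pq nz X uv by (intro young_pv[OF mul K pq _ _ _ fz _ _ P]) (auto simp: powr_powr)
  qed
  moreover have "norm (mul (?L u) (z v - z u)) \<le> (norm (X 0) + H) * ?Z * K"
    by (rule order_trans[OF K(2)]) (use L Z K X in \<open>intro mult_right_mono mult_mono; simp\<close>)
  moreover have "norm ?I \<le> norm (mul (?L u) (z v - z u)) + norm (?I - mul (?L u) (z v - z u))"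
    by (rule norm_triangle_sub)
  ultimately have "norm ?I \<le> (norm (X 0) + H) * ?Z * K + young_const p q * (K * H * ?Z)" by linarith
  also have "\<dots> = K * (norm (X 0) + (1 + young_const p q) * H) * ?Z" by (simp add: algebra_simps)
  finally show ?thesis .
qed

text \<open>The integral against \<open>a\<close> asks for no more than a bounded integrand.\<close>

lemma rs_integral_bv_bound:
  fixes mul :: "'a::real_normed_vector \<Rightarrow> 'b::real_normed_vector \<Rightarrow> 'c::real_normed_vector"
  assumes I: "has_rs_integral mul h a u v I" and K: "0 \<le> K" "\<And>a b. norm (mul a b) \<le> norm a * norm b * K"
    and h: "\<And>r. u \<le> r \<Longrightarrow> r \<le> v \<Longrightarrow> norm (h r) \<le> B" "0 \<le> B" and a: "fv 1 a u v"
  shows "norm I \<le> K * B * pv 1 a u v"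
proof -
  have "norm (I - 0) \<le> K * B * pv 1 a u v"
  proof (rule has_rs_integral_norm_le[OF I])
    fix P \<xi> assume P: "is_partition u v P" "rs_tags P \<xi>"
    have "norm (rs_sum mul h a P \<xi>) \<le> (\<Sum>i<length P - 1. K * B * norm (a (P ! Suc i) - a (P ! i)) powr 1)"
      unfolding rs_sum_def
    proof (rule sum_norm_le)
      fix i assume i: "i \<in> {..<length P - 1}"
      then have "P ! i \<in> set P" "P ! Suc i \<in> set P" by auto
      then have "u \<le> P ! i" "P ! Suc i \<le> v" using is_partition_set[OF P(1)] by auto
      then have "norm (h (\<xi> i)) \<le> B" using P(2) i h unfolding rs_tags_def by (metis lessThan_iff order_trans)
      then have "norm (h (\<xi> i)) * norm (a (P ! Suc i) - a (P ! i)) * K \<le> B * norm (a (P ! Suc i) - a (P ! i)) * K"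
        using K by (intro mult_right_mono) auto
      then show "norm (mul (h (\<xi> i)) (a (P ! Suc i) - a (P ! i))) \<le> K * B * norm (a (P ! Suc i) - a (P ! i)) powr 1"
        using K(2)[of "h (\<xi> i)" "a (P ! Suc i) - a (P ! i)"] by (simp add: mult_ac)
    qed
    also have "\<dots> = K * B * pvar_sum 1 a P" unfolding pvar_sum_def by (simp add: sum_distrib_left)
    also have "\<dots> \<le> K * B * pv 1 a u v" using K h le_pv[OF a P(1)] by (intro mult_left_mono) auto
    finally show "norm (rs_sum mul h a P \<xi> - 0) \<le> K * B * pv 1 a u v" by simp
  qed
  then show ?thesis by simp
qed

section \<open>The one-dimensional Skorokhod problem\<close>

lemma eventually_at_rightE:
  assumes "eventually P (at_right (t::real))"
  obtains d where "t < d" "\<And>s. t < s \<Longrightarrow> s < d \<Longrightarrow> P s"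
  using assms unfolding eventually_at_right_field by blast

text \<open>The interval \<open>{0..max 0 t}\<close> makes this constant on negative times, like the integrator in \<open>skorokhod\<close>.\<close>

definition smax :: "(real \<Rightarrow> real) \<Rightarrow> real \<Rightarrow> real" where
  "smax u t = (SUP s\<in>{0..max 0 t}. max 0 (u s))"

lemma smax_bdd: "cadlag (u :: real \<Rightarrow> real) \<Longrightarrow> bdd_above ((\<lambda>s. max 0 (u s)) ` {0..max 0 t})"
proof -
  assume "cadlag u"
  then obtain B where B: "\<And>s. 0 \<le> s \<Longrightarrow> s \<le> max 0 t \<Longrightarrow> norm (u s) \<le> B"
    using cadlag_bounded[of u "max 0 t"] by auto
  show ?thesis
  proof (rule bdd_aboveI2)
    fix s assume "s \<in> {0..max 0 t}"
    then show "max 0 (u s) \<le> B" using B[of s] by (auto simp: abs_le_iff intro: order_trans[OF abs_ge_zero])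
  qed
qed

lemma smax_upper: "cadlag u \<Longrightarrow> 0 \<le> s \<Longrightarrow> s \<le> t \<Longrightarrow> u s \<le> smax u t"
  unfolding smax_def by (rule order_trans[OF _ cSUP_upper[OF _ smax_bdd, of s]]) auto

lemma smax_nonneg: "cadlag u \<Longrightarrow> 0 \<le> smax u t"
  unfolding smax_def by (rule order_trans[OF _ cSUP_upper[OF _ smax_bdd, of 0]]) auto

lemma smax_least: "0 \<le> B \<Longrightarrow> (\<And>s. 0 \<le> s \<Longrightarrow> s \<le> max 0 t \<Longrightarrow> u s \<le> B) \<Longrightarrow> smax u t \<le> B"
  unfolding smax_def by (intro cSUP_least) auto

lemma smax_mono: "cadlag u \<Longrightarrow> s \<le> t \<Longrightarrow> smax u s \<le> smax u t"
  unfolding smax_def by (rule cSUP_subset_mono) (auto intro: smax_bdd)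

lemma smax_split:
  assumes "cadlag u" "0 \<le> s" "smax u s \<le> B" "\<And>r. s < r \<Longrightarrow> r \<le> t \<Longrightarrow> u r \<le> B"
  shows "smax u t \<le> B"
proof (rule smax_least)
  show "0 \<le> B" using smax_nonneg[OF assms(1), of s] assms(3) by linarith
  fix r assume "0 \<le> r" "r \<le> max 0 t"
  then show "u r \<le> B"
    using smax_upper[OF assms(1), of r s] assms by (cases "r \<le> s") force+
qed

lemma smax_less:
  assumes "cadlag u" "0 \<le> c" "c < smax u t"
  shows "\<exists>s. 0 \<le> s \<and> s \<le> max 0 t \<and> c < u s"
  using smax_least[OF assms(2), of t u] assms(3) by force

lemma smax_0: "u 0 \<le> 0 \<Longrightarrow> t \<le> 0 \<Longrightarrow> smax u t = 0"
  unfolding smax_def by (simp add: max_absorb1)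

lemma smax_cong: "(\<And>s. 0 \<le> s \<Longrightarrow> s \<le> t \<Longrightarrow> u s = u' s) \<Longrightarrow> 0 \<le> t \<Longrightarrow> smax u t = smax u' t"
  unfolding smax_def by (intro SUP_cong) auto

lemma smax_right:
  assumes "cadlag u"
  shows "(smax u \<longlongrightarrow> smax u t) (at_right t)"
proof (cases "t < 0")
  case True
  then have "eventually (\<lambda>s. smax u s = smax u t) (at_right t)"
    using eventually_at_right_real[OF True] by (auto elim!: eventually_mono simp: smax_def max_absorb1)
  then show ?thesis by (rule tendsto_eventually)
next
  case False
  show ?thesis
  proof (rule order_tendstoI)
    fix c assume "c < smax u t"
    then have "c < smax u s" if "t < s" for s using smax_mono[OF assms, of t s] that by linarith
    then show "eventually (\<lambda>s. c < smax u s) (at_right t)"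
      using eventually_at_right_less[of t] by (auto elim: eventually_mono)
  next
    fix c assume c: "smax u t < c"
    define b where "b = (smax u t + c) / 2"
    have b: "smax u t < b" "b < c" using c by (auto simp: b_def)
    have "u t < b" using smax_upper[OF assms, of t t] False b by linarith
    then have ev: "eventually (\<lambda>s. u s < b) (at_right t)"
      using order_tendstoD(2)[OF cadlag_right[OF assms, of t]] False by simp
    then obtain d where d: "d > t" "\<And>s. t < s \<Longrightarrow> s < d \<Longrightarrow> u s < b"
      using eventually_at_rightE[OF ev] by metis
    have "smax u s \<le> b" if "t < s" "s < d" for s
    proof (rule smax_split[OF assms, of t])
      show "u r \<le> b" if "t < r" "r \<le> s" for r using d(2)[of r] that \<open>s < d\<close> by simp
    qed (use b False in auto)
    then show "eventually (\<lambda>s. smax u s < c) (at_right t)"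
      using eventually_at_right_real[OF d(1)] b by (auto elim!: eventually_mono dest!: order.strict_trans1)
  qed
qed

lemma fv_pv_mono_fun:
  assumes "\<And>u v. s \<le> u \<Longrightarrow> u \<le> v \<Longrightarrow> v \<le> t \<Longrightarrow> k u \<le> (k v :: real)" "1 \<le> p" "s \<le> t"
  shows "fv p k s t" "pv p k s t \<le> (k t - k s) powr p"
proof -
  have sup: "super_on s t (\<lambda>u v. (k v - k u) powr p)"
    by (rule super_on_powr[OF _ assms(2)]) (use assms(1) in \<open>auto simp: super_on_def\<close>)
  have inc: "norm (k v - k u) powr p \<le> (k v - k u) powr p" if "s \<le> u" "u < v" "v \<le> t" for u v
    using assms(1)[of u v] that by simp
  show "fv p k s t" "pv p k s t \<le> (k t - k s) powr p" using pv_control[OF sup inc] assms(3) by auto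
qed

lemma cadlag_smax:
  assumes "cadlag u" shows "cadlag (smax u)"
  by (rule cadlag_of_fv[of _ 1]) (use smax_right[OF assms] smax_mono[OF assms] in \<open>auto intro: fv_pv_mono_fun(1)\<close>)

text \<open>\<open>Inv\<close> says that the variation of \<open>d\<close> so far is at most that of \<open>w\<close> up to the last turning point \<open>r\<close> plus one pending
  monotone move with direction \<open>\<sigma>\<close>, and that \<open>w\<close> has already overshot \<open>d\<close> in that direction at \<open>s\<close>.\<close>

lemma zigzag_variation:
  fixes w d :: "real \<Rightarrow> real"
  assumes w: "fv p w 0 T" "w 0 = 0" and p: "1 \<le> p" and d0: "d 0 = 0"
    and move: "\<And>\<sigma> t t'. \<sigma> = 1 \<or> \<sigma> = -1 \<Longrightarrow> 0 \<le> t \<Longrightarrow> t < t' \<Longrightarrow> t' \<le> T \<Longrightarrow> \<sigma> * d t < \<sigma> * d t' \<Longrightarrow>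
        \<exists>s. t < s \<and> s \<le> t' \<and> \<sigma> * d t' \<le> \<sigma> * w s"
    and P: "is_partition 0 T P"
  shows "pvar_sum p d P \<le> pv p w 0 T"
proof -
  define Inv where "Inv a A \<longleftrightarrow> (\<exists>\<sigma> r s. (\<sigma> = 1 \<or> \<sigma> = -1) \<and> 0 \<le> r \<and> r \<le> s \<and> s \<le> a \<and>
     A \<le> pv p w 0 r + \<bar>d a - w r\<bar> powr p \<and> 0 \<le> \<sigma> * (d a - w r) \<and> 0 \<le> \<sigma> * (w s - d a))" for a A
  have InvI: "Inv a A" if "\<sigma> = 1 \<or> \<sigma> = -1" "0 \<le> r" "r \<le> s" "s \<le> a"
     "A \<le> pv p w 0 r + \<bar>d a - w r\<bar> powr p" "0 \<le> \<sigma> * (d a - w r)" "0 \<le> \<sigma> * (w s - d a)" for a A \<sigma> r s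
    using that unfolding Inv_def by blast
  have pvs: "pv p w 0 r + \<bar>w s - w r\<bar> powr p \<le> pv p w 0 s" if "0 \<le> r" "r \<le> s" "s \<le> T" for r s
    using pv_superadd[of p w 0 s r] incr_le_pv[OF w(1), of r s] fv_subset[OF w(1), of 0 s] that by auto
  have step: "Inv v (A + \<bar>d v - d a\<bar> powr p)" if I: "Inv a A" and av: "0 \<le> a" "a < v" "v \<le> T" for a v A
  proof -
    obtain \<sigma> r s where h: "\<sigma> = 1 \<or> \<sigma> = -1" "0 \<le> r" "r \<le> s" "s \<le> a"
      "A \<le> pv p w 0 r + \<bar>d a - w r\<bar> powr p" "0 \<le> \<sigma> * (d a - w r)" "0 \<le> \<sigma> * (w s - d a)"
      using I unfolding Inv_def by blast
    consider "d v = d a" | "\<sigma> * d a < \<sigma> * d v" | "\<sigma> * d v < \<sigma> * d a" using h(1) by fastforce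
    then show ?thesis
    proof cases
      case 1
      then show ?thesis using h av by (intro InvI[of \<sigma> r s]) auto
    next
      \<comment> \<open>The move goes on in the pending direction and merges with the pending one by
        \<open>powr_superadd\<close>.\<close>
      case 2
      obtain s' where s': "a < s'" "s' \<le> v" "\<sigma> * d v \<le> \<sigma> * w s'" using move[OF h(1) av 2] by blast
      have eq: "\<bar>d a - w r\<bar> + \<bar>d v - d a\<bar> = \<bar>d v - w r\<bar>" using h(1,6) 2 by auto
      have "\<bar>d a - w r\<bar> powr p + \<bar>d v - d a\<bar> powr p \<le> \<bar>d v - w r\<bar> powr p"
        using powr_superadd[OF p, of "\<bar>d a - w r\<bar>" "\<bar>d v - d a\<bar>"] unfolding eq by simp
      then have "A + \<bar>d v - d a\<bar> powr p \<le> pv p w 0 r + \<bar>d v - w r\<bar> powr p" using h(5) by linarith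
      moreover have "0 \<le> \<sigma> * (d v - w r)" "0 \<le> \<sigma> * (w s' - d v)" using h(1,6) 2 s' by auto
      moreover have "r \<le> s'" using h s' by linarith
      ultimately show ?thesis using h(1,2) s'(2) by (intro InvI[of \<sigma> r s']) auto
    next
      \<comment> \<open>The direction turns and \<open>s\<close> becomes the new turning point.
        Since \<open>w s\<close> overshoots \<open>d a\<close>, both the finished move and the new
        one only grow when \<open>d a\<close> is replaced by \<open>w s\<close>.\<close>
      case 3
      have \<sigma>': "- \<sigma> = 1 \<or> - \<sigma> = -1" using h(1) by auto
      obtain s' where s': "a < s'" "s' \<le> v" "- \<sigma> * d v \<le> - \<sigma> * w s'" using move[OF \<sigma>' av] 3 by auto
      have "\<bar>d a - w r\<bar> powr p \<le> \<bar>w s - w r\<bar> powr p"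
        using h(1,6,7) p by (intro powr_mono2) auto
      moreover have "\<bar>d v - d a\<bar> powr p \<le> \<bar>d v - w s\<bar> powr p"
        using h(1,7) 3 p by (intro powr_mono2) auto
      ultimately have "A + \<bar>d v - d a\<bar> powr p \<le> pv p w 0 s + \<bar>d v - w s\<bar> powr p"
        using pvs[of r s] h av by linarith
      moreover have "0 \<le> - \<sigma> * (d v - w s)" "0 \<le> - \<sigma> * (w s' - d v)" using h(1,7) 3 s' by auto
      moreover have "0 \<le> s" "s \<le> s'" using h s' by linarith+
      ultimately show ?thesis using \<sigma>' s'(2) by (intro InvI[of "- \<sigma>" s s']) auto
    qed
  qed
  have final: "A \<le> pv p w 0 T" if I: "Inv T A" for A
  proof -
    obtain \<sigma> r s where h: "\<sigma> = 1 \<or> \<sigma> = -1" "0 \<le> r" "r \<le> s" "s \<le> T"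
      "A \<le> pv p w 0 r + \<bar>d T - w r\<bar> powr p" "0 \<le> \<sigma> * (d T - w r)" "0 \<le> \<sigma> * (w s - d T)"
      using I unfolding Inv_def by blast
    have "\<bar>d T - w r\<bar> powr p \<le> \<bar>w s - w r\<bar> powr p"
      using h(1,6,7) p by (intro powr_mono2) auto
    then show ?thesis using h pvs[of r s] pv_mono[OF w(1), of 0 s] by linarith
  qed
  have "0 \<le> a \<longrightarrow> (\<forall>A. Inv a A \<longrightarrow> A + pvar_sum p d P \<le> pv p w 0 T)" if "is_partition a T P" for a P
    using that
  proof (induction rule: is_partition_induct)
    case single
    then show ?case using final by auto
  next
    case (Cons a v P)
    show ?case
    proof (intro impI allI)
      fix A assume a: "0 \<le> a" "Inv a A"
      have "Inv v (A + \<bar>d v - d a\<bar> powr p)" using step[OF a(2,1)] Cons.hyps by auto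
      then have "A + \<bar>d v - d a\<bar> powr p + pvar_sum p d P \<le> pv p w 0 T" using Cons a by auto
      then show "A + pvar_sum p d (a # P) \<le> pv p w 0 T" using Cons.hyps by (simp add: pvar_sum_Cons add.assoc)
    qed
  qed
  moreover have "Inv 0 0" using w d0 by (intro InvI[of 1 0 0]) (auto simp: fv_pv_same)
  ultimately have "0 + pvar_sum p d P \<le> pv p w 0 T" using P by blast
  then show ?thesis by simp
qed

text \<open>Discrete version of \<open>smax\<close>. The supremum over an interval need not be
  attained by a cadlag function, whereas a maximum over finitely many times is;
  \<open>zigzag_variation\<close> needs such a witness.\<close>

definition fmax :: "real set \<Rightarrow> (real \<Rightarrow> real) \<Rightarrow> real \<Rightarrow> real" where
  "fmax F u t = Max (insert 0 (u ` {s\<in>F. s \<le> t}))"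

lemma fmax_upper: "finite F \<Longrightarrow> s \<in> F \<Longrightarrow> s \<le> t \<Longrightarrow> u s \<le> fmax F u t"
  unfolding fmax_def by (intro Max_ge) auto

lemma fmax_mono: "finite F \<Longrightarrow> s \<le> t \<Longrightarrow> fmax F u s \<le> fmax F u t"
  unfolding fmax_def by (intro Max_mono) auto

lemma fmax_nonneg: "finite F \<Longrightarrow> 0 \<le> fmax F u t"
  unfolding fmax_def by (intro Max_ge) auto

text \<open>As \<open>fmax F u'\<close> cannot decrease, \<open>fmax F u\<close> must have
  increased. Its new value is attained at some \<open>s\<close> after \<open>t\<close>, and there
  \<open>u' s\<close> is at most \<open>fmax F u' t'\<close>.\<close>

lemma fmax_jump:
  assumes "finite F" "t < t'" "fmax F u t - fmax F u' t < fmax F u t' - fmax F u' t'"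
  shows "\<exists>s. t < s \<and> s \<le> t' \<and> fmax F u t' - fmax F u' t' \<le> u s - u' s"
proof -
  have lt: "fmax F u t < fmax F u t'" using fmax_mono[OF assms(1), of t t' u'] assms by linarith
  have "fmax F u t' \<in> insert 0 (u ` {s\<in>F. s \<le> t'})" unfolding fmax_def using assms(1) by (intro Max_in) auto
  then obtain s where s: "s \<in> F" "s \<le> t'" "fmax F u t' = u s"
    using lt fmax_nonneg[OF assms(1), of u t] by auto
  have "t < s" using fmax_upper[OF assms(1) s(1), of t u] lt s by force
  then show ?thesis using s fmax_upper[OF assms(1) s(1,2), of u'] by auto
qed

text \<open>\<open>zigzag_variation\<close> with \<open>w = u - u'\<close> gives the bound, with
  constant 1, for finite maxima; along a fixed partition the suprema are limits of such maxima.
  Equal starting values provide \<open>w 0 = 0\<close>.\<close>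

lemma smax_variation:
  assumes u: "cadlag u" "cadlag u'" "u 0 \<le> 0" "u' 0 \<le> 0" "u 0 = u' 0" and p: "1 \<le> p" and T: "0 \<le> T"
    and w: "fv p (\<lambda>t. u t - u' t) 0 T"
  shows "fv p (\<lambda>t. smax u t - smax u' t) 0 T"
    and "pv p (\<lambda>t. smax u t - smax u' t) 0 T \<le> pv p (\<lambda>t. u t - u' t) 0 T"
proof -
  let ?B = "pv p (\<lambda>t. u t - u' t) 0 T"
  have main: "pvar_sum p (\<lambda>t. smax u t - smax u' t) P \<le> ?B" if P: "is_partition 0 T P" for P
  proof -
    have disc: "pvar_sum p (\<lambda>t. fmax F u t - fmax F u' t) P \<le> ?B" if F: "finite F" "F \<subseteq> {0..}" for F
    proof (rule zigzag_variation[OF w _ p _ _ P])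
      have "{s \<in> F. s \<le> 0} \<subseteq> {0}" using F by auto
      then have "fmax F v 0 = 0" if "v 0 \<le> 0" for v
        using that F(1) unfolding fmax_def by (intro Max_eqI) auto
      then show "fmax F u 0 - fmax F u' 0 = 0" using u by simp
      fix \<sigma> t t' :: real
      assume h: "\<sigma> = 1 \<or> \<sigma> = -1" "t < t'" "\<sigma> * (fmax F u t - fmax F u' t) < \<sigma> * (fmax F u t' - fmax F u' t')"
      show "\<exists>s. t < s \<and> s \<le> t' \<and> \<sigma> * (fmax F u t' - fmax F u' t') \<le> \<sigma> * (u s - u' s)"
        using h fmax_jump[OF F(1) h(2), of u u'] fmax_jump[OF F(1) h(2), of u' u] by (auto simp: algebra_simps)
    qed (use u in auto)
    have approx: "\<exists>F. finite F \<and> F \<subseteq> {0..} \<and> (\<forall>t\<in>set P. \<bar>fmax F u t - smax u t\<bar> \<le> e \<and> \<bar>fmax F u' t - smax u' t\<bar> \<le> e)"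
      if e: "0 < e" for e
    proof -
      have ex: "\<exists>s. 0 \<le> s \<and> s \<le> max 0 t \<and> smax v t - e \<le> max 0 (v s)" if v: "cadlag v" for v t
      proof (cases "0 \<le> smax v t - e")
        case True
        have "smax v t - e < smax v t" using e by simp
        then obtain s where "0 \<le> s" "s \<le> max 0 t" "smax v t - e < v s" using smax_less[OF v True] by blast
        then show ?thesis by (intro exI[of _ s]) linarith
      next
        case False
        then show ?thesis by (intro exI[of _ 0]) auto
      qed
      obtain m where m: "\<And>t. 0 \<le> m t \<and> m t \<le> max 0 t \<and> smax u t - e \<le> max 0 (u (m t))" using ex[OF u(1)] by metis
      obtain m' where m': "\<And>t. 0 \<le> m' t \<and> m' t \<le> max 0 t \<and> smax u' t - e \<le> max 0 (u' (m' t))" using ex[OF u(2)] by metis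
      \<comment> \<open>Near-maximising times of both functions are collected in one set, because
        \<open>fmax_jump\<close> compares maxima over the same times.\<close>
      define F where "F = m ` set P \<union> m' ` set P"
      have "0 \<le> m t" "0 \<le> m' t" for t using m m' by blast+
      then have F: "finite F" "F \<subseteq> {0..}" by (auto simp: F_def)
      have ub: "fmax F v t \<le> smax v t" if "cadlag v" for v t
        using F smax_upper[OF that] smax_nonneg[OF that] unfolding fmax_def by (subst Max_le_iff) auto
      have "\<bar>fmax F u t - smax u t\<bar> \<le> e \<and> \<bar>fmax F u' t - smax u' t\<bar> \<le> e" if t: "t \<in> set P" for t
      proof -
        have t0: "max 0 t = t" using t is_partition_set[OF P] by auto
        have "max 0 (u (m t)) \<le> fmax F u t"
          using fmax_upper[OF F(1), of "m t" t u] fmax_nonneg[OF F(1)] m[of t] t t0 by (auto simp: F_def)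
        moreover have "max 0 (u' (m' t)) \<le> fmax F u' t"
          using fmax_upper[OF F(1), of "m' t" t u'] fmax_nonneg[OF F(1)] m'[of t] t t0 by (auto simp: F_def)
        ultimately show ?thesis using m[of t] m'[of t] ub[OF u(1), of t] ub[OF u(2), of t] by linarith
      qed
      then show ?thesis using F by blast
    qed
    have "\<forall>n. \<exists>F. finite F \<and> F \<subseteq> {0..} \<and> (\<forall>t\<in>set P. \<bar>fmax F u t - smax u t\<bar> \<le> 1 / Suc n \<and> \<bar>fmax F u' t - smax u' t\<bar> \<le> 1 / Suc n)"
      using approx by simp
    then obtain F where F: "\<And>n. finite (F n)" "\<And>n. F n \<subseteq> {0..}"
      "\<And>n t. t \<in> set P \<Longrightarrow> \<bar>fmax (F n) u t - smax u t\<bar> \<le> 1 / Suc n"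
      "\<And>n t. t \<in> set P \<Longrightarrow> \<bar>fmax (F n) u' t - smax u' t\<bar> \<le> 1 / Suc n" by metis
    have z: "(\<lambda>n. 1 / Suc n) \<longlonglongrightarrow> 0" by (rule LIMSEQ_inverse_real_of_nat[unfolded inverse_eq_divide])
    have lim: "(\<lambda>n. fmax (F n) u t) \<longlonglongrightarrow> smax u t" "(\<lambda>n. fmax (F n) u' t) \<longlonglongrightarrow> smax u' t" if "t \<in> set P" for t
      by (rule LIM_zero_cancel, rule Lim_null_comparison[OF _ z], use F that in \<open>auto intro: always_eventually\<close>)+
    have "(\<lambda>n. pvar_sum p (\<lambda>t. fmax (F n) u t - fmax (F n) u' t) P) \<longlonglongrightarrow> pvar_sum p (\<lambda>t. smax u t - smax u' t) P"
      unfolding pvar_sum_def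
      by (intro tendsto_sum tendsto_powr' tendsto_norm tendsto_diff lim tendsto_const) (use p in auto)
    then show ?thesis by (rule LIMSEQ_le_const2) (use disc[OF F(1,2)] in auto)
  qed
  show "fv p (\<lambda>t. smax u t - smax u' t) 0 T" "pv p (\<lambda>t. smax u t - smax u' t) 0 T \<le> ?B"
    using main T by (auto intro: fvI pv_le)
qed

text \<open>The integrand is positive only on \<open>N\<close>, where \<open>u\<close> lies below
  its running maximum. By right continuity this maximum stays constant from such a point up to some
  rational \<open>r\<close>, so countably many sets \<open>Mr r\<close> cover \<open>N\<close>. Each
  lies in an interval on which \<open>?F\<close> is constant, apart from its left endpoint, which
  needs an argument about atoms.\<close>

lemma smax_sp:
  assumes u: "cadlag u" "u 0 \<le> 0"
  shows "(\<integral>\<^sup>+ s \<in> {0..t}. ennreal (smax u s - u s) \<partial>interval_measure (smax u)) = 0"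
proof -
  let ?F = "smax u" and ?M = "interval_measure (smax u)"
  have mono: "?F x \<le> ?F y" if "x \<le> y" for x y using smax_mono[OF u(1) that] .
  have rc: "continuous (at_right x) ?F" for x using smax_right[OF u(1)] by (simp add: continuous_within)
  have Ioc: "emeasure ?M {x<..y} = ennreal (?F y - ?F x)" if "x \<le> y" for x y
    using emeasure_interval_measure_Ioc[OF that mono rc] .
  define N where "N = {s. 0 \<le> s \<and> u s < ?F s}"
  \<comment> \<open>No atom at \<open>s\<close>: as \<open>u s\<close> is below the supremum, the
    supremum is nearly reached strictly before \<open>s\<close>, so \<open>?F\<close> does not jump
    there.\<close>
  have single: "emeasure ?M {s} = 0" if s: "s \<in> N" for s
  proof -
    have le: "emeasure ?M {s} \<le> ennreal e" if e: "0 < e" for e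
    proof -
      have "\<exists>b<s. ?F s - ?F b \<le> e"
      proof (cases "?F s = 0")
        case True
        then show ?thesis using smax_nonneg[OF u(1), of "s - 1"] e by (intro exI[of _ "s - 1"]) auto
      next
        case False
        then have pos: "0 < ?F s" using smax_nonneg[OF u(1), of s] by auto
        define c where "c = max (max 0 (u s)) (?F s - e)"
        have c: "0 \<le> c" "c < ?F s" "u s \<le> c" "?F s - e \<le> c" using pos s e by (auto simp: c_def N_def)
        obtain r where r: "0 \<le> r" "r \<le> max 0 s" "c < u r" using smax_less[OF u(1) c(1,2)] by blast
        then have "r < s" using c s by (cases "r = s") (auto simp: N_def)
        moreover have "u r \<le> ?F r" using smax_upper[OF u(1) r(1)] by auto
        ultimately show ?thesis using r c by (intro exI[of _ r]) auto
      qed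
      then obtain b where b: "b < s" "?F s - ?F b \<le> e" by blast
      have "emeasure ?M {s} \<le> emeasure ?M {b<..s}" using b by (intro emeasure_mono) auto
      also have "\<dots> \<le> ennreal e" using b Ioc[of b s] by (simp add: ennreal_leI)
      finally show ?thesis .
    qed
    have "emeasure ?M {s} \<le> 0"
      by (rule ennreal_le_epsilon) (simp only: add_0_left le)
    then show ?thesis by simp
  qed
  define Mr where "Mr r = {s \<in> N. s < r \<and> ?F s = ?F r}" for r
  have null: "\<exists>A\<in>null_sets ?M. Mr r \<subseteq> A" for r
  proof (cases "Mr r = {}")
    case False
    \<comment> \<open>By right continuity \<open>?F\<close> already equals \<open>?F r\<close> at
      \<open>\<sigma>\<close>. The point \<open>\<sigma>\<close> is added to the cover only if it
      lies in \<open>N\<close>, since otherwise it may carry an atom.\<close>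
    define \<sigma> where "\<sigma> = Inf (Mr r)"
    have bb: "bdd_below (Mr r)" by (rule bdd_belowI[of _ 0]) (auto simp: Mr_def N_def)
    have \<sigma>r: "\<sigma> < r" using False cInf_lower[OF _ bb] unfolding \<sigma>_def Mr_def by force
    have "eventually (\<lambda>s. ?F s = ?F r) (at_right \<sigma>)"
      using eventually_at_right_real[OF \<sigma>r]
    proof eventually_elim
      case (elim s)
      then obtain s' where "s' \<in> Mr r" "s' < s" using cInf_lessD[OF False] unfolding \<sigma>_def by force
      then show ?case using mono[of s' s] mono[of s r] elim by (auto simp: Mr_def)
    qed
    then have "(?F \<longlongrightarrow> ?F r) (at_right \<sigma>)" by (rule tendsto_eventually)
    then have "?F \<sigma> = ?F r" using smax_right[OF u(1), of \<sigma>] tendsto_unique[OF trivial_limit_at_right_real] by blast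
    then have "{\<sigma><..r} \<in> null_sets ?M" using Ioc[of \<sigma> r] \<sigma>r by (simp add: null_sets_def)
    moreover have "(if \<sigma> \<in> N then {\<sigma>} else {}) \<in> null_sets ?M" using single by (simp add: null_sets_def)
    moreover have "Mr r \<subseteq> {\<sigma><..r} \<union> (if \<sigma> \<in> N then {\<sigma>} else {})"
    proof
      fix s assume s: "s \<in> Mr r"
      then have "\<sigma> \<le> s" using cInf_lower[OF _ bb] unfolding \<sigma>_def by auto
      then show "s \<in> {\<sigma><..r} \<union> (if \<sigma> \<in> N then {\<sigma>} else {})" using s by (cases "s = \<sigma>") (auto simp: Mr_def)
    qed
    ultimately show ?thesis by (intro bexI[of _ "{\<sigma><..r} \<union> (if \<sigma> \<in> N then {\<sigma>} else {})"] null_sets.Un)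
  qed auto
  then obtain A where A: "\<And>r. A r \<in> null_sets ?M" "\<And>r. Mr r \<subseteq> A r" by metis
  have cover: "N \<subseteq> (\<Union>r\<in>\<rat>. A r)"
  proof
    fix s assume s: "s \<in> N"
    then have ev: "eventually (\<lambda>r. u r < ?F s) (at_right s)"
      using order_tendstoD(2)[OF cadlag_right[OF u(1), of s]] by (simp add: N_def)
    then obtain d where d: "d > s" "\<And>r. s < r \<Longrightarrow> r < d \<Longrightarrow> u r < ?F s"
      using eventually_at_rightE[OF ev] by metis
    obtain r where r: "r \<in> \<rat>" "s < r" "r < d" using Rats_dense_in_real[OF d(1)] by blast
    have "?F r \<le> ?F s"
    proof (rule smax_split[OF u(1), of s])
      show "u q \<le> ?F s" if "s < q" "q \<le> r" for q using d(2)[of q] that r by simp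
    qed (use s in \<open>auto simp: N_def\<close>)
    then have "s \<in> Mr r" using mono[of s r] r s by (auto simp: Mr_def)
    then show "s \<in> (\<Union>r\<in>\<rat>. A r)" using A(2) r by auto
  qed
  have "(\<Union>r\<in>\<rat>. A r) \<in> null_sets ?M" by (intro null_sets_UN' countable_rat A)
  then have "AE s in ?M. ennreal (?F s - u s) * indicator {0..t} s = 0"
    by (rule AE_I') (use cover in \<open>auto simp: N_def indicator_def ennreal_eq_0_iff\<close>)
  then have "(\<integral>\<^sup>+ s \<in> {0..t}. ennreal (?F s - u s) \<partial>?M) = (\<integral>\<^sup>+ s. 0 \<partial>?M)"
    by (rule nn_integral_cong_AE)
  then show ?thesis by simp
qed

text \<open>A nondecreasing \<open>k\<close> above \<open>u\<close> with \<open>k 0 = 0\<close>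
  dominates the running maximum. Were it larger, so that \<open>m = smax u t < k t\<close>, it would
  have to charge the set \<open>E\<close> where it exceeds \<open>m\<close>; but there
  \<open>k - u > 0\<close>, which the integral condition forbids.\<close>

lemma smax_sp_unique:
  assumes u: "cadlag u" and k0: "k 0 = 0" and mono: "\<And>s t. 0 \<le> s \<Longrightarrow> s \<le> t \<Longrightarrow> k s \<le> (k t :: real)"
    and rc: "\<And>t. 0 \<le> t \<Longrightarrow> (k \<longlongrightarrow> k t) (at_right t)" and ge: "\<And>t. 0 \<le> t \<Longrightarrow> u t \<le> k t"
    and int: "\<And>t. 0 \<le> t \<Longrightarrow> (\<integral>\<^sup>+ s \<in> {0..t}. ennreal (k s - u s) \<partial>interval_measure (\<lambda>s. k (max 0 s))) = 0"
    and t: "0 \<le> t"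
  shows "k t = smax u t"
proof (rule antisym)
  show "smax u t \<le> k t"
  proof (rule smax_least)
    show "0 \<le> k t" using mono[of 0 t] k0 t by simp
    show "u s \<le> k t" if "0 \<le> s" "s \<le> max 0 t" for s using ge[of s] mono[of s t] that t by simp
  qed
  show "k t \<le> smax u t"
  proof (rule ccontr)
    assume "\<not> k t \<le> smax u t"
    define m where "m = smax u t"
    have km: "m < k t" using \<open>\<not> k t \<le> smax u t\<close> by (simp add: m_def)
    have m0: "0 \<le> m" using smax_nonneg[OF u] by (simp add: m_def)
    define F where "F s = k (max 0 s)" for s
    let ?M = "interval_measure F"
    have Fmono: "F x \<le> F y" if "x \<le> y" for x y using mono[of "max 0 x" "max 0 y"] that by (auto simp: F_def)
    have Frc: "continuous (at_right x) F" for x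
    proof (cases "x < 0")
      case True
      then have "eventually (\<lambda>s. F s = F x) (at_right x)"
        using eventually_at_right_real[OF True] by (auto elim!: eventually_mono simp: F_def max_def)
      then show ?thesis unfolding continuous_within by (rule tendsto_eventually)
    next
      case False
      then have "(k \<longlongrightarrow> F x) (at_right x)" using rc[of x] by (simp add: F_def max_def)
      moreover have "eventually (\<lambda>s. k s = F s) (at_right x)"
        using eventually_at_right_less[of x] False by (auto elim!: eventually_mono simp: F_def max_def)
      ultimately show ?thesis unfolding continuous_within by (rule Lim_transform_eventually)
    qed
    have Ioc: "emeasure ?M {x<..y} = ennreal (F y - F x)" if "x \<le> y" for x y
      using emeasure_interval_measure_Ioc[OF that Fmono Frc] .
    have Fmeas: "F \<in> borel_measurable ?M"
      using borel_measurable_mono[of F] Fmono by (simp add: mono_def measurable_def)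
    have "(\<integral>\<^sup>+ s. ennreal (F s - m) * indicator {0..t} s \<partial>?M) \<le> (\<integral>\<^sup>+ s \<in> {0..t}. ennreal (k s - u s) \<partial>?M)"
    proof (rule nn_integral_mono)
      fix s
      show "ennreal (F s - m) * indicator {0..t} s \<le> ennreal (k s - u s) * indicator {0..t} s"
        using smax_upper[OF u, of s t] by (auto simp: indicator_def F_def m_def intro!: ennreal_leI)
    qed
    then have "(\<integral>\<^sup>+ s. ennreal (F s - m) * indicator {0..t} s \<partial>?M) = 0" using int[OF t] by (simp add: F_def[abs_def])
    then have ae: "AE s in ?M. ennreal (F s - m) * indicator {0..t} s = 0"
      using Fmeas by (subst (asm) nn_integral_0_iff_AE) auto
    define E where "E = {s \<in> {0..t}. m < F s}"
    have Em: "E \<in> sets ?M"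
    proof -
      have "F -` {m<..} \<inter> space ?M \<in> sets ?M" by (rule measurable_sets[OF Fmeas]) simp
      then have "{0..t} \<inter> F -` {m<..} \<in> sets ?M" by (simp add: sets.Int)
      moreover have "E = {0..t} \<inter> F -` {m<..}" by (auto simp: E_def)
      ultimately show ?thesis by simp
    qed
    have E: "emeasure ?M E = 0"
    proof -
      have "AE s in ?M. s \<notin> E" using ae by eventually_elim (auto simp: E_def ennreal_eq_0_iff)
      then show ?thesis using Em by (subst (asm) AE_iff_measurable[of E]) (auto simp: )
    qed
    have pos: "\<not> ennreal (k t - m) \<le> 0" using km by simp
    define G where "G = {s. s \<le> t \<and> F s \<le> m}"
    have G: "0 \<in> G" "bdd_above G" using t k0 m0 by (auto simp: G_def F_def intro: bdd_aboveI)
    define \<sigma> where "\<sigma> = Sup G"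
    have \<sigma>: "0 \<le> \<sigma>" "\<sigma> \<le> t" using G unfolding \<sigma>_def by (auto intro: cSup_upper cSup_least simp: G_def)
    have above: "m < F s" if "\<sigma> < s" "s \<le> t" for s
      using cSup_upper[OF _ G(2), of s] that unfolding \<sigma>_def G_def by force
    show False
    proof (cases "F \<sigma> \<le> m")
      case True
      have "{\<sigma><..t} \<subseteq> E" using above \<sigma> by (auto simp: E_def)
      then have "ennreal (F t - F \<sigma>) \<le> 0" using Em emeasure_mono[of "{\<sigma><..t}" E ?M] Ioc[OF \<sigma>(2)] E by simp
      then show False using km True t by (simp add: F_def)
    next
      \<comment> \<open>\<open>k\<close> jumps across the level \<open>m\<close> at
        \<open>\<sigma>\<close>, so the atom there has to be counted: the closed interval is
        approximated by half-open ones that start to the left of \<open>\<sigma>\<close>, where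
        \<open>F \<le> m\<close>.\<close>
      case False
      have below: "F s \<le> m" if s: "s < \<sigma>" for s
      proof -
        have "G \<noteq> {}" using G by auto
        then obtain r where "r \<in> G" "s < r" using less_cSupE[of s G] s unfolding \<sigma>_def by blast
        then show ?thesis using Fmono[of s r] by (auto simp: G_def)
      qed
      have sub: "{\<sigma>..t} \<subseteq> E" using above \<sigma> False by (auto simp: E_def less_eq_real_def)
      have z: "emeasure ?M {\<sigma>..t} = 0" using emeasure_mono[OF sub Em] E by simp
      have le_t: "\<sigma> - 1 / real (Suc n) \<le> t" for n
      proof -
        have "0 \<le> 1 / real (Suc n)" by simp
        then show ?thesis using \<sigma>(2) by linarith
      qed
      define X where "X n = {\<sigma> - 1 / Suc n<..t}" for n :: nat
      have "(\<lambda>n. emeasure ?M (X n)) \<longlonglongrightarrow> emeasure ?M (\<Inter>n. X n)"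
      proof (rule Lim_emeasure_decseq)
        show "decseq X" unfolding decseq_def
        proof (intro allI impI)
          fix i j :: nat assume "i \<le> j"
          then have "1 / real (Suc j) \<le> 1 / real (Suc i)" by (intro frac_le) auto
          then show "X j \<subseteq> X i" unfolding X_def subset_iff greaterThanAtMost_iff by linarith
        qed
        show "emeasure ?M (X i) \<noteq> \<infinity>" for i unfolding X_def Ioc[OF le_t] by simp
      qed (auto simp: X_def)
      moreover have "(\<Inter>n. X n) = {\<sigma>..t}"
      proof (intro equalityI subsetI)
        fix s assume s: "s \<in> (\<Inter>n. X n)"
        have "\<sigma> \<le> s"
        proof (rule ccontr)
          assume "\<not> \<sigma> \<le> s"
          then obtain n where "1 / Suc n < \<sigma> - s" using nat_approx_posE[of "\<sigma> - s"] by auto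
          moreover have "\<sigma> - 1 / Suc n < s" using s by (auto simp: X_def)
          ultimately show False by linarith
        qed
        then show "s \<in> {\<sigma>..t}" using s by (auto simp: X_def)
      next
        fix s assume "s \<in> {\<sigma>..t}"
        moreover have "0 < 1 / real (Suc n)" for n by simp
        ultimately have "\<sigma> - 1 / real (Suc n) < s" for n
          by (metis atLeastAtMost_iff diff_gt_0_iff_gt diff_less_eq less_add_same_cancel1 order.strict_trans1 add.commute)
        then show "s \<in> (\<Inter>n. X n)" using \<open>s \<in> {\<sigma>..t}\<close> by (simp add: X_def)
      qed
      ultimately have lim: "(\<lambda>n. emeasure ?M (X n)) \<longlonglongrightarrow> 0" using z by simp
      have "ennreal (k t - m) \<le> emeasure ?M (X n)" for n
      proof -
        have "k t - m \<le> F t - F (\<sigma> - 1 / Suc n)" using below[of "\<sigma> - 1 / Suc n"] t by (simp add: F_def)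
        then show ?thesis unfolding X_def Ioc[OF le_t] by (rule ennreal_leI)
      qed
      then have "ennreal (k t - m) \<le> 0" by (intro LIMSEQ_le_const[OF lim]) auto
      then show False using pos by simp
    qed
  qed
qed

section \<open>Vector-valued Skorokhod problem and coefficient estimates\<close>

definition kmap :: "(real \<Rightarrow> real^'d) \<Rightarrow> real \<Rightarrow> real^'d" where
  "kmap u t = (\<chi> i. smax (\<lambda>s. u s $ i) t)"

lemma kmap_component [simp]: "kmap u t $ i = smax (\<lambda>s. u s $ i) t"
  by (simp add: kmap_def)

lemma cadlag_component:
  fixes u :: "real \<Rightarrow> real^'d"
  shows "cadlag u \<Longrightarrow> cadlag (\<lambda>t. u t $ i)"
  by (rule cadlag_compose[of "\<lambda>v. v $ i"]) (auto intro: continuous_intros)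

lemma cadlag_vec:
  fixes u :: "real \<Rightarrow> real^'d"
  assumes "\<And>i. cadlag (\<lambda>t. u t $ i)"
  shows "cadlag u"
proof (rule cadlagI)
  show "(u \<longlongrightarrow> u t) (at_right t)" if "0 \<le> t" for t
    by (rule vec_tendstoI) (rule cadlag_right[OF assms that])
  show "\<exists>L. (u \<longlongrightarrow> L) (at_left t)" if "0 < t" for t
  proof (intro exI vec_tendstoI)
    fix i show "((\<lambda>s. u s $ i) \<longlongrightarrow> (\<chi> i. left_lim (\<lambda>s. u s $ i) t) $ i) (at_left t)"
      using tendsto_left_lim[OF assms that] by simp
  qed
qed

lemma cadlag_kmap: "cadlag u \<Longrightarrow> cadlag (kmap u)"
  by (intro cadlag_vec) (simp add: cadlag_smax cadlag_component)

lemma kmap_0: "(\<And>i. u 0 $ i \<le> 0) \<Longrightarrow> t \<le> 0 \<Longrightarrow> kmap u t = 0"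
  by (simp add: vec_eq_iff smax_0)

lemma kmap_cong: "(\<And>s. 0 \<le> s \<Longrightarrow> s \<le> t \<Longrightarrow> u s = u' s) \<Longrightarrow> 0 \<le> t \<Longrightarrow> kmap u t = kmap u' t"
  unfolding kmap_def by (metis (mono_tags, lifting) smax_cong)

lemma fv_pv_component:
  fixes x :: "real \<Rightarrow> real^'d"
  assumes "fv p x s t" "s \<le> t" "0 \<le> p"
  shows "fv p (\<lambda>r. x r $ i) s t" "pv p (\<lambda>r. x r $ i) s t \<le> pv p x s t"
proof -
  have inc: "norm (x v $ i - x u $ i) powr p \<le> pv p x u v" if "s \<le> u" "u < v" "v \<le> t" for u v
  proof -
    have "norm (x v $ i - x u $ i) \<le> norm (x v - x u)"
      using component_le_norm_cart[of "x v - x u" i] by simp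
    then have "norm (x v $ i - x u $ i) powr p \<le> norm (x v - x u) powr p" using assms by (intro powr_mono2) auto
    also have "\<dots> \<le> pv p x u v" using incr_le_pv[OF assms(1)] that by simp
    finally show ?thesis .
  qed
  show "fv p (\<lambda>r. x r $ i) s t" "pv p (\<lambda>r. x r $ i) s t \<le> pv p x s t"
    using pv_control[OF super_on_pv[OF assms(1)] inc] assms by auto
qed

lemma norm_powr_le_sum:
  fixes v :: "real^'d"
  assumes "0 \<le> p"
  shows "norm v powr p \<le> real CARD('d) powr p * (\<Sum>i\<in>UNIV. \<bar>v $ i\<bar> powr p)"
proof -
  have "Max (range (\<lambda>i. \<bar>v $ i\<bar>)) \<in> range (\<lambda>i. \<bar>v $ i\<bar>)" by (intro Max_in) auto
  then obtain j where j: "Max (range (\<lambda>i. \<bar>v $ i\<bar>)) = \<bar>v $ j\<bar>" by blast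
  have mx: "\<bar>v $ i\<bar> \<le> \<bar>v $ j\<bar>" for i unfolding j[symmetric] by (intro Max_ge) auto
  have "norm v \<le> (\<Sum>i\<in>UNIV. \<bar>v $ i\<bar>)" by (rule norm_le_l1_cart)
  also have "\<dots> \<le> real CARD('d) * \<bar>v $ j\<bar>" using mx by (intro sum_bounded_above) auto
  finally have "norm v powr p \<le> (real CARD('d) * \<bar>v $ j\<bar>) powr p" using assms by (intro powr_mono2) auto
  also have "\<dots> = real CARD('d) powr p * \<bar>v $ j\<bar> powr p" by (simp add: powr_mult)
  also have "\<dots> \<le> real CARD('d) powr p * (\<Sum>i\<in>UNIV. \<bar>v $ i\<bar> powr p)"
    by (intro mult_left_mono member_le_sum) auto
  finally show ?thesis .
qed

lemma super_on_sum: "(\<And>i. i \<in> I \<Longrightarrow> super_on s t (w i)) \<Longrightarrow> super_on s t (\<lambda>u v. \<Sum>i\<in>I. w i u v)"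
  unfolding super_on_def by (auto simp: sum.distrib[symmetric] intro!: sum_nonneg sum_mono)

text \<open>The dimension enters twice: through comparing the norm with the largest component, and
  through summing over the components.\<close>

lemma fv_pv_vec:
  fixes x :: "real \<Rightarrow> real^'d"
  assumes "\<And>i. fv p (\<lambda>r. x r $ i) s t" "\<And>i. pv p (\<lambda>r. x r $ i) s t \<le> B" "s \<le> t" "0 \<le> p"
  shows "fv p x s t" "pv p x s t \<le> real CARD('d) powr p * (real CARD('d) * B)"
proof -
  let ?w = "\<lambda>u v. real CARD('d) powr p * (\<Sum>i\<in>UNIV. pv p (\<lambda>r. x r $ i) u v)"
  have sup: "super_on s t ?w" by (intro super_on_cmult super_on_sum super_on_pv assms) auto
  have inc: "norm (x v - x u) powr p \<le> ?w u v" if "s \<le> u" "u < v" "v \<le> t" for u v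
  proof -
    have "norm (x v - x u) powr p \<le> real CARD('d) powr p * (\<Sum>i\<in>UNIV. \<bar>(x v - x u) $ i\<bar> powr p)"
      by (rule norm_powr_le_sum[OF assms(4)])
    also have "\<dots> \<le> ?w u v"
      using incr_le_pv[OF assms(1)] that by (intro mult_left_mono sum_mono) auto
    finally show ?thesis .
  qed
  show "fv p x s t" using pv_control(1)[OF sup inc] .
  have "pv p x s t \<le> ?w s t" using pv_control(2)[OF sup inc] assms by auto
  also have "\<dots> \<le> real CARD('d) powr p * (real CARD('d) * B)"
    using assms(2) by (intro mult_left_mono sum_bounded_above) auto
  finally show "pv p x s t \<le> real CARD('d) powr p * (real CARD('d) * B)" .
qed

text \<open>For \<open>u = l - Y x\<close> and \<open>u' = l - Y x'\<close> the barrier cancels in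
  \<open>u - u'\<close>, so that only the integrals have to be compared.\<close>

lemma kmap_variation:
  fixes u u' :: "real \<Rightarrow> real^'d"
  assumes u: "cadlag u" "cadlag u'" "\<And>i. u 0 $ i \<le> 0" "u 0 = u' 0" and p: "1 \<le> p" and T: "0 \<le> T"
    and w: "fv p (\<lambda>t. u t - u' t) 0 T"
  shows "fv p (\<lambda>t. kmap u t - kmap u' t) 0 T"
    and "pv p (\<lambda>t. kmap u t - kmap u' t) 0 T \<le> real CARD('d) powr p * (real CARD('d) * pv p (\<lambda>t. u t - u' t) 0 T)"
proof -
  have c: "fv p (\<lambda>t. u t $ i - u' t $ i) 0 T" "pv p (\<lambda>t. u t $ i - u' t $ i) 0 T \<le> pv p (\<lambda>t. u t - u' t) 0 T" for i
    using fv_pv_component[OF w T, of i] p by auto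
  have "fv p (\<lambda>t. (kmap u t - kmap u' t) $ i) 0 T" "pv p (\<lambda>t. (kmap u t - kmap u' t) $ i) 0 T \<le> pv p (\<lambda>t. u t - u' t) 0 T" for i
    using smax_variation[OF cadlag_component[OF u(1)] cadlag_component[OF u(2)] _ _ _ p T c(1)] c(2)[of i] u(3)[of i] u(4)
    by (force intro: order_trans)+
  then show "fv p (\<lambda>t. kmap u t - kmap u' t) 0 T"
    "pv p (\<lambda>t. kmap u t - kmap u' t) 0 T \<le> real CARD('d) powr p * (real CARD('d) * pv p (\<lambda>t. u t - u' t) 0 T)"
    using fv_pv_vec[of p "\<lambda>t. kmap u t - kmap u' t" 0 T] T p by auto
qed

text \<open>Each component is nondecreasing, so its p-variation is at most the p-th power of its
  total growth, and this growth is at most the oscillation \<open>c\<close> of \<open>u\<close>. No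
  variation of \<open>u\<close> is involved, which is what admits a barrier that is merely
  cadlag.\<close>

lemma kmap_osc:
  fixes u :: "real \<Rightarrow> real^'d"
  assumes u: "cadlag u" and st: "0 \<le> s" "s \<le> t" and p: "1 \<le> p" and c: "\<And>r. s \<le> r \<Longrightarrow> r \<le> t \<Longrightarrow> norm (u r - u s) \<le> c"
  shows "fv p (kmap u) s t" "pv p (kmap u) s t \<le> real CARD('d) powr p * (real CARD('d) * c powr p)"
proof -
  have c0: "0 \<le> c" using c[of s] st by simp
  have "fv p (\<lambda>r. kmap u r $ i) s t \<and> pv p (\<lambda>r. kmap u r $ i) s t \<le> c powr p" for i
  proof -
    let ?k = "smax (\<lambda>s. u s $ i)"
    note cu = cadlag_component[OF u, of i]
    have "?k t \<le> ?k s + c"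
    proof (rule smax_split[OF cu st(1)])
      fix r assume r: "s < r" "r \<le> t"
      have "u r $ i - u s $ i \<le> c" using c[of r] component_le_norm_cart[of "u r - u s" i] r by auto
      then show "u r $ i \<le> ?k s + c" using smax_upper[OF cu st(1) order_refl] by linarith
    qed (use c0 in simp)
    then have "(?k t - ?k s) powr p \<le> c powr p" using smax_mono[OF cu st(2)] p by (intro powr_mono2) auto
    moreover have "fv p ?k s t" "pv p ?k s t \<le> (?k t - ?k s) powr p"
      using fv_pv_mono_fun[of s t ?k p] smax_mono[OF cu] p st by auto
    ultimately show ?thesis by simp
  qed
  then show "fv p (kmap u) s t" "pv p (kmap u) s t \<le> real CARD('d) powr p * (real CARD('d) * c powr p)"
    using fv_pv_vec[of p "kmap u" s t "c powr p"] st p by auto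
qed

lemma skorokhod_kmap:
  fixes y l :: "real \<Rightarrow> real^'d"
  assumes "cadlag y" "cadlag l" "\<And>i. l 0 $ i \<le> y 0 $ i"
  shows "skorokhod l y (\<lambda>t. y t + kmap (\<lambda>s. l s - y s) t) (kmap (\<lambda>s. l s - y s))"
proof -
  define u where "u s = l s - y s" for s
  have u: "cadlag u" unfolding u_def using cadlag_diff assms by blast
  have cu: "cadlag (\<lambda>s. u s $ i)" for i using cadlag_component[OF u] .
  have u0: "u 0 $ i \<le> 0" for i using assms(3) by (simp add: u_def)
  \<comment> \<open>The convention for negative times in \<open>smax\<close> makes it coincide with
    the integrator in \<open>skorokhod\<close>.\<close>
  have eq: "kmap u (max 0 s) $ i = smax (\<lambda>s. u s $ i) s" for s i by (simp add: smax_def)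
  have z: "(\<integral>\<^sup>+ s \<in> {0..t}. ennreal ((y s + kmap u s) $ i - l s $ i) \<partial>interval_measure (\<lambda>s. kmap u (max 0 s) $ i)) = 0" for i t
  proof -
    have "(y s + kmap u s) $ i - l s $ i = smax (\<lambda>s. u s $ i) s - u s $ i" for s by (simp add: u_def)
    then show ?thesis unfolding eq by (simp only: smax_sp[OF cu u0])
  qed
  have up: "l t $ i \<le> (y t + kmap u t) $ i" if "0 \<le> t" for t i
    using smax_upper[OF cu that order_refl, of i] by (simp add: u_def)
  have "skorokhod l y (\<lambda>t. y t + kmap u t) (kmap u)"
    unfolding skorokhod_def using z up kmap_0[of u 0] u0 smax_mono[OF cu] by auto
  then show ?thesis by (simp add: u_def[abs_def])
qed

lemma skorokhod_unique:
  fixes y l x k :: "real \<Rightarrow> real^'d"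
  assumes sk: "skorokhod l y x k" and c: "cadlag y" "cadlag l" "cadlag k" and t: "0 \<le> t"
  shows "k t = kmap (\<lambda>s. l s - y s) t"
proof -
  have "k t $ i = smax (\<lambda>s. (l s - y s) $ i) t" for i
  proof (rule smax_sp_unique[OF cadlag_component[OF cadlag_diff[OF c(2,1)]] _ _ _ _ _ t])
    show "k 0 $ i = 0" using sk by (simp add: skorokhod_def)
    show "k s $ i \<le> k t $ i" if "0 \<le> s" "s \<le> t" for s t using sk that by (auto simp: skorokhod_def)
    show "((\<lambda>s. k s $ i) \<longlongrightarrow> k t $ i) (at_right t)" if "0 \<le> t" for t
      using cadlag_right[OF cadlag_component[OF c(3)] that] .
    have x: "x s = y s + k s" "l s $ i \<le> x s $ i" if "0 \<le> s" for s using sk that by (auto simp: skorokhod_def)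
    show "(l t - y t) $ i \<le> k t $ i" if "0 \<le> t" for t using x[OF that] by simp
    show "(\<integral>\<^sup>+ s \<in> {0..t}. ennreal (k s $ i - (l s - y s) $ i) \<partial>interval_measure (\<lambda>s. k (max 0 s) $ i)) = 0" if "0 \<le> t" for t
    proof -
      have "(\<integral>\<^sup>+ s \<in> {0..t}. ennreal (k s $ i - (l s - y s) $ i) \<partial>interval_measure (\<lambda>s. k (max 0 s) $ i)) =
        (\<integral>\<^sup>+ s \<in> {0..t}. ennreal (x s $ i - l s $ i) \<partial>interval_measure (\<lambda>s. k (max 0 s) $ i))"
        by (intro nn_integral_cong) (auto simp: indicator_def x(1) algebra_simps)
      also have "\<dots> = 0" using sk that by (auto simp: skorokhod_def)
      finally show ?thesis .
    qed
  qed
  then show ?thesis by (simp add: vec_eq_iff)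
qed

section \<open>Regularity of the coefficients in terms of variation\<close>

lemma fv_pv_hoelder:
  assumes x: "fv p x s t" "s \<le> t" and \<alpha>: "0 < \<alpha>" "0 \<le> M" "0 < p"
    and X: "\<And>u v. s \<le> u \<Longrightarrow> u \<le> v \<Longrightarrow> v \<le> t \<Longrightarrow> norm (X v - X u) \<le> M * norm (x v - x u) powr \<alpha>"
  shows "fv (p / \<alpha>) X s t" "pv (p / \<alpha>) X s t \<le> M powr (p / \<alpha>) * pv p x s t"
proof -
  have sup: "super_on s t (\<lambda>u v. M powr (p / \<alpha>) * pv p x u v)"
    by (intro super_on_cmult super_on_pv x) simp
  have inc: "norm (X v - X u) powr (p / \<alpha>) \<le> M powr (p / \<alpha>) * pv p x u v" if "s \<le> u" "u < v" "v \<le> t" for u v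
  proof -
    have "norm (X v - X u) powr (p / \<alpha>) \<le> (M * norm (x v - x u) powr \<alpha>) powr (p / \<alpha>)"
      using X that \<alpha> by (intro powr_mono2) auto
    also have "\<dots> = M powr (p / \<alpha>) * norm (x v - x u) powr p" using \<alpha> by (simp add: powr_mult powr_powr)
    also have "\<dots> \<le> M powr (p / \<alpha>) * pv p x u v" using incr_le_pv[OF x(1)] that by (intro mult_left_mono) auto
    finally show ?thesis .
  qed
  show "fv (p / \<alpha>) X s t" "pv (p / \<alpha>) X s t \<le> M powr (p / \<alpha>) * pv p x s t"
    using pv_control[OF sup inc] x(2) by auto
qed

text \<open>\<open>norm\<close> on matrices is the Frobenius norm; Cauchy-Schwarz in each row gives
  the constant 1.\<close>

lemma bounded_bilinear_matrix_vector: "bounded_bilinear ((*v) :: real^'n^'m \<Rightarrow> real^'n \<Rightarrow> real^'m)"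
  and norm_matrix_vector_le: "norm ((A :: real^'n^'m) *v v) \<le> norm A * norm v * 1"
proof -
  have *: "norm (A *v v) \<le> norm A * norm v" for A :: "real^'n^'m" and v
  proof -
    have "norm (A *v v) = L2_set (\<lambda>i. \<bar>A $ i \<bullet> v\<bar>) UNIV"
      by (simp add: norm_vec_def matrix_mult_dot)
    also have "\<dots> \<le> L2_set (\<lambda>i. norm (A $ i) * norm v) UNIV"
      by (intro L2_set_mono) (auto simp: Cauchy_Schwarz_ineq2)
    also have "\<dots> = norm A * norm v"
      by (simp add: norm_vec_def[of A] L2_set_left_distrib)
    finally show ?thesis .
  qed
  then show "norm ((A :: real^'n^'m) *v v) \<le> norm A * norm v * 1" by simp
  show "bounded_bilinear ((*v) :: real^'n^'m \<Rightarrow> real^'n \<Rightarrow> real^'m)"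
  proof
    show "\<exists>K. \<forall>(a::real^'n^'m) b. norm (a *v b) \<le> norm a * norm b * K" using * by (intro exI[of _ 1]) simp
  qed (simp_all add: matrix_vector_mult_add_rdistrib matrix_vector_right_distrib scaleR_matrix_vector_assoc matrix_vector_mult_scaleR)
qed

lemma bounded_bilinear_scaleR_flip: "bounded_bilinear (\<lambda>(u::'a::real_normed_vector) v. v *\<^sub>R u)"
  by (rule bounded_bilinear.flip[OF bounded_bilinear_scaleR])

text \<open>The mean value theorem is applied once, to the difference of \<open>\<phi>\<close> along
  the segments from \<open>y'\<close> to \<open>y\<close> and from \<open>x'\<close> to
  \<open>x\<close> with a common parameter. At the intermediate parameter the derivative splits into
  a gradient times the second difference plus a difference of gradients times \<open>x - x'\<close>.
  The constant bounds the gradient on the ball, with \<open>C\<close> added so that one factor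
  serves both terms.\<close>

lemma gradient_second_difference:
  fixes \<phi> :: "'a::euclidean_space \<Rightarrow> real"
  assumes der: "\<And>x. (\<phi> has_derivative (\<lambda>h. D x \<bullet> h)) (at x)"
    and hold: "\<And>x y. norm x \<le> R \<Longrightarrow> norm y \<le> R \<Longrightarrow> norm (D x - D y) \<le> C * norm (x - y) powr \<gamma>"
    and C: "0 \<le> C" "0 < \<gamma>" and n: "norm x \<le> R" "norm x' \<le> R" "norm y \<le> R" "norm y' \<le> R"
  shows "\<bar>(\<phi> y - \<phi> y') - (\<phi> x - \<phi> x')\<bar> \<le> (norm (D 0) + C * R powr \<gamma> + C) *
     (norm ((y - y') - (x - x')) + (norm (y - x) + norm (y' - x')) powr \<gamma> * norm (x - x'))"
proof -
  have R: "0 \<le> R" using n(1) norm_ge_zero order_trans by blast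
  define b where "b r = y' + r *\<^sub>R (y - y')" for r :: real
  define a where "a r = x' + r *\<^sub>R (x - x')" for r :: real
  define \<psi> where "\<psi> r = \<phi> (b r) - \<phi> (a r)" for r
  define \<psi>' where "\<psi>' r = D (b r) \<bullet> (y - y') - D (a r) \<bullet> (x - x')" for r
  have line: "((\<lambda>r. \<phi> (w + r *\<^sub>R v)) has_real_derivative D (w + r *\<^sub>R v) \<bullet> v) (at r)" for w v r
  proof -
    have "((\<lambda>r. w + r *\<^sub>R v) has_derivative (\<lambda>h. h *\<^sub>R v)) (at r)"
      by (auto intro!: derivative_eq_intros)
    then have "((\<lambda>r. \<phi> (w + r *\<^sub>R v)) has_derivative (\<lambda>h. D (w + r *\<^sub>R v) \<bullet> (h *\<^sub>R v))) (at r)"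
      by (rule has_derivative_compose[OF _ der])
    then show ?thesis by (rule has_derivative_imp_has_field_derivative) simp
  qed
  have "DERIV \<psi> r :> \<psi>' r" for r
    unfolding \<psi>_def \<psi>'_def a_def b_def by (intro DERIV_diff line)
  then obtain r where r: "0 < r" "r < 1" "\<psi> 1 - \<psi> 0 = (1 - 0) * \<psi>' r"
    using MVT2[of 0 1 \<psi> \<psi>'] by auto
  have eq: "(\<phi> y - \<phi> y') - (\<phi> x - \<phi> x') = \<psi>' r"
    using r(3) by (simp add: \<psi>_def a_def b_def)
  have conv: "norm (w + r *\<^sub>R (v - w)) \<le> R" if "norm w \<le> R" "norm v \<le> R" for v w :: 'a
  proof -
    have "w + r *\<^sub>R (v - w) = (1 - r) *\<^sub>R w + r *\<^sub>R v" by (simp add: algebra_simps)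
    also have "norm \<dots> \<le> (1 - r) * norm w + r * norm v" using r by (intro norm_triangle_mono) auto
    also have "\<dots> \<le> (1 - r) * R + r * R" using r that by (intro add_mono mult_left_mono) auto
    finally show ?thesis by (simp add: algebra_simps)
  qed
  have nab: "norm (b r) \<le> R" "norm (a r) \<le> R" unfolding a_def b_def using conv n by auto
  have "b r - a r = (1 - r) *\<^sub>R (y' - x') + r *\<^sub>R (y - x)" by (simp add: a_def b_def algebra_simps)
  then have "norm (b r - a r) \<le> (1 - r) * norm (y' - x') + r * norm (y - x)"
    using r by (metis (no_types, lifting) norm_triangle_mono norm_scaleR abs_of_nonneg diff_ge_0_iff_ge less_imp_le order_refl)
  also have "\<dots> \<le> 1 * norm (y' - x') + 1 * norm (y - x)" using r by (intro add_mono mult_right_mono) auto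
  finally have ba: "norm (b r - a r) \<le> norm (y - x) + norm (y' - x')" by simp
  have "norm (D (b r) - D 0) \<le> C * norm (b r - 0) powr \<gamma>" using nab R by (intro hold) auto
  also have "\<dots> \<le> C * R powr \<gamma>" using nab C by (intro mult_left_mono powr_mono2) auto
  finally have Db: "norm (D (b r)) \<le> norm (D 0) + C * R powr \<gamma>" using norm_triangle_sub[of "D (b r)" "D 0"] by simp
  have "norm (D (b r) - D (a r)) \<le> C * norm (b r - a r) powr \<gamma>" using nab by (intro hold) auto
  also have "\<dots> \<le> C * (norm (y - x) + norm (y' - x')) powr \<gamma>" using ba C by (intro mult_left_mono powr_mono2) auto
  finally have Dba: "norm (D (b r) - D (a r)) \<le> C * (norm (y - x) + norm (y' - x')) powr \<gamma>" .
  let ?P = "norm ((y - y') - (x - x'))" and ?Q = "(norm (y - x) + norm (y' - x')) powr \<gamma> * norm (x - x')"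
  have "\<psi>' r = D (b r) \<bullet> ((y - y') - (x - x')) + (D (b r) - D (a r)) \<bullet> (x - x')"
    by (simp add: \<psi>'_def inner_diff_left inner_diff_right)
  then have "\<bar>\<psi>' r\<bar> \<le> \<bar>D (b r) \<bullet> ((y - y') - (x - x'))\<bar> + \<bar>(D (b r) - D (a r)) \<bullet> (x - x')\<bar>" by simp
  also have "\<dots> \<le> norm (D (b r)) * ?P + norm (D (b r) - D (a r)) * norm (x - x')"
    by (intro add_mono Cauchy_Schwarz_ineq2)
  also have "\<dots> \<le> (norm (D 0) + C * R powr \<gamma>) * ?P + (C * (norm (y - x) + norm (y' - x')) powr \<gamma>) * norm (x - x')"
    by (intro add_mono mult_right_mono Db Dba) auto
  also have "\<dots> = (norm (D 0) + C * R powr \<gamma>) * ?P + C * ?Q" by (simp add: mult.assoc)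
  also have "\<dots> \<le> (norm (D 0) + C * R powr \<gamma> + C) * ?P + (norm (D 0) + C * R powr \<gamma> + C) * ?Q"
    by (rule add_mono[OF mult_right_mono mult_right_mono]) (use C in auto)
  finally show ?thesis unfolding eq by (simp add: distrib_left)
qed

lemma norm_matrix_le_sum: "norm (A :: real^'n^'m) \<le> (\<Sum>i\<in>UNIV. \<Sum>j\<in>UNIV. \<bar>A $ i $ j\<bar>)"
proof -
  have "norm A \<le> (\<Sum>i\<in>UNIV. norm (A $ i))" unfolding norm_vec_def by (rule L2_set_le_sum) simp
  also have "\<dots> \<le> (\<Sum>i\<in>UNIV. \<Sum>j\<in>UNIV. \<bar>A $ i $ j\<bar>)" by (intro sum_mono norm_le_l1_cart)
  finally show ?thesis .
qed

text \<open>Leads from the operator norm of the hypotheses to \<open>norm\<close>: each entry is a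
  component of the image of a basis vector.\<close>

lemma norm_matrix_le_onorm: "norm (A :: real^'n^'m) \<le> real CARD('m) * (real CARD('n) * onorm (\<lambda>v. A *v v))"
proof -
  have bl: "bounded_linear (\<lambda>v. A *v v)"
    by (rule bounded_bilinear.bounded_linear_right[OF bounded_bilinear_matrix_vector])
  have e: "\<bar>A $ i $ j\<bar> \<le> onorm (\<lambda>v. A *v v)" for i j
  proof -
    have "A $ i $ j = (A *v axis j 1) $ i" by (simp add: matrix_vector_mult_basis column_def)
    then have "\<bar>A $ i $ j\<bar> \<le> norm (A *v axis j 1)" using component_le_norm_cart by metis
    also have "\<dots> \<le> onorm (\<lambda>v. A *v v) * norm (axis j (1::real))" by (rule onorm[OF bl])
    finally show ?thesis by simp
  qed
  have "norm A \<le> (\<Sum>i\<in>UNIV. \<Sum>j\<in>UNIV. \<bar>A $ i $ j\<bar>)" by (rule norm_matrix_le_sum)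
  also have "\<dots> \<le> (\<Sum>i\<in>(UNIV::'m set). real CARD('n) * onorm (\<lambda>v. A *v v))"
    using e by (intro sum_mono sum_bounded_above) auto
  finally show ?thesis by simp
qed

section \<open>The solution map\<close>

text \<open>The hypotheses in the form in which they are used: Frobenius norm for \<open>g\<close>,
  arbitrary real radii, and a second-difference estimate in place of the derivatives.\<close>

locale reflected_equation =
  fixes p \<alpha> \<gamma> Lf Cg :: real
    and f :: "real^'d \<Rightarrow> real^'d" and g :: "real^'d \<Rightarrow> real^'d^'d"
    and a :: "real \<Rightarrow> real" and z l :: "real \<Rightarrow> real^'d" and x0 :: "real^'d"
  assumes p1: "1 \<le> p" and \<alpha>: "p - 1 < \<alpha>" "\<alpha> \<le> 1" and \<gamma>: "p - 1 < \<gamma>" "\<gamma> \<le> 1"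
    and f_cont: "continuous_on UNIV f" and Lf: "0 \<le> Lf" and f_growth: "\<And>x. norm (f x) \<le> Lf * (1 + norm x)"
    and Cg: "0 \<le> Cg" and g_hoelder: "\<And>x y. norm (g x - g y) \<le> Cg * norm (x - y) powr \<alpha>"
    and f_lip: "\<And>R. \<exists>M\<ge>0. \<forall>x y. norm x \<le> R \<longrightarrow> norm y \<le> R \<longrightarrow> norm (f x - f y) \<le> M * norm (x - y)"
    and g_diff: "\<And>R. \<exists>M\<ge>0. \<forall>x x' y y'. norm x \<le> R \<longrightarrow> norm x' \<le> R \<longrightarrow> norm y \<le> R \<longrightarrow> norm y' \<le> R \<longrightarrow>
        norm ((g y - g y') - (g x - g x')) \<le> M * (norm ((y - y') - (x - x')) + (norm (y - x) + norm (y' - x')) powr \<gamma> * norm (x - x'))"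
    and a: "cadlag a" "\<And>T. 0 \<le> T \<Longrightarrow> fv 1 a 0 T"
    and z: "cadlag z" "\<And>T. 0 \<le> T \<Longrightarrow> fv p z 0 T"
    and l: "cadlag l" "\<And>i. l 0 $ i \<le> x0 $ i"
begin

lemma exponents:
  shows "0 < \<alpha>" "0 < \<gamma>" "0 < p" "1 \<le> p / \<alpha>" "1 \<le> p / \<gamma>" "1 < 1 / p + 1 / (p / \<alpha>)" "1 < 1 / p + 1 / (p / \<gamma>)" "p \<le> p / \<gamma>"
proof -
  show pos: "0 < \<alpha>" "0 < \<gamma>" "0 < p" using p1 \<alpha> \<gamma> by auto
  then show "1 \<le> p / \<alpha>" "1 \<le> p / \<gamma>" "1 < 1 / p + 1 / (p / \<alpha>)" "1 < 1 / p + 1 / (p / \<gamma>)"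
    using p1 \<alpha> \<gamma> by (auto simp: field_simps)
  have "p * \<gamma> \<le> p * 1" using pos \<gamma> by (intro mult_left_mono) auto
  then show "p \<le> p / \<gamma>" using pos by (simp add: le_divide_eq)
qed

lemma g_cont: "continuous_on UNIV g"
proof -
  have "isCont g x" for x
  proof -
    have "((\<lambda>y. Cg * norm (y - x) powr \<alpha>) \<longlongrightarrow> Cg * norm (x - x) powr \<alpha>) (at x)"
      by (intro tendsto_mult tendsto_powr' tendsto_norm tendsto_diff tendsto_const tendsto_ident_at) (use exponents in auto)
    then have "((\<lambda>y. Cg * norm (y - x) powr \<alpha>) \<longlongrightarrow> 0) (at x)" by simp
    then have "((\<lambda>y. g y - g x) \<longlongrightarrow> 0) (at x)"
      by (rule Lim_null_comparison[OF always_eventually, rotated]) (use g_hoelder in blast)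
    then show ?thesis unfolding isCont_def by (rule LIM_zero_cancel)
  qed
  then show ?thesis by (simp add: continuous_on_eq_continuous_at)
qed

text \<open>The common starting value makes the difference of two paths vanish at 0, so that its
  p-variation bounds its supremum.\<close>

definition path :: "(real \<Rightarrow> real^'d) \<Rightarrow> bool" where
  "path x \<longleftrightarrow> cadlag x \<and> x 0 = x0 \<and> (\<forall>T\<ge>0. fv p x 0 T)"

definition Ia :: "(real \<Rightarrow> real^'d) \<Rightarrow> real \<Rightarrow> real \<Rightarrow> real^'d" where
  "Ia x = rsi (\<lambda>u v. v *\<^sub>R u) (\<lambda>s. f (left_lim x s)) a"

definition Iz :: "(real \<Rightarrow> real^'d) \<Rightarrow> real \<Rightarrow> real \<Rightarrow> real^'d" where
  "Iz x = rsi (\<lambda>M v. M *v v) (\<lambda>s. g (left_lim x s)) z"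

definition Y :: "(real \<Rightarrow> real^'d) \<Rightarrow> real \<Rightarrow> real^'d" where
  "Y x t = x0 + Ia x 0 t + Iz x 0 t"

definition \<Phi> :: "(real \<Rightarrow> real^'d) \<Rightarrow> real \<Rightarrow> real^'d" where
  "\<Phi> x t = Y x t + kmap (\<lambda>s. l s - Y x s) t"

text \<open>Raising \<open>pv 1 a\<close> to the power \<open>p\<close> puts it on the scale of p-th
  powers of increments; since \<open>p \<ge> 1\<close> the result is still superadditive.\<close>

definition W :: "real \<Rightarrow> real \<Rightarrow> real" where
  "W u v = pv p z u v + pv 1 a u v powr p"

lemma pathD: "path x \<Longrightarrow> cadlag x" "path x \<Longrightarrow> x 0 = x0" "path x \<Longrightarrow> 0 \<le> u \<Longrightarrow> u \<le> v \<Longrightarrow> fv p x u v"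
  unfolding path_def by (blast, blast, meson fv_subset order_trans order_refl)

lemma fv_drivers: "0 \<le> u \<Longrightarrow> u \<le> v \<Longrightarrow> fv 1 a u v" "0 \<le> u \<Longrightarrow> u \<le> v \<Longrightarrow> fv p z u v"
  using fv_subset[OF a(2), of v u v] fv_subset[OF z(2), of v u v] by auto

lemma super_on_W: "0 \<le> T \<Longrightarrow> super_on 0 T W"
  unfolding W_def by (intro super_on_add super_on_powr super_on_pv fv_drivers p1) auto

lemma W_nonneg: "0 \<le> u \<Longrightarrow> u \<le> v \<Longrightarrow> 0 \<le> W u v"
  using super_onD(1)[OF super_on_W, of v u v] by simp

lemma W_mono: "0 \<le> s \<Longrightarrow> s \<le> u \<Longrightarrow> u \<le> v \<Longrightarrow> v \<le> t \<Longrightarrow> W u v \<le> W s t"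
  using super_on_mono[OF super_on_W, of t s u v t] by simp

lemma W_right_small:
  assumes "0 \<le> t" "0 < e"
  shows "\<exists>d>0. d \<le> 1 \<and> W t (t + d) \<le> e"
proof -
  have e: "0 < e / 2" "0 < (e / 2) powr (1 / p)" using assms by auto
  obtain d1 where d1: "0 < d1" "t + d1 \<le> t + 1" "pv p z t (t + d1) \<le> e / 2"
    using pv_right_small[OF cadlag_right[OF z(1) assms(1)] fv_drivers(2)[of t "t + 1"] _ e(1)] assms exponents by auto
  obtain d2 where d2: "0 < d2" "t + d2 \<le> t + 1" "pv 1 a t (t + d2) \<le> (e / 2) powr (1 / p)"
    using pv_right_small[OF cadlag_right[OF a(1) assms(1)] fv_drivers(1)[of t "t + 1"] _ e(2)] assms by auto
  define d where "d = min d1 d2"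
  have d: "0 < d" "d \<le> 1" "t \<le> t + d" "t + d \<le> t + d1" "t + d \<le> t + d2" using d1 d2 by (auto simp: d_def)
  have "pv p z t (t + d) \<le> e / 2"
    using pv_mono[OF fv_drivers(2), of t "t + d1" t "t + d"] d d1 assms by auto
  moreover have "pv 1 a t (t + d) powr p \<le> ((e / 2) powr (1 / p)) powr p"
    using pv_mono[OF fv_drivers(1), of t "t + d2" t "t + d"] d d2 assms exponents
    by (intro powr_mono2 pv_nonneg fv_drivers) auto
  moreover have "((e / 2) powr (1 / p)) powr p = e / 2" using assms exponents by (simp add: powr_powr)
  ultimately have "W t (t + d) \<le> e" by (simp add: W_def)
  then show ?thesis using d by blast
qed

lemma W_left_small:
  assumes "0 < t" "0 < e"
  shows "\<exists>s. 0 \<le> s \<and> s < t \<and> (\<forall>v. s \<le> v \<longrightarrow> v < t \<longrightarrow> W s v \<le> e)"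
proof -
  have e: "0 < e / 2" "0 < (e / 2) powr (1 / p)" using assms by auto
  have 1: "0 \<le> v \<Longrightarrow> v < t \<Longrightarrow> fv p z 0 v \<and> pv p z 0 v \<le> pv p z 0 t" for v
    using assms by (auto intro: fv_drivers pv_mono[OF fv_drivers(2)])
  have 2: "0 \<le> v \<Longrightarrow> v < t \<Longrightarrow> fv 1 a 0 v \<and> pv 1 a 0 v \<le> pv 1 a 0 t" for v
    using assms by (auto intro: fv_drivers pv_mono[OF fv_drivers(1)])
  obtain s1 where s1: "0 \<le> s1" "s1 < t" "\<forall>u v. s1 \<le> u \<longrightarrow> u \<le> v \<longrightarrow> v < t \<longrightarrow> pv p z u v \<le> e / 2"
    using pv_left_half_small[OF 1 assms(1) e(1)] by blast
  obtain s2 where s2: "0 \<le> s2" "s2 < t" "\<forall>u v. s2 \<le> u \<longrightarrow> u \<le> v \<longrightarrow> v < t \<longrightarrow> pv 1 a u v \<le> (e / 2) powr (1 / p)"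
    using pv_left_half_small[OF 2 assms(1) e(2)] by blast
  define s where "s = max s1 s2"
  have s: "0 \<le> s" "s < t" "s1 \<le> s" "s2 \<le> s" using s1 s2 by (auto simp: s_def)
  have "W s v \<le> e" if v: "s \<le> v" "v < t" for v
  proof -
    have "pv p z s v \<le> e / 2" using s1 s v by auto
    moreover have "pv 1 a s v powr p \<le> ((e / 2) powr (1 / p)) powr p"
      using s2 s v exponents by (intro powr_mono2 pv_nonneg fv_drivers) auto
    moreover have "((e / 2) powr (1 / p)) powr p = e / 2" using assms exponents by (simp add: powr_powr)
    ultimately show ?thesis by (simp add: W_def)
  qed
  then show ?thesis using s by blast
qed

section \<open>The integrals along a path and the solution map\<close>

lemma path_bound:
  assumes "path x" "0 \<le> r" "r \<le> v" "pv p x 0 v \<le> N"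
  shows "norm (x r) \<le> norm x0 + N powr (1 / p)" and "norm (left_lim x r) \<le> norm x0 + N powr (1 / p)"
proof -
  have *: "norm (x r) \<le> norm x0 + N powr (1 / p)" if "0 \<le> r" "r \<le> v" for r
  proof -
    have "norm (x r - x 0) \<le> pv p x 0 r powr (1 / p)"
      using incr_le_pv_root[OF pathD(3)[OF assms(1)], of 0 v 0 r] that exponents by simp
    also have "\<dots> \<le> N powr (1 / p)"
      using that assms exponents pv_mono[OF pathD(3)[OF assms(1)], of 0 v 0 r]
      by (intro powr_mono2 pv_nonneg pathD(3)[OF assms(1)]) auto
    finally show ?thesis using norm_triangle_sub[of "x r" "x 0"] pathD(2)[OF assms(1)] by simp
  qed
  show "norm (x r) \<le> norm x0 + N powr (1 / p)" using * assms by simp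
  show "norm (left_lim x r) \<le> norm x0 + N powr (1 / p)"
    using left_lim_bound[OF pathD(1)[OF assms(1)] assms(2), of "norm x0 + N powr (1 / p)"] * assms by simp
qed

lemma fv_f_path: assumes "path x" "0 \<le> v" shows "fv p (\<lambda>t. f (x t)) 0 v"
proof -
  define R where "R = norm x0 + pv p x 0 v powr (1 / p)"
  obtain M where M: "0 \<le> M" "\<And>x y. norm x \<le> R \<Longrightarrow> norm y \<le> R \<Longrightarrow> norm (f x - f y) \<le> M * norm (x - y)"
    using f_lip[of R] by blast
  have R: "norm (x r) \<le> R" if "0 \<le> r" "r \<le> v" for r
    using path_bound(1)[OF assms(1) that] by (simp add: R_def)
  have "fv (p / 1) (\<lambda>t. f (x t)) 0 v"
    by (rule fv_pv_hoelder(1)[OF pathD(3)[OF assms(1) order_refl assms(2)] assms(2) zero_less_one M(1)])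
       (use R M(2) exponents in auto)
  then show ?thesis by simp
qed

lemma fv_g_path:
  assumes "path x" "0 \<le> v"
  shows "fv (p / \<alpha>) (\<lambda>t. g (x t)) 0 v" "pv (p / \<alpha>) (\<lambda>t. g (x t)) 0 v \<le> Cg powr (p / \<alpha>) * pv p x 0 v"
  using fv_pv_hoelder[OF pathD(3)[OF assms(1) order_refl assms(2)] assms(2) exponents(1) Cg exponents(3), of "\<lambda>t. g (x t)"]
    g_hoelder by auto

lemma left_lim_f: "path x \<Longrightarrow> 0 \<le> r \<Longrightarrow> left_lim (\<lambda>t. f (x t)) r = f (left_lim x r)"
  by (rule left_lim_compose[OF f_cont]) (auto dest: pathD)

lemma left_lim_g: "path x \<Longrightarrow> 0 \<le> r \<Longrightarrow> left_lim (\<lambda>t. g (x t)) r = g (left_lim x r)"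
  by (rule left_lim_compose[OF g_cont]) (auto dest: pathD)

lemma cadlag_f: "path x \<Longrightarrow> cadlag (\<lambda>t. f (x t))"
  by (rule cadlag_compose[OF f_cont]) (auto dest: pathD)

lemma cadlag_g: "path x \<Longrightarrow> cadlag (\<lambda>t. g (x t))"
  by (rule cadlag_compose[OF g_cont]) (auto dest: pathD)

lemma Ia_has:
  assumes "path x" "0 \<le> u" "u \<le> v"
  shows "has_rs_integral (\<lambda>u v. v *\<^sub>R u) (\<lambda>s. f (left_lim x s)) a u v (Ia x u v)"
proof -
  have v: "0 \<le> v" using assms by simp
  have h: "has_rs_integral (\<lambda>u v. v *\<^sub>R u) (left_lim (\<lambda>t. f (x t))) a u v (rsi (\<lambda>u v. v *\<^sub>R u) (left_lim (\<lambda>t. f (x t))) a u v)"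
    by (rule has_rs_integral_left_lim[OF bounded_bilinear_scaleR_flip order_refl p1 _ cadlag_f[OF assms(1)] fv_f_path[OF assms(1) v] a(1) a(2)[OF v] assms(2,3)])
       (use exponents in simp)
  have eq: "left_lim (\<lambda>t. f (x t)) r = f (left_lim x r)" if "u \<le> r" "r \<le> v" for r
    using left_lim_f assms that by simp
  have e: "Ia x u v = rsi (\<lambda>u v. v *\<^sub>R u) (left_lim (\<lambda>t. f (x t))) a u v"
    unfolding Ia_def by (rule rsi_cong) (simp add: eq)
  show ?thesis
    by (rule iffD1[OF has_rs_integral_cong h[folded e]]) (rule eq)
qed

lemma Iz_has:
  assumes "path x" "0 \<le> u" "u \<le> v"
  shows "has_rs_integral (\<lambda>M v. M *v v) (\<lambda>s. g (left_lim x s)) z u v (Iz x u v)"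
    and "Iz x u v = rsi (\<lambda>M v. M *v v) (left_lim (\<lambda>t. g (x t))) z u v"
proof -
  have v: "0 \<le> v" using assms by simp
  have h: "has_rs_integral (\<lambda>M v. M *v v) (left_lim (\<lambda>t. g (x t))) z u v (rsi (\<lambda>M v. M *v v) (left_lim (\<lambda>t. g (x t))) z u v)"
    by (rule has_rs_integral_left_lim[OF bounded_bilinear_matrix_vector p1 exponents(4,6) cadlag_g[OF assms(1)] fv_g_path(1)[OF assms(1) v] z(1) z(2)[OF v] assms(2,3)])
  have eq: "left_lim (\<lambda>t. g (x t)) r = g (left_lim x r)" if "u \<le> r" "r \<le> v" for r
    using left_lim_g assms that by simp
  show e: "Iz x u v = rsi (\<lambda>M v. M *v v) (left_lim (\<lambda>t. g (x t))) z u v"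
    unfolding Iz_def by (rule rsi_cong) (simp add: eq)
  show "has_rs_integral (\<lambda>M v. M *v v) (\<lambda>s. g (left_lim x s)) z u v (Iz x u v)"
    by (rule iffD1[OF has_rs_integral_cong h[folded e]]) (rule eq)
qed

lemma integrals_add:
  assumes "path x" "0 \<le> u" "u \<le> v"
  shows "Ia x 0 v = Ia x 0 u + Ia x u v" "Iz x 0 v = Iz x 0 u + Iz x u v"
proof -
  have v: "0 \<le> v" using assms by simp
  show "Ia x 0 v = Ia x 0 u + Ia x u v"
    using has_rs_integral_unique[OF Ia_has[OF assms(1) order_refl v] has_rs_integral_concat[OF Ia_has[OF assms(1) order_refl assms(2)] Ia_has[OF assms]]] .
  show "Iz x 0 v = Iz x 0 u + Iz x u v"
    using has_rs_integral_unique[OF Iz_has(1)[OF assms(1) order_refl v] has_rs_integral_concat[OF Iz_has(1)[OF assms(1) order_refl assms(2)] Iz_has(1)[OF assms]]] .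
qed

lemma Y_0: "path x \<Longrightarrow> Y x 0 = x0"
  using integrals_add[of x 0 0] unfolding Y_def by simp

lemma Y_incr: "path x \<Longrightarrow> 0 \<le> u \<Longrightarrow> u \<le> v \<Longrightarrow> Y x v - Y x u = Ia x u v + Iz x u v"
  using integrals_add[of x u v] unfolding Y_def by simp

lemma Ia_bound:
  assumes "path x" "0 \<le> u" "u \<le> v" "\<And>r. u \<le> r \<Longrightarrow> r \<le> v \<Longrightarrow> norm (f (left_lim x r)) \<le> B" "0 \<le> B"
  shows "norm (Ia x u v) \<le> B * pv 1 a u v"
  using rs_integral_bv_bound[OF Ia_has[OF assms(1-3)], of 1 B] assms(4,5) fv_drivers(1)[OF assms(2,3)] by simp

text \<open>Recombines the bounds for the two integrals into \<open>W\<close>. The factor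
  \<open>m\<close> is one plus the size of a path in \<open>Y_estimate\<close> and the distance of
  two paths in \<open>Y_diff_estimate\<close>.\<close>

lemma young_drivers_combine:
  assumes "0 \<le> D" "0 \<le> m" "norm i1 \<le> D * m * pv 1 a u v" "norm i2 \<le> D * m * pv p z u v powr (1 / p)" "0 \<le> u" "u \<le> v"
  shows "norm (i1 + i2) powr p \<le> (2 * D * m) powr p * W u v"
proof -
  have nn: "0 \<le> pv 1 a u v" "0 \<le> pv p z u v" using pv_nonneg[OF fv_drivers(1)] pv_nonneg[OF fv_drivers(2)] assms by auto
  have "norm (i1 + i2) \<le> norm i1 + norm i2" by (rule norm_triangle_ineq)
  also have "\<dots> \<le> D * m * (pv 1 a u v + pv p z u v powr (1 / p))" using assms by (simp add: distrib_left)
  finally have "norm (i1 + i2) powr p \<le> (D * m * (pv 1 a u v + pv p z u v powr (1 / p))) powr p"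
    using exponents by (intro powr_mono2) auto
  also have "\<dots> = (D * m) powr p * (pv 1 a u v + pv p z u v powr (1 / p)) powr p" by (simp add: powr_mult)
  also have "\<dots> \<le> (D * m) powr p * (2 powr p * (pv 1 a u v powr p + (pv p z u v powr (1 / p)) powr p))"
    using nn exponents by (intro mult_left_mono powr_add_le) auto
  also have "(pv p z u v powr (1 / p)) powr p = pv p z u v" using nn exponents by (simp add: powr_powr)
  also have "(D * m) powr p * (2 powr p * (pv 1 a u v powr p + pv p z u v)) = (2 * D * m) powr p * W u v"
    by (simp add: W_def powr_mult add.commute)
  finally show ?thesis .
qed

text \<open>The bound is affine in \<open>pv p x 0 v\<close>, since \<open>f\<close> grows linearly
  and \<open>\<alpha> \<le> 1\<close> turns the Hoelder estimate for \<open>g\<close> into a linear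
  one. This is what lets \<open>extend_limit\<close> absorb the variation; the constants of (H2)
  would not do, as they depend on the size of the path.\<close>

lemma Y_estimate:
  "\<exists>c\<ge>0. \<forall>x u v. path x \<longrightarrow> 0 \<le> u \<longrightarrow> u \<le> v \<longrightarrow> norm (Y x v - Y x u) powr p \<le> c * (1 + pv p x 0 v) * W u v"
proof -
  define yc where "yc = young_const p (p / \<alpha>)"
  have yc: "0 \<le> yc" unfolding yc_def using young_const_nonneg exponents by blast
  define D where "D = Lf * (1 + norm x0) + norm (g x0) + (1 + yc) * Cg"
  have D: "0 \<le> D" using Lf Cg yc by (simp add: D_def)
  have "norm (Y x v - Y x u) powr p \<le> ((2 * D) powr p * 2 powr p) * (1 + pv p x 0 v) * W u v"
    if x: "path x" and uv: "0 \<le> u" "u \<le> v" for x u v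
  proof -
    define N where "N = pv p x 0 v"
    define n where "n = N powr (1 / p)"
    have v: "0 \<le> v" using uv by simp
    have N: "0 \<le> N" using pv_nonneg[OF pathD(3)[OF x order_refl v] v] by (simp add: N_def)
    have n: "0 \<le> n" "n powr p = N" using N exponents by (auto simp: n_def powr_powr)
    have "norm (f (left_lim x r)) \<le> Lf * (1 + norm x0) * (1 + n)" if "u \<le> r" "r \<le> v" for r
    proof -
      have "norm (f (left_lim x r)) \<le> Lf * (1 + norm (left_lim x r))" by (rule f_growth)
      also have "\<dots> \<le> Lf * (1 + (norm x0 + n))"
        using path_bound(2)[OF x, of r v N] that uv Lf by (intro mult_left_mono) (auto simp: N_def n_def)
      also have "\<dots> \<le> Lf * ((1 + norm x0) * (1 + n))" using n Lf by (intro mult_left_mono) (auto simp: algebra_simps)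
      finally show ?thesis by (simp add: mult.assoc)
    qed
    then have i1: "norm (Ia x u v) \<le> Lf * (1 + norm x0) * (1 + n) * pv 1 a u v"
      using Lf n by (intro Ia_bound x uv) auto
    have na: "0 \<le> pv 1 a u v" using pv_nonneg[OF fv_drivers(1)] uv by auto
    have "Lf * (1 + norm x0) \<le> D" using Cg yc by (simp add: D_def)
    then have "Lf * (1 + norm x0) * (1 + n) * pv 1 a u v \<le> D * (1 + n) * pv 1 a u v" using na n by (intro mult_right_mono) auto
    then have I1: "norm (Ia x u v) \<le> D * (1 + n) * pv 1 a u v" using i1 by linarith
    define H where "H = Cg * n powr \<alpha>"
    have H: "0 \<le> H" "H powr (p / \<alpha>) = Cg powr (p / \<alpha>) * N"
      using Cg n exponents by (auto simp: H_def powr_mult powr_powr)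
    \<comment> \<open>The place where \<open>\<alpha> \<le> 1\<close> yields linear growth.\<close>
    have "n powr \<alpha> \<le> 1 + n"
    proof (cases "n \<le> 1")
      case True
      then show ?thesis using n exponents powr_le1[of \<alpha> n] by simp
    next
      case False
      then have "n powr \<alpha> \<le> n powr 1" using \<alpha> by (intro powr_mono) auto
      then show ?thesis using False by simp
    qed
    then have Hn: "H \<le> Cg * (1 + n)" using Cg by (simp add: H_def mult_left_mono)
    have "norm (Iz x u v) \<le> 1 * (norm (g (x 0)) + (1 + yc) * H) * pv p z u v powr (1 / p)"
      unfolding Iz_has(2)[OF x uv] yc_def
      by (rule rsi_young_bound[OF bounded_bilinear_matrix_vector _ norm_matrix_vector_le p1 exponents(4,6) cadlag_g[OF x] fv_g_path(1)[OF x v] _ H(1) z(1) z(2)[OF v] uv])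
         (use fv_g_path(2)[OF x v] in \<open>auto simp: H(2) N_def\<close>)
    also have "\<dots> \<le> D * (1 + n) * pv p z u v powr (1 / p)"
    proof (rule mult_right_mono)
      have "(1 + yc) * H \<le> (1 + yc) * Cg * (1 + n)" using Hn yc by (simp add: mult.assoc mult_left_mono)
      moreover have "norm (g x0) * 1 \<le> norm (g x0) * (1 + n)" using n by (intro mult_left_mono) auto
      moreover have "0 \<le> Lf * (1 + norm x0) * (1 + n)" using Lf n by simp
      moreover have "D * (1 + n) = Lf * (1 + norm x0) * (1 + n) + norm (g x0) * (1 + n) + (1 + yc) * Cg * (1 + n)"
        by (simp add: D_def distrib_right)
      ultimately show "1 * (norm (g (x 0)) + (1 + yc) * H) \<le> D * (1 + n)" using pathD(2)[OF x] by simp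
    qed simp
    finally have I2: "norm (Iz x u v) \<le> D * (1 + n) * pv p z u v powr (1 / p)" .
    have "norm (Y x v - Y x u) powr p \<le> (2 * D * (1 + n)) powr p * W u v"
      unfolding Y_incr[OF x uv] using D n I1 I2 uv by (intro young_drivers_combine) auto
    also have "\<dots> = (2 * D) powr p * (1 + n) powr p * W u v" by (simp only: powr_mult)
    also have "\<dots> \<le> (2 * D) powr p * (2 powr p * (1 powr p + n powr p)) * W u v"
      using n exponents W_nonneg[OF uv] by (intro mult_right_mono mult_left_mono powr_add_le) auto
    finally show ?thesis unfolding n(2) by (simp add: N_def mult.assoc)
  qed
  then show ?thesis by (intro exI[of _ "(2 * D) powr p * 2 powr p"]) simp
qed

lemma Y_variation:
  "\<exists>c\<ge>0. \<forall>x u v. path x \<longrightarrow> 0 \<le> u \<longrightarrow> u \<le> v \<longrightarrow> fv p (Y x) u v \<and> pv p (Y x) u v \<le> c * (1 + pv p x 0 v) * W u v"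
proof -
  obtain c where c: "0 \<le> c" "\<And>x u v. path x \<Longrightarrow> 0 \<le> u \<Longrightarrow> u \<le> v \<Longrightarrow> norm (Y x v - Y x u) powr p \<le> c * (1 + pv p x 0 v) * W u v"
    using Y_estimate by blast
  have "fv p (Y x) u v \<and> pv p (Y x) u v \<le> c * (1 + pv p x 0 v) * W u v" if x: "path x" and uv: "0 \<le> u" "u \<le> v" for x u v
  proof -
    have N: "0 \<le> pv p x 0 v" using pv_nonneg[OF pathD(3)[OF x]] uv by auto
    have sup: "super_on u v (\<lambda>s t. c * (1 + pv p x 0 v) * W s t)"
      using c(1) N uv super_on_subset[OF super_on_W, of v u v] by (intro super_on_cmult) auto
    have inc: "norm (Y x t - Y x s) powr p \<le> c * (1 + pv p x 0 v) * W s t" if "u \<le> s" "s < t" "t \<le> v" for s t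
    proof -
      have "norm (Y x t - Y x s) powr p \<le> c * (1 + pv p x 0 t) * W s t" using that uv by (intro c(2) x) auto
      also have "\<dots> \<le> c * (1 + pv p x 0 v) * W s t"
        using that uv c(1) pv_mono[OF pathD(3)[OF x], of 0 v 0 t] W_nonneg[of s t] by (intro mult_right_mono mult_left_mono) auto
      finally show ?thesis .
    qed
    show ?thesis using pv_control[OF sup inc] uv by auto
  qed
  then show ?thesis using c(1) by blast
qed

lemma fv_Y: "path x \<Longrightarrow> 0 \<le> u \<Longrightarrow> u \<le> v \<Longrightarrow> fv p (Y x) u v"
  using Y_variation by blast

lemma cadlag_Y:
  assumes x: "path x" shows "cadlag (Y x)"
proof (rule cadlag_of_fv[OF _ fv_Y[OF x order_refl] exponents(3)])
  fix t :: real assume t: "0 \<le> t"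
  obtain c where c: "0 \<le> c" "\<And>x u v. path x \<Longrightarrow> 0 \<le> u \<Longrightarrow> u \<le> v \<Longrightarrow> norm (Y x v - Y x u) powr p \<le> c * (1 + pv p x 0 v) * W u v"
    using Y_estimate by blast
  define C where "C = c * (1 + pv p x 0 (t + 1))"
  have N: "0 \<le> pv p x 0 (t + 1)" using pv_nonneg[OF pathD(3)[OF x]] t by auto
  have C: "0 \<le> C" using c(1) N by (simp add: C_def)
  show "(Y x \<longlongrightarrow> Y x t) (at_right t)"
  proof (rule tendstoI)
    fix e :: real assume e: "0 < e"
    define \<eta> where "\<eta> = e powr p / (2 * (C + 1))"
    have "0 < \<eta>" using e C by (simp add: \<eta>_def)
    then obtain d where d: "0 < d" "d \<le> 1" "W t (t + d) \<le> \<eta>" using W_right_small[OF t] by blast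
    have "dist (Y x v) (Y x t) < e" if v: "t < v" "v < t + d" for v
    proof -
      have "norm (Y x v - Y x t) powr p \<le> c * (1 + pv p x 0 v) * W t v" using c(2)[OF x t, of v] v by simp
      also have "\<dots> \<le> C * \<eta>" unfolding C_def
        using v t d c(1) N pv_mono[OF pathD(3)[OF x], of 0 "t + 1" 0 v] W_mono[of t t v "t + d"] W_nonneg[of t v]
        by (intro mult_mono mult_left_mono) auto
      also have "\<dots> < e powr p"
      proof -
        have "C * \<eta> \<le> (C + 1) * \<eta>" using \<open>0 < \<eta>\<close> by simp
        also have "\<dots> = e powr p / 2" using C by (simp add: \<eta>_def field_simps)
        also have "\<dots> < e powr p" using e by simp
        finally show ?thesis .
      qed
      finally show ?thesis
        using e exponents powr_mono2[of p e "norm (Y x v - Y x t)"] by (auto simp: dist_norm not_less[symmetric])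
    qed
    then show "eventually (\<lambda>v. dist (Y x v) (Y x t) < e) (at_right t)"
      using eventually_at_right_real[of t "t + d"] d by (auto elim!: eventually_mono)
  qed
qed

lemma cadlag_lY: "path x \<Longrightarrow> cadlag (\<lambda>s. l s - Y x s)"
  using cadlag_diff l(1) cadlag_Y by blast

lemma lY_0: "path x \<Longrightarrow> (l 0 - Y x 0) $ i \<le> 0"
  using l(2)[of i] Y_0 by simp

lemma fv_kmap: "path x \<Longrightarrow> 0 \<le> u \<Longrightarrow> u \<le> v \<Longrightarrow> fv p (kmap (\<lambda>s. l s - Y x s)) u v"
proof -
  assume x: "path x" and uv: "0 \<le> u" "u \<le> v"
  let ?u = "\<lambda>s. l s - Y x s"
  \<comment> \<open>Boundedness is enough here: \<open>l\<close> has no variation bound, but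
    \<open>kmap_osc\<close> asks only for oscillation.\<close>
  obtain B where B: "\<And>r. 0 \<le> r \<Longrightarrow> r \<le> v \<Longrightarrow> norm (?u r) \<le> B" using cadlag_bounded[OF cadlag_lY[OF x], of v] uv by auto
  show ?thesis
  proof (rule kmap_osc(1)[OF cadlag_lY[OF x] uv p1])
    fix r assume "u \<le> r" "r \<le> v"
    then show "norm (?u r - ?u u) \<le> B + B" using B[of r] B[of u] uv norm_triangle_ineq4[of "?u r" "?u u"] by auto
  qed
qed

lemma path_\<Phi>: "path x \<Longrightarrow> path (\<Phi> x)"
proof -
  assume x: "path x"
  have c: "cadlag (\<Phi> x)" unfolding \<Phi>_def by (intro cadlag_add cadlag_kmap cadlag_lY cadlag_Y x)
  have f: "fv p (\<Phi> x) 0 T" if "0 \<le> T" for T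
    unfolding \<Phi>_def using fv_pv_add(1)[OF fv_Y fv_kmap, OF x _ _ x, of 0 T] that exponents by auto
  have "\<Phi> x 0 = x0" unfolding \<Phi>_def using kmap_0[of "\<lambda>s. l s - Y x s" 0] lY_0[OF x] Y_0[OF x] by simp
  then show ?thesis using c f by (simp add: path_def)
qed

text \<open>The integrands contain left limits only, so agreement strictly before \<open>u\<close>
  determines even the value at \<open>u\<close>, jump included.\<close>

lemma causal:
  assumes "path x" "path x'" "\<And>s. 0 \<le> s \<Longrightarrow> s < u \<Longrightarrow> x s = x' s" "0 \<le> t" "t \<le> u"
  shows "Y x t = Y x' t" "\<Phi> x t = \<Phi> x' t"
proof -
  have Yeq: "Y x t = Y x' t" if "0 \<le> t" "t \<le> u" for t
  proof -
    have "left_lim x r = left_lim x' r" if "0 \<le> r" "r \<le> t" for r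
      using that \<open>t \<le> u\<close> assms(3) pathD(2)[OF assms(1)] pathD(2)[OF assms(2)] by (intro left_lim_cong) auto
    then have "Ia x 0 t = Ia x' 0 t" "Iz x 0 t = Iz x' 0 t" unfolding Ia_def Iz_def by (auto intro: rsi_cong)
    then show ?thesis by (simp add: Y_def)
  qed
  show "Y x t = Y x' t" using Yeq assms by simp
  have "kmap (\<lambda>s. l s - Y x s) t = kmap (\<lambda>s. l s - Y x' s) t"
    by (rule kmap_cong) (use Yeq assms in auto)
  then show "\<Phi> x t = \<Phi> x' t" using Yeq assms by (simp add: \<Phi>_def)
qed

end

section \<open>Contraction and uniqueness\<close>

context reflected_equation
begin

text \<open>Here the constant may depend on \<open>B\<close>: the local constants of
  \<open>f\<close> and \<open>g\<close> are taken on a ball that the paths do not leave, and the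
  variation of each path enters through the second differences. The Young exponent is
  \<open>p / \<gamma>\<close> rather than \<open>p / \<alpha>\<close>, because the difference of the
  integrands must be small with the distance of the paths.\<close>

lemma Y_diff_estimate:
  assumes B: "0 \<le> B"
  shows "\<exists>c\<ge>0. \<forall>x x' u v N. path x \<longrightarrow> path x' \<longrightarrow> 0 \<le> u \<longrightarrow> u \<le> v \<longrightarrow> pv p x 0 v \<le> B \<longrightarrow> pv p x' 0 v \<le> B \<longrightarrow>
     pv p (\<lambda>t. x t - x' t) 0 v \<le> N \<longrightarrow> 0 < N \<longrightarrow>
     norm ((Y x v - Y x' v) - (Y x u - Y x' u)) powr p \<le> c * N * W u v"
proof -
  define R where "R = norm x0 + B powr (1 / p)"
  obtain M1 where M1: "0 \<le> M1" "\<And>x y. norm x \<le> R \<Longrightarrow> norm y \<le> R \<Longrightarrow> norm (f x - f y) \<le> M1 * norm (x - y)"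
    using f_lip[of R] by blast
  obtain M2 where M2: "0 \<le> M2" "\<And>x x' y y'. norm x \<le> R \<Longrightarrow> norm x' \<le> R \<Longrightarrow> norm y \<le> R \<Longrightarrow> norm y' \<le> R \<Longrightarrow>
      norm ((g y - g y') - (g x - g x')) \<le> M2 * (norm ((y - y') - (x - x')) + (norm (y - x) + norm (y' - x')) powr \<gamma> * norm (x - x'))"
    using g_diff[of R] by blast
  define q where "q = p / \<gamma>"
  have q: "1 \<le> q" "p \<le> q" "0 < q" "\<gamma> * q = p" using exponents by (auto simp: q_def)
  define yc where "yc = young_const p q"
  have yc: "0 \<le> yc" unfolding yc_def q_def using young_const_nonneg exponents by blast
  define cH where "cH = 2 * M2 * (1 + 2 powr p * (B + B)) powr (1 / q)"
  have cH: "0 \<le> cH" using M2 by (simp add: cH_def)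
  define D where "D = M1 + (1 + yc) * cH"
  have D: "0 \<le> D" using M1 yc cH by (simp add: D_def)
  have "norm ((Y x v - Y x' v) - (Y x u - Y x' u)) powr p \<le> (2 * D) powr p * N * W u v"
    if x: "path x" "path x'" and uv: "0 \<le> u" "u \<le> v" and bd: "pv p x 0 v \<le> B" "pv p x' 0 v \<le> B"
      and dN: "pv p (\<lambda>t. x t - x' t) 0 v \<le> N" and N: "0 < N" for x x' u v N
  proof -
    have v: "0 \<le> v" using uv by simp
    define n where "n = N powr (1 / p)"
    have n: "0 < n" "n powr p = N" using N exponents by (auto simp: n_def powr_powr)
    let ?d = "\<lambda>t. x t - x' t"
    have fd: "fv p ?d 0 v" using fv_pv_diff(1)[OF pathD(3)[OF x(1)] pathD(3)[OF x(2)]] v exponents by simp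
    have cd: "cadlag ?d" using x pathD(1) cadlag_diff by blast
    have dn: "norm (?d r) \<le> n" if "0 \<le> r" "r \<le> v" for r
    proof -
      have "norm (?d r - ?d 0) \<le> pv p ?d 0 r powr (1 / p)" using incr_le_pv_root[OF fd] that exponents by simp
      also have "\<dots> \<le> n" unfolding n_def using that exponents dN pv_mono[OF fd, of 0 r]
        by (intro powr_mono2 pv_nonneg fv_subset[OF fd]) auto
      finally show ?thesis using pathD(2)[OF x(1)] pathD(2)[OF x(2)] by simp
    qed
    have Rx: "norm (x r) \<le> R" "norm (x' r) \<le> R" "norm (left_lim x r) \<le> R" "norm (left_lim x' r) \<le> R" if "0 \<le> r" "r \<le> v" for r
      using path_bound[OF x(1) that bd(1)] path_bound[OF x(2) that bd(2)] by (simp_all add: R_def)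
    have lld: "norm (left_lim x r - left_lim x' r) \<le> n" if "0 \<le> r" "r \<le> v" for r
      using left_lim_bound[OF cd that(1), of n] dn that left_lim_diff[OF pathD(1)[OF x(1)] pathD(1)[OF x(2)] that(1)] by simp
    have Ia: "norm (Ia x u v - Ia x' u v) \<le> 1 * (M1 * n) * pv 1 a u v"
    proof (rule rs_integral_bv_bound[OF has_rs_integral_diff[OF bounded_bilinear_scaleR_flip Ia_has[OF x(1) uv] Ia_has[OF x(2) uv]]])
      fix r assume r: "u \<le> r" "r \<le> v"
      have "norm (f (left_lim x r) - f (left_lim x' r)) \<le> M1 * norm (left_lim x r - left_lim x' r)"
        using r uv by (intro M1(2) Rx) auto
      also have "\<dots> \<le> M1 * n" using lld[of r] r uv M1 by (intro mult_left_mono) auto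
      finally show "norm (f (left_lim x r) - f (left_lim x' r)) \<le> M1 * n" .
    qed (use M1 n fv_drivers(1)[OF uv] in auto)
    let ?X = "\<lambda>t. g (x t) - g (x' t)"
    have cX: "cadlag ?X" using cadlag_diff[OF cadlag_g[OF x(1)] cadlag_g[OF x(2)]] .
    \<comment> \<open>On \<open>{0..v}\<close> both summands are at most a multiple of
      \<open>n powr q\<close>, so the q-th root is linear in \<open>n\<close>; \<open>cH\<close> is
      the resulting factor.\<close>
    define \<Omega> where "\<Omega> s t = (2 * M2) powr q * (n powr (q - p) * pv p ?d s t + n powr q * 2 powr p * (pv p x s t + pv p x' s t))" for s t
    have \<Omega>: "super_on 0 v \<Omega>" unfolding \<Omega>_def
      by (intro super_on_cmult super_on_add super_on_pv fd pathD(3)[OF x(1)] pathD(3)[OF x(2)] v) auto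
    have inc: "norm (?X t - ?X s) powr q \<le> \<Omega> s t" if st: "0 \<le> s" "s < t" "t \<le> v" for s t
    proof -
      let ?e = "norm (?d t - ?d s)" and ?e1 = "norm (x t - x s)" and ?e2 = "norm (x' t - x' s)"
      have "norm (?X t - ?X s) \<le> M2 * (?e + (?e1 + ?e2) powr \<gamma> * norm (x s - x' s))"
        using st by (intro M2(2) Rx) auto
      also have "\<dots> \<le> M2 * (?e + (?e1 + ?e2) powr \<gamma> * n)"
        using dn[of s] st M2 by (intro mult_left_mono add_left_mono) auto
      finally have "norm (?X t - ?X s) powr q \<le> (M2 * (?e + (?e1 + ?e2) powr \<gamma> * n)) powr q"
        using q by (intro powr_mono2) auto
      also have "\<dots> = M2 powr q * (?e + (?e1 + ?e2) powr \<gamma> * n) powr q" by (simp add: powr_mult)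
      also have "\<dots> \<le> M2 powr q * (2 powr q * (?e powr q + ((?e1 + ?e2) powr \<gamma> * n) powr q))"
        using q n by (intro mult_left_mono powr_add_le) auto
      also have "\<dots> = (2 * M2) powr q * (?e powr q + n powr q * (?e1 + ?e2) powr p)"
        using q(4) by (simp add: powr_mult powr_powr mult_ac)
      also have "\<dots> \<le> \<Omega> s t" unfolding \<Omega>_def
      proof (rule mult_left_mono[OF add_mono])
        have "?e \<le> n"
        proof -
          have "?e \<le> pv p ?d s t powr (1 / p)" using incr_le_pv_root[OF fd] st exponents by simp
          also have "\<dots> \<le> n" unfolding n_def using st exponents dN pv_mono[OF fd, of s t]
            by (intro powr_mono2 pv_nonneg fv_subset[OF fd]) auto
          finally show ?thesis .
        qed
        \<comment> \<open>Since \<open>q \<ge> p\<close>, the surplus power \<open>q - p\<close> of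
          the increment is estimated by \<open>n\<close>, and the rest is controlled by the
          p-variation of the difference.\<close>
        have "?e powr q = ?e powr (q - p) * ?e powr p" by (simp add: powr_add[symmetric])
        also have "\<dots> \<le> n powr (q - p) * pv p ?d s t"
          using \<open>?e \<le> n\<close> q incr_le_pv[OF fd, of s t] st by (intro mult_mono powr_mono2) auto
        finally show "?e powr q \<le> n powr (q - p) * pv p ?d s t" .
        have "(?e1 + ?e2) powr p \<le> 2 powr p * (?e1 powr p + ?e2 powr p)" using exponents by (intro powr_add_le) auto
        also have "\<dots> \<le> 2 powr p * (pv p x s t + pv p x' s t)"
          using incr_le_pv[OF pathD(3)[OF x(1) order_refl v], of s t] incr_le_pv[OF pathD(3)[OF x(2) order_refl v], of s t] st
          by (intro mult_left_mono add_mono) auto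
        finally show "n powr q * (?e1 + ?e2) powr p \<le> n powr q * 2 powr p * (pv p x s t + pv p x' s t)"
          by (simp add: mult.assoc mult_left_mono)
      qed simp
      finally show ?thesis .
    qed
    have fX: "fv q ?X 0 v" and "pv q ?X 0 v \<le> \<Omega> 0 v" using pv_control[OF \<Omega> inc] v by auto
    note \<open>pv q ?X 0 v \<le> \<Omega> 0 v\<close>
    also have "\<Omega> 0 v \<le> (2 * M2) powr q * (n powr (q - p) * n powr p + n powr q * 2 powr p * (B + B))"
      unfolding \<Omega>_def using dN n(2) bd by (intro mult_left_mono add_mono) auto
    also have "n powr (q - p) * n powr p = n powr q" by (simp add: powr_add[symmetric])
    also have "(2 * M2) powr q * (n powr q + n powr q * 2 powr p * (B + B)) = (2 * M2) powr q * n powr q * (1 + 2 powr p * (B + B))"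
      by (simp add: algebra_simps)
    also have "\<dots> = (cH * n) powr q"
      using q B by (simp add: cH_def powr_mult powr_powr mult_ac)
    finally have pX: "pv q ?X 0 v \<le> (cH * n) powr q" .
    have llX: "left_lim ?X r = g (left_lim x r) - g (left_lim x' r)" if "u \<le> r" "r \<le> v" for r
      using left_lim_diff[OF cadlag_g[OF x(1)] cadlag_g[OF x(2)], of r] left_lim_g[OF x(1), of r] left_lim_g[OF x(2), of r] that uv by simp
    have "has_rs_integral (\<lambda>M v. M *v v) (left_lim ?X) z u v (Iz x u v - Iz x' u v)"
      by (rule iffD2[OF has_rs_integral_cong[OF llX] has_rs_integral_diff[OF bounded_bilinear_matrix_vector Iz_has(1)[OF x(1) uv] Iz_has(1)[OF x(2) uv]]])
    then have eqI: "rsi (\<lambda>M v. M *v v) (left_lim ?X) z u v = Iz x u v - Iz x' u v" by (rule rsi_eqI)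
    have qy: "1 < 1 / p + 1 / q" using exponents by (simp add: q_def)
    have "norm (Iz x u v - Iz x' u v) \<le> 1 * (norm (?X 0) + (1 + yc) * (cH * n)) * pv p z u v powr (1 / p)"
      unfolding eqI[symmetric] yc_def
      using cH n by (intro rsi_young_bound[OF bounded_bilinear_matrix_vector _ norm_matrix_vector_le p1 q(1) qy cX fX pX _ z(1) z(2)[OF v] uv]) auto
    then have Iz: "norm (Iz x u v - Iz x' u v) \<le> ((1 + yc) * cH) * n * pv p z u v powr (1 / p)"
      using pathD(2)[OF x(1)] pathD(2)[OF x(2)] by (simp add: mult.assoc)
    have nn: "0 \<le> pv 1 a u v" using pv_nonneg[OF fv_drivers(1)] uv by auto
    have I1: "norm (Ia x u v - Ia x' u v) \<le> D * n * pv 1 a u v"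
    proof -
      have "M1 * n * pv 1 a u v \<le> D * n * pv 1 a u v" using nn n yc cH by (intro mult_right_mono) (auto simp: D_def)
      then show ?thesis using Ia by simp
    qed
    have I2: "norm (Iz x u v - Iz x' u v) \<le> D * n * pv p z u v powr (1 / p)"
    proof -
      have "((1 + yc) * cH) * n * pv p z u v powr (1 / p) \<le> D * n * pv p z u v powr (1 / p)"
        using n M1 by (intro mult_right_mono) (auto simp: D_def)
      then show ?thesis using Iz by simp
    qed
    have "(Y x v - Y x' v) - (Y x u - Y x' u) = (Y x v - Y x u) - (Y x' v - Y x' u)" by simp
    also have "\<dots> = (Ia x u v - Ia x' u v) + (Iz x u v - Iz x' u v)" unfolding Y_incr[OF x(1) uv] Y_incr[OF x(2) uv] by simp
    finally have eq: "(Y x v - Y x' v) - (Y x u - Y x' u) = (Ia x u v - Ia x' u v) + (Iz x u v - Iz x' u v)" .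
    have "norm ((Y x v - Y x' v) - (Y x u - Y x' u)) powr p \<le> (2 * D * n) powr p * W u v"
      unfolding eq using D n I1 I2 uv by (intro young_drivers_combine) auto
    also have "(2 * D * n) powr p = (2 * D) powr p * N" unfolding n(2)[symmetric] by (simp only: powr_mult)
    finally show ?thesis .
  qed
  then show ?thesis by (intro exI[of _ "(2 * D) powr p"]) simp
qed

text \<open>The integrals agree up to \<open>u\<close>, so \<open>fv_pv_vanish\<close> reduces the
  variation of their difference on \<open>{0..v}\<close> to that on \<open>{u..v}\<close>. The
  comparison of the reflection terms has to start at time 0, because running maxima remember the
  past.\<close>

lemma contraction:
  assumes B: "0 \<le> B"
  shows "\<exists>c\<ge>0. \<forall>x x' u v N. path x \<longrightarrow> path x' \<longrightarrow> 0 \<le> u \<longrightarrow> u \<le> v \<longrightarrow> (\<forall>s. 0 \<le> s \<longrightarrow> s \<le> u \<longrightarrow> x s = x' s) \<longrightarrow>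
     pv p x 0 v \<le> B \<longrightarrow> pv p x' 0 v \<le> B \<longrightarrow> pv p (\<lambda>t. x t - x' t) 0 v \<le> N \<longrightarrow> 0 < N \<longrightarrow>
     pv p (\<lambda>t. \<Phi> x t - \<Phi> x' t) 0 v \<le> c * N * W u v"
proof -
  obtain c where c: "0 \<le> c" "\<And>x x' u v N. path x \<Longrightarrow> path x' \<Longrightarrow> 0 \<le> u \<Longrightarrow> u \<le> v \<Longrightarrow> pv p x 0 v \<le> B \<Longrightarrow> pv p x' 0 v \<le> B \<Longrightarrow>
     pv p (\<lambda>t. x t - x' t) 0 v \<le> N \<Longrightarrow> 0 < N \<Longrightarrow>
     norm ((Y x v - Y x' v) - (Y x u - Y x' u)) powr p \<le> c * N * W u v"
    using Y_diff_estimate[OF B] by blast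
  define k where "k = real CARD('d) powr p * real CARD('d)"
  have k: "0 \<le> k" by (simp add: k_def)
  have "pv p (\<lambda>t. \<Phi> x t - \<Phi> x' t) 0 v \<le> (2 powr p * (1 + k) * c) * N * W u v"
    if x: "path x" "path x'" and uv: "0 \<le> u" "u \<le> v" and eq: "\<forall>s. 0 \<le> s \<longrightarrow> s \<le> u \<longrightarrow> x s = x' s"
     and bd: "pv p x 0 v \<le> B" "pv p x' 0 v \<le> B" and dN: "pv p (\<lambda>t. x t - x' t) 0 v \<le> N" and N: "0 < N" for x x' u v N
  proof -
    have v: "0 \<le> v" using uv by simp
    let ?d = "\<lambda>t. Y x t - Y x' t"
    have fd: "fv p (\<lambda>t. x t - x' t) 0 v" using fv_pv_diff(1)[OF pathD(3)[OF x(1)] pathD(3)[OF x(2)]] v exponents by simp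
    have sup: "super_on u v (\<lambda>s t. c * N * W s t)"
      using c(1) N uv super_on_subset[OF super_on_W, of v u v] by (intro super_on_cmult) auto
    have inc: "norm (?d t - ?d s) powr p \<le> c * N * W s t" if "u \<le> s" "s < t" "t \<le> v" for s t
    proof (rule c(2)[OF x _ _ _ _ _ N])
      show "pv p x 0 t \<le> B" using bd pv_mono[OF pathD(3)[OF x(1)], of 0 v 0 t] that uv by auto
      show "pv p x' 0 t \<le> B" using bd pv_mono[OF pathD(3)[OF x(2)], of 0 v 0 t] that uv by auto
      show "pv p (\<lambda>t. x t - x' t) 0 t \<le> N" using dN pv_mono[OF fd, of 0 t] that uv by auto
    qed (use that uv in auto)
    have Yu: "fv p ?d u v" "pv p ?d u v \<le> c * N * W u v" using pv_control[OF sup inc] uv by auto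
    have zero: "?d r = 0" if "0 \<le> r" "r \<le> u" for r using causal(1)[OF x _ that] eq by simp
    have Y0: "fv p ?d 0 v" "pv p ?d 0 v \<le> c * N * W u v"
      using fv_pv_vanish[OF zero Yu(1) uv] Yu(2) by auto
    let ?u = "\<lambda>s. l s - Y x s" and ?u' = "\<lambda>s. l s - Y x' s"
    have ud: "(\<lambda>t. ?u t - ?u' t) = (\<lambda>t. - ?d t)" by auto
    have fu: "fv p (\<lambda>t. ?u t - ?u' t) 0 v" unfolding ud fv_pv_uminus by (rule Y0)
    have pu: "pv p (\<lambda>t. ?u t - ?u' t) 0 v \<le> c * N * W u v" unfolding ud fv_pv_uminus by (rule Y0)
    have u0: "?u 0 = ?u' 0" using Y_0 x by simp
    note kv = kmap_variation[OF cadlag_lY[OF x(1)] cadlag_lY[OF x(2)] lY_0[OF x(1)] u0 p1 v fu]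
    have "pv p (\<lambda>t. kmap ?u t - kmap ?u' t) 0 v \<le> real CARD('d) powr p * (real CARD('d) * (c * N * W u v))"
      by (rule order_trans[OF kv(2)]) (intro mult_left_mono pu; simp)
    then have kb: "pv p (\<lambda>t. kmap ?u t - kmap ?u' t) 0 v \<le> k * (c * N * W u v)" by (simp add: k_def mult.assoc)
    have "(\<lambda>t. \<Phi> x t - \<Phi> x' t) = (\<lambda>t. ?d t + (kmap ?u t - kmap ?u' t))" by (auto simp: \<Phi>_def)
    then have "pv p (\<lambda>t. \<Phi> x t - \<Phi> x' t) 0 v \<le> 2 powr p * (pv p ?d 0 v + pv p (\<lambda>t. kmap ?u t - kmap ?u' t) 0 v)"
      using fv_pv_add(2)[OF Y0(1) kv(1) v] exponents by simp
    also have "\<dots> \<le> 2 powr p * (c * N * W u v + k * (c * N * W u v))" using Y0(2) kb by (intro mult_left_mono add_mono) auto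
    also have "\<dots> = (2 powr p * (1 + k) * c) * N * W u v" by (simp add: algebra_simps)
    finally show ?thesis .
  qed
  then show ?thesis using c(1) k by (intro exI[of _ "2 powr p * (1 + k) * c"]) simp
qed

text \<open>A priori bound for a single path. The barrier contributes only its oscillation
  \<open>b\<close> on the interval.\<close>

lemma \<Phi>_variation:
  "\<exists>c\<ge>0. \<forall>x s v b. path x \<longrightarrow> 0 \<le> s \<longrightarrow> s \<le> v \<longrightarrow> (\<forall>r. s \<le> r \<longrightarrow> r \<le> v \<longrightarrow> norm (l r - l s) \<le> b) \<longrightarrow>
     pv p (\<Phi> x) s v \<le> c * (b powr p + (1 + pv p x 0 v) * W s v)"
proof -
  obtain c where c: "0 \<le> c" "\<And>x u v. path x \<Longrightarrow> 0 \<le> u \<Longrightarrow> u \<le> v \<Longrightarrow> pv p (Y x) u v \<le> c * (1 + pv p x 0 v) * W u v"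
    using Y_variation by blast
  define k where "k = real CARD('d) powr p * real CARD('d) * 2 powr p"
  have k: "0 \<le> k" by (simp add: k_def)
  have "pv p (\<Phi> x) s v \<le> (2 powr p * (1 + k) * (1 + c)) * (b powr p + (1 + pv p x 0 v) * W s v)"
    if x: "path x" and sv: "0 \<le> s" "s \<le> v" and b: "\<forall>r. s \<le> r \<longrightarrow> r \<le> v \<longrightarrow> norm (l r - l s) \<le> b" for x s v b
  proof -
    have b0: "0 \<le> b" using b[rule_format, of s] sv by simp
    define e where "e = pv p (Y x) s v"
    have e0: "0 \<le> e" using pv_nonneg[OF fv_Y[OF x sv] sv(2)] by (simp add: e_def)
    define E where "E = (1 + pv p x 0 v) * W s v"
    have E0: "0 \<le> E" using pv_nonneg[OF pathD(3)[OF x]] W_nonneg[OF sv] sv by (auto simp: E_def)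
    have eE: "e \<le> c * E" using c(2)[OF x sv] by (simp add: e_def E_def mult.assoc)
    let ?u = "\<lambda>s. l s - Y x s"
    have "norm (?u r - ?u s) \<le> b + e powr (1 / p)" if r: "s \<le> r" "r \<le> v" for r
    proof -
      have "norm (Y x r - Y x s) \<le> pv p (Y x) s r powr (1 / p)"
        using incr_le_pv_root[OF fv_Y[OF x sv]] r exponents by simp
      also have "\<dots> \<le> e powr (1 / p)" unfolding e_def using r sv exponents
        by (intro powr_mono2 pv_nonneg pv_mono[OF fv_Y[OF x sv]] fv_Y[OF x]) auto
      finally have "norm (Y x r - Y x s) \<le> e powr (1 / p)" .
      moreover have eq: "?u r - ?u s = (l r - l s) - (Y x r - Y x s)" by simp
      ultimately show ?thesis unfolding eq using b[rule_format, OF r] norm_triangle_ineq4[of "l r - l s" "Y x r - Y x s"] by linarith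
    qed
    then have "pv p (kmap ?u) s v \<le> real CARD('d) powr p * (real CARD('d) * (b + e powr (1 / p)) powr p)"
      by (rule kmap_osc(2)[OF cadlag_lY[OF x] sv p1])
    also have "\<dots> \<le> real CARD('d) powr p * (real CARD('d) * (2 powr p * (b powr p + (e powr (1 / p)) powr p)))"
      using b0 exponents by (intro mult_left_mono powr_add_le) auto
    also have "\<dots> = k * (b powr p + e)" using e0 exponents by (simp add: k_def powr_powr mult_ac)
    finally have kb: "pv p (kmap ?u) s v \<le> k * (b powr p + e)" .
    have "pv p (\<Phi> x) s v \<le> 2 powr p * (pv p (Y x) s v + pv p (kmap ?u) s v)"
      using fv_pv_add(2)[OF fv_Y[OF x sv] fv_kmap[OF x sv] sv(2)] exponents by (simp add: \<Phi>_def[abs_def])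
    also have "\<dots> \<le> 2 powr p * ((b powr p + e) + k * (b powr p + e))"
      using kb by (intro mult_left_mono add_mono) (auto simp: e_def)
    also have "\<dots> = 2 powr p * (1 + k) * (b powr p + e)" by (simp add: algebra_simps)
    also have "\<dots> \<le> 2 powr p * (1 + k) * ((1 + c) * (b powr p + E))"
    proof (rule mult_left_mono)
      have "(1 + c) * (b powr p + E) = b powr p + c * E + (c * b powr p + E)" by (simp add: algebra_simps)
      moreover have "0 \<le> c * b powr p" using c(1) by simp
      ultimately show "b powr p + e \<le> (1 + c) * (b powr p + E)" using eE E0 by linarith
    qed (use k in simp)
    finally show ?thesis by (simp add: E_def mult.assoc)
  qed
  then show ?thesis using c(1) k by (intro exI[of _ "2 powr p * (1 + k) * (1 + c)"]) simp
qed

end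

text \<open>At the infimum of the failures \<open>closed\<close> yields \<open>P\<close>, and then
  \<open>right\<close> keeps all failures a positive distance away from it.\<close>

lemma real_induct_nonneg:
  fixes P :: "real \<Rightarrow> bool"
  assumes closed: "\<And>t. 0 \<le> t \<Longrightarrow> (\<And>s. 0 \<le> s \<Longrightarrow> s < t \<Longrightarrow> P s) \<Longrightarrow> P t"
    and right: "\<And>t. 0 \<le> t \<Longrightarrow> (\<And>s. 0 \<le> s \<Longrightarrow> s \<le> t \<Longrightarrow> P s) \<Longrightarrow> \<exists>d>0. \<forall>s. t \<le> s \<longrightarrow> s \<le> t + d \<longrightarrow> P s"
    and "0 \<le> T"
  shows "P T"
proof (rule ccontr)
  assume "\<not> P T"
  define A where "A = {t. 0 \<le> t \<and> \<not> P t}"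
  have A: "A \<noteq> {}" "bdd_below A" using \<open>\<not> P T\<close> \<open>0 \<le> T\<close> by (auto simp: A_def intro: bdd_belowI[of _ 0])
  define \<tau> where "\<tau> = Inf A"
  have \<tau>: "0 \<le> \<tau>" unfolding \<tau>_def by (rule cInf_greatest[OF A(1)]) (simp add: A_def)
  have below: "P s" if "0 \<le> s" "s < \<tau>" for s
    using cInf_lower[OF _ A(2), of s] that unfolding \<tau>_def A_def by force
  have P\<tau>: "P \<tau>" by (rule closed[OF \<tau> below])
  have upto: "P s" if "0 \<le> s" "s \<le> \<tau>" for s using below[of s] P\<tau> that by (cases "s = \<tau>") auto
  obtain d where d: "0 < d" "\<And>s. \<tau> \<le> s \<Longrightarrow> s \<le> \<tau> + d \<Longrightarrow> P s" using right[OF \<tau> upto] by blast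
  have "\<tau> + d \<le> Inf A"
  proof (rule cInf_greatest[OF A(1)])
    fix s assume s: "s \<in> A"
    show "\<tau> + d \<le> s"
    proof (rule ccontr)
      assume "\<not> \<tau> + d \<le> s"
      then have "P s" using upto[of s] d(2)[of s] s by (cases "s \<le> \<tau>") (auto simp: A_def)
      then show False using s by (simp add: A_def)
    qed
  qed
  then show False using d(1) by (simp add: \<tau>_def)
qed

context reflected_equation
begin

definition fixed :: "(real \<Rightarrow> real^'d) \<Rightarrow> real \<Rightarrow> bool" where
  "fixed x T \<longleftrightarrow> (\<forall>t. 0 \<le> t \<longrightarrow> t \<le> T \<longrightarrow> \<Phi> x t = x t)"

text \<open>The step to the limit is causality. In the step to the right the variation
  \<open>N\<close> of the difference satisfies \<open>N \<le> N / 2\<close> and therefore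
  vanishes.\<close>

lemma fixed_unique:
  assumes x: "path x" "path x'" and fx: "fixed x T" "fixed x' T" and t: "0 \<le> t" "t \<le> T"
  shows "x t = x' t"
proof -
  have "t \<le> T \<longrightarrow> x t = x' t"
  proof (rule real_induct_nonneg[of "\<lambda>t. t \<le> T \<longrightarrow> x t = x' t", OF _ _ t(1)])
    fix t :: real assume t: "0 \<le> t" and IH: "\<And>s. 0 \<le> s \<Longrightarrow> s < t \<Longrightarrow> s \<le> T \<longrightarrow> x s = x' s"
    show "t \<le> T \<longrightarrow> x t = x' t"
    proof
      assume "t \<le> T"
      then have "\<Phi> x t = \<Phi> x' t" using IH by (intro causal(2)[OF x _ t order_refl]) auto
      then show "x t = x' t" using fx t \<open>t \<le> T\<close> by (simp add: fixed_def)
    qed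
  next
    fix t :: real assume t: "0 \<le> t" and IH: "\<And>s. 0 \<le> s \<Longrightarrow> s \<le> t \<Longrightarrow> s \<le> T \<longrightarrow> x s = x' s"
    show "\<exists>d>0. \<forall>s. t \<le> s \<longrightarrow> s \<le> t + d \<longrightarrow> s \<le> T \<longrightarrow> x s = x' s"
    proof (cases "t < T")
      case False
      then have "x s = x' s" if "t \<le> s" "s \<le> T" for s using that IH[of s] t by simp
      then show ?thesis by (intro exI[of _ 1]) simp
    next
      case True
      define B where "B = max (pv p x 0 (t + 1)) (pv p x' 0 (t + 1))"
      have B: "0 \<le> B" using pv_nonneg[OF pathD(3)[OF x(1)], of 0 "t + 1"] t by (simp add: B_def)
      obtain c where c: "0 \<le> c" "\<And>x x' u v N. path x \<Longrightarrow> path x' \<Longrightarrow> 0 \<le> u \<Longrightarrow> u \<le> v \<Longrightarrow> (\<forall>s. 0 \<le> s \<longrightarrow> s \<le> u \<longrightarrow> x s = x' s) \<Longrightarrow>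
         pv p x 0 v \<le> B \<Longrightarrow> pv p x' 0 v \<le> B \<Longrightarrow> pv p (\<lambda>t. x t - x' t) 0 v \<le> N \<Longrightarrow> 0 < N \<Longrightarrow>
         pv p (\<lambda>t. \<Phi> x t - \<Phi> x' t) 0 v \<le> c * N * W u v"
        using contraction[OF B] by blast
      \<comment> \<open>Gives \<open>c * W t v \<le> 1 / 2\<close>, with \<open>c + 1\<close>
        positive also for \<open>c = 0\<close>.\<close>
      obtain d where d: "0 < d" "d \<le> 1" "W t (t + d) \<le> 1 / (2 * (c + 1))"
        using W_right_small[OF t, of "1 / (2 * (c + 1))"] c(1) by auto
      define v where "v = min (t + d) T"
      have v: "t \<le> v" "v \<le> t + d" "v \<le> T" "v \<le> t + 1" "0 \<le> v" using True d t by (auto simp: v_def)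
      let ?d = "\<lambda>t. x t - x' t"
      have fd: "fv p ?d 0 v" using fv_pv_diff(1)[OF pathD(3)[OF x(1)] pathD(3)[OF x(2)]] v exponents by simp
      define N where "N = pv p ?d 0 v"
      have "N = 0"
      proof (rule ccontr)
        assume "N \<noteq> 0"
        then have N: "0 < N" using pv_nonneg[OF fd v(5)] by (simp add: N_def)
        have "N = pv p (\<lambda>t. \<Phi> x t - \<Phi> x' t) 0 v"
          unfolding N_def using fx v by (intro fv_pv_cong(2)) (simp add: fixed_def)
        also have "\<dots> \<le> c * N * W t v"
        proof (rule c(2)[OF x t v(1) _ _ _ _ N])
          show "\<forall>s. 0 \<le> s \<longrightarrow> s \<le> t \<longrightarrow> x s = x' s" using IH True by auto
          show "pv p x 0 v \<le> B" "pv p x' 0 v \<le> B" unfolding B_def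
            using pv_mono[OF pathD(3)[OF x(1)], of 0 "t + 1" 0 v] pv_mono[OF pathD(3)[OF x(2)], of 0 "t + 1" 0 v] v t by auto
        qed (simp add: N_def)
        also have "\<dots> \<le> c * N * (1 / (2 * (c + 1)))"
          using W_mono[of t t v "t + d"] d v t c(1) N by (intro mult_left_mono) auto
        also have "\<dots> = N * (c / (c + 1)) / 2"
        proof -
          have "c * N * (1 / (2 * k)) = N * (c / k) / 2" for k :: real by (simp add: mult.commute)
          then show ?thesis .
        qed
        also have "\<dots> \<le> N * 1 / 2" using N c(1) by (intro divide_right_mono mult_left_mono) auto
        finally show False using N by simp
      qed
      have "x s = x' s" if s: "t \<le> s" "s \<le> t + d" "s \<le> T" for s
      proof -
        have sv: "0 \<le> s" "s \<le> v" using s t by (auto simp: v_def)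
        have "norm (?d s - ?d 0) powr p \<le> pv p ?d 0 s" using incr_le_pv[OF fd] sv by simp
        also have "\<dots> \<le> 0" using pv_mono[OF fd, of 0 s] sv \<open>N = 0\<close> by (simp add: N_def)
        finally have "norm (?d s - ?d 0) powr p = 0" by (intro antisym) auto
        then show ?thesis using pathD(2)[OF x(1)] pathD(2)[OF x(2)] by simp
      qed
      then show ?thesis using d by blast
    qed
  qed
  then show ?thesis using t by simp
qed

end

section \<open>Existence\<close>

context reflected_equation
begin

text \<open>Freezing after \<open>V\<close> and before 0 turns information on \<open>{0..V}\<close>
  into information at all times, as needed for membership in \<open>path\<close> and for uniform
  convergence.\<close>

definition stop :: "real \<Rightarrow> (real \<Rightarrow> real^'d) \<Rightarrow> real \<Rightarrow> real^'d" where
  "stop V x t = x (max 0 (min t V))"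

lemma stop_eq: "0 \<le> t \<Longrightarrow> t \<le> V \<Longrightarrow> stop V x t = x t"
  by (simp add: stop_def)

lemma fv_pv_stop:
  assumes "fv p x 0 V" "0 \<le> V" "0 \<le> T"
  shows "fv p (stop V x) 0 T" "pv p (stop V x) 0 T \<le> pv p x 0 V"
proof -
  have m: "fv p (\<lambda>t. x (max 0 (min t V))) 0 T" "pv p (\<lambda>t. x (max 0 (min t V))) 0 T \<le> pv p x (max 0 (min 0 V)) (max 0 (min T V))"
    using fv_pv_compose_mono[OF assms(1), of 0 T "\<lambda>t. max 0 (min t V)"] assms by auto
  have "pv p x (max 0 (min 0 V)) (max 0 (min T V)) \<le> pv p x 0 V" using assms by (intro pv_mono[OF assms(1)]) auto
  then show "fv p (stop V x) 0 T" "pv p (stop V x) 0 T \<le> pv p x 0 V" using m by (auto simp: stop_def[abs_def])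
qed

lemma path_stop:
  assumes x: "path x" and V: "0 \<le> V"
  shows "path (stop V x)"
proof -
  have f: "fv p (stop V x) 0 T" if "0 \<le> T" for T using fv_pv_stop(1)[OF pathD(3)[OF x order_refl V] V that] .
  have "cadlag (stop V x)"
  proof (rule cadlag_of_fv[OF _ f exponents(3)])
    fix t :: real assume t: "0 \<le> t"
    show "(stop V x \<longlongrightarrow> stop V x t) (at_right t)"
    proof (cases "t < V")
      case True
      have "eventually (\<lambda>s. x s = stop V x s) (at_right t)"
        using eventually_at_right_real[OF True] t by (auto elim!: eventually_mono simp: stop_eq)
      moreover have "(x \<longlongrightarrow> stop V x t) (at_right t)" using cadlag_right[OF pathD(1)[OF x] t] True t by (simp add: stop_eq)
      ultimately show ?thesis by (rule Lim_transform_eventually[rotated])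
    next
      case False
      have "eventually (\<lambda>s. stop V x s = stop V x t) (at_right t)"
        using eventually_at_right_less[of t] False by (auto elim!: eventually_mono simp: stop_def min_def)
      then show ?thesis by (rule tendsto_eventually)
    qed
  qed
  moreover have "stop V x 0 = x0" using pathD(2)[OF x] V by (simp add: stop_eq)
  ultimately show ?thesis using f by (simp add: path_def)
qed

text \<open>Uniform convergence preserves right continuity but not finiteness of the variation,
  which is therefore a separate hypothesis.\<close>

lemma path_uniform_limit:
  assumes X: "\<And>n. path (X n)" and lim: "\<And>n t. norm (X n t - x t) \<le> r n" and r: "r \<longlonglongrightarrow> 0"
    and f: "\<And>T. 0 \<le> T \<Longrightarrow> fv p x 0 T"
  shows "path x"
proof -
  have "cadlag x"
  proof (rule cadlag_of_fv[OF _ f exponents(3)])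
    fix t :: real assume t: "0 \<le> t"
    show "(x \<longlongrightarrow> x t) (at_right t)"
    proof (rule tendstoI)
      fix e :: real assume e: "0 < e"
      then have "eventually (\<lambda>n. r n < e / 3) sequentially" using order_tendstoD(2)[OF r, of "e / 3"] by simp
      then obtain n where n: "r n < e / 3" by (auto dest: eventually_happens)
      have "eventually (\<lambda>s. dist (X n s) (X n t) < e / 3) (at_right t)"
        using tendstoD[OF cadlag_right[OF pathD(1)[OF X] t], of "e / 3" n] e by simp
      then show "eventually (\<lambda>s. dist (x s) (x t) < e) (at_right t)"
      proof eventually_elim
        case (elim s)
        have eq: "x s - x t = (X n s - X n t) - (X n s - x s) + (X n t - x t)" by simp
        have "norm (x s - x t) \<le> norm (X n s - X n t) + norm (X n s - x s) + norm (X n t - x t)"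
          unfolding eq by (intro norm_triangle_le add_right_mono norm_triangle_ineq4)
        then show ?case using elim n lim[of n s] lim[of n t] unfolding dist_norm by linarith
      qed
    qed
  qed
  moreover have "x 0 = x0"
  proof -
    have "norm (x0 - x 0) \<le> r n" for n using lim[of n 0] pathD(2)[OF X] by simp
    then have "norm (x0 - x 0) \<le> 0" by (intro LIMSEQ_le_const[OF r]) auto
    then show ?thesis by simp
  qed
  ultimately show ?thesis using f by (simp add: path_def)
qed

text \<open>Picard iteration in the set \<open>S\<close> of paths that continue \<open>xb\<close>,
  have variation at most \<open>B\<close> up to \<open>V\<close>, and are frozen outside
  \<open>{0..V}\<close>.\<close>

lemma extend_right:
  assumes x: "path xb" and U: "0 \<le> U" and fx: "fixed xb U"
  shows "\<exists>d>0. \<exists>x. path x \<and> fixed x (U + d)"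
proof -
  \<comment> \<open>Allows variation 1 on the new piece and includes the factor that
    \<open>fv_pv_concat\<close> costs.\<close>
  define B where "B = 2 powr p * (pv p xb 0 U + 1)"
  have pU: "0 \<le> pv p xb 0 U" using pv_nonneg[OF pathD(3)[OF x order_refl U] U] .
  have B: "0 \<le> B" "pv p xb 0 U \<le> B"
  proof -
    have "1 * (pv p xb 0 U + 1) \<le> 2 powr p * (pv p xb 0 U + 1)"
      using pU exponents by (intro mult_right_mono) (auto simp: ge_one_powr_ge_zero)
    then have "pv p xb 0 U + 1 \<le> B" by (simp only: B_def mult_1)
    then show "0 \<le> B" "pv p xb 0 U \<le> B" using pU by linarith+
  qed
  obtain c1 where c1: "0 \<le> c1" "\<And>x s v b. path x \<Longrightarrow> 0 \<le> s \<Longrightarrow> s \<le> v \<Longrightarrow> (\<And>r. s \<le> r \<Longrightarrow> r \<le> v \<Longrightarrow> norm (l r - l s) \<le> b) \<Longrightarrow>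
     pv p (\<Phi> x) s v \<le> c1 * (b powr p + (1 + pv p x 0 v) * W s v)"
    using \<Phi>_variation by blast
  obtain c2 where c2: "0 \<le> c2" "\<And>x x' u v N. path x \<Longrightarrow> path x' \<Longrightarrow> 0 \<le> u \<Longrightarrow> u \<le> v \<Longrightarrow> (\<And>s. 0 \<le> s \<Longrightarrow> s \<le> u \<Longrightarrow> x s = x' s) \<Longrightarrow>
         pv p x 0 v \<le> B \<Longrightarrow> pv p x' 0 v \<le> B \<Longrightarrow> pv p (\<lambda>t. x t - x' t) 0 v \<le> N \<Longrightarrow> 0 < N \<Longrightarrow>
         pv p (\<lambda>t. \<Phi> x t - \<Phi> x' t) 0 v \<le> c2 * N * W u v"
    using contraction[OF B(1)] by blast
  \<comment> \<open>In the growth estimate for the new piece, \<open>b\<close> and the first bound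
    in \<open>\<eta>\<close> each account for at most one half of the allowed variation 1. The
    second bound in \<open>\<eta>\<close> makes the contraction factor \<open>1 / 2\<close>.\<close>
  define b where "b = (1 / (2 * (c1 + 1))) powr (1 / p)"
  have b: "0 < b" "b powr p = 1 / (2 * (c1 + 1))" using c1(1) exponents by (auto simp: b_def powr_powr)
  define \<eta> where "\<eta> = min (1 / (2 * (c1 + 1) * (1 + B))) (1 / (2 * (c2 + 1)))"
  have \<eta>: "0 < \<eta>" using c1(1) c2(1) B(1) by (simp add: \<eta>_def)
  obtain d1 where d1: "0 < d1" "d1 \<le> 1" "W U (U + d1) \<le> \<eta>" using W_right_small[OF U \<eta>] by blast
  have ev: "eventually (\<lambda>r. dist (l r) (l U) < b) (at_right U)" using cadlag_right[OF l(1) U] b(1) by (simp add: tendsto_iff)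
  obtain e where e: "U < e" "\<And>r. U < r \<Longrightarrow> r < e \<Longrightarrow> dist (l r) (l U) < b" by (rule eventually_at_rightE[OF ev]) blast
  define d where "d = min d1 ((e - U) / 2)"
  have d: "0 < d" "d \<le> d1" "U + d < e" using d1 e by (auto simp: d_def min_def field_simps)
  define V where "V = U + d"
  have V: "0 \<le> V" "U \<le> V" "U \<le> U + d1" "V \<le> U + d1" using U d by (auto simp: V_def)
  have lb: "norm (l r - l U) \<le> b" if "U \<le> r" "r \<le> V" for r
    using that e(2)[of r] d b(1) by (cases "r = U") (auto simp: V_def dist_norm)
  have WV: "W U V \<le> \<eta>" using W_mono[OF U order_refl V(2,4)] d1(3) by simp
  define S where "S x \<longleftrightarrow> path x \<and> (\<forall>t. 0 \<le> t \<longrightarrow> t \<le> U \<longrightarrow> x t = xb t) \<and> pv p x 0 V \<le> B \<and> (\<forall>t. x t = stop V x t)" for x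
  have SP: "path x" and SB: "pv p x 0 V \<le> B" and SU: "\<And>t. 0 \<le> t \<Longrightarrow> t \<le> U \<Longrightarrow> x t = xb t" if "S x" for x
    using that unfolding S_def by blast+
  have S0: "S (stop U xb)"
    unfolding S_def
  proof (intro conjI allI impI)
    show "path (stop U xb)" by (rule path_stop[OF x U])
    show "stop U xb t = xb t" if "0 \<le> t" "t \<le> U" for t using stop_eq that .
    show "pv p (stop U xb) 0 V \<le> B" using fv_pv_stop(2)[OF pathD(3)[OF x order_refl U] U V(1)] B(2) by simp
    show "stop U xb t = stop V (stop U xb) t" for t using U V by (simp add: stop_def min_def max_def)
  qed
  have S\<Phi>: "S (stop V (\<Phi> x))" if Sx: "S x" for x
    unfolding S_def
  proof (intro conjI allI impI)
    have px: "path x" and eq: "\<And>t. 0 \<le> t \<Longrightarrow> t \<le> U \<Longrightarrow> x t = xb t" and pB: "pv p x 0 V \<le> B" using Sx unfolding S_def by auto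
    note p\<Phi> = path_\<Phi>[OF px]
    show "path (stop V (\<Phi> x))" by (rule path_stop[OF p\<Phi> V(1)])
    have \<Phi>eq: "\<Phi> x t = xb t" if "0 \<le> t" "t \<le> U" for t
      using causal(2)[OF px \<open>path xb\<close> _ that] eq fx that by (simp add: fixed_def)
    show "stop V (\<Phi> x) t = xb t" if "0 \<le> t" "t \<le> U" for t using stop_eq[of t V] \<Phi>eq[OF that] that V by simp
    show "stop V (\<Phi> x) t = stop V (stop V (\<Phi> x)) t" for t using V by (simp add: stop_def)
    have "pv p (\<Phi> x) U V \<le> c1 * (b powr p + (1 + pv p x 0 V) * W U V)" by (rule c1(2)[OF px U V(2) lb])
    also have "\<dots> \<le> c1 * (1 / (2 * (c1 + 1)) + (1 + B) * (1 / (2 * (c1 + 1) * (1 + B))))"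
      unfolding b(2) using c1(1) pB WV B(1) W_nonneg[OF U V(2)]
      by (intro mult_left_mono add_left_mono mult_mono) (auto simp: \<eta>_def)
    also have "(1 + B) * (1 / (2 * (c1 + 1) * (1 + B))) = 1 / (2 * (c1 + 1))"
    proof -
      have "h * (1 / (k * h)) = 1 / k" if "0 < h" for k h :: real using that by simp
      from this[of "1 + B"] show ?thesis using B(1) by simp
    qed
    also have "c1 * (1 / (2 * (c1 + 1)) + 1 / (2 * (c1 + 1))) = c1 / (c1 + 1)"
    proof -
      have "c1 * (1 / (2 * k) + 1 / (2 * k)) = c1 / k" for k :: real by simp
      then show ?thesis .
    qed
    also have "\<dots> \<le> 1" using c1(1) by simp
    finally have UV: "pv p (\<Phi> x) U V \<le> 1" .
    have "pv p (stop V (\<Phi> x)) 0 V = pv p (\<Phi> x) 0 V" by (rule fv_pv_cong(2)) (simp add: stop_eq)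
    also have "\<dots> \<le> 2 powr p * (pv p (\<Phi> x) 0 U + pv p (\<Phi> x) U V)"
      using U V exponents by (intro fv_pv_concat(2) pathD(3)[OF p\<Phi>]) auto
    also have "pv p (\<Phi> x) 0 U = pv p xb 0 U" by (rule fv_pv_cong(2)) (simp add: \<Phi>eq)
    also have "2 powr p * (pv p xb 0 U + pv p (\<Phi> x) U V) \<le> B" unfolding B_def using UV by (intro mult_left_mono) auto
    finally show "pv p (stop V (\<Phi> x)) 0 V \<le> B" .
  qed
  have contr: "pv p (\<lambda>t. stop V (\<Phi> x) t - stop V (\<Phi> x') t) 0 V \<le> N / 2"
    if "S x" "S x'" "pv p (\<lambda>t. x t - x' t) 0 V \<le> N" "0 < N" for x x' N
  proof -
    have "pv p (\<lambda>t. stop V (\<Phi> x) t - stop V (\<Phi> x') t) 0 V = pv p (\<lambda>t. \<Phi> x t - \<Phi> x' t) 0 V"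
      by (rule fv_pv_cong(2)) (simp add: stop_eq)
    also have "\<dots> \<le> c2 * N * W U V" using that SU[OF that(1)] SU[OF that(2)] by (intro c2(2) U V SP SB) auto
    also have "\<dots> \<le> c2 * N * (1 / (2 * (c2 + 1)))" using WV c2(1) that by (intro mult_left_mono) (auto simp: \<eta>_def)
    also have "\<dots> = N * (c2 / (c2 + 1)) / 2"
    proof -
      have "c2 * N * (1 / (2 * k)) = N * (c2 / k) / 2" for k :: real by (simp add: mult.commute)
      then show ?thesis .
    qed
    also have "\<dots> \<le> N * 1 / 2" using that c2(1) by (intro divide_right_mono mult_left_mono) auto
    finally show ?thesis by simp
  qed
  \<comment> \<open>Bounds the distance of any two elements of \<open>S\<close>; the summand 1 makes
    it positive, as \<open>contr\<close> requires.\<close>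
  define D where "D = 2 powr p * (B + B) + 1"
  have D: "0 < D" using B(1) by (simp add: D_def add_nonneg_pos)
  have fS: "fv p (\<lambda>t. x t - x' t) 0 V" if "S x" "S x'" for x x'
  proof -
    have "path x" "path x'" using that unfolding S_def by blast+
    then show ?thesis using V exponents by (intro fv_pv_diff(1) pathD(3)) auto
  qed
  have SD: "pv p (\<lambda>t. x t - x' t) 0 V \<le> D" if "S x" "S x'" for x x'
  proof -
    have S: "path x" "path x'" "pv p x 0 V \<le> B" "pv p x' 0 V \<le> B" using that unfolding S_def by blast+
    then have "pv p (\<lambda>t. x t - x' t) 0 V \<le> 2 powr p * (pv p x 0 V + pv p x' 0 V)"
      using V exponents by (intro fv_pv_diff(2) pathD(3)) auto
    also have "\<dots> \<le> 2 powr p * (B + B)" using S by (intro mult_left_mono add_mono) auto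
    finally show ?thesis by (simp add: D_def)
  qed
  define X where "X n = ((\<lambda>x. stop V (\<Phi> x)) ^^ n) (stop U xb)" for n
  have X0: "X 0 = stop U xb" and XS: "X (Suc n) = stop V (\<Phi> (X n))" for n by (simp_all add: X_def)
  have SX: "S (X n)" for n by (induction n) (simp_all add: X0 XS S0 S\<Phi>)
  have diffX: "pv p (\<lambda>t. X (n + m) t - X n t) 0 V \<le> D * (1 / 2) ^ n" for n m
  proof (induction n)
    case 0
    then show ?case using SD[OF SX SX] by simp
  next
    case (Suc n)
    have "pv p (\<lambda>t. stop V (\<Phi> (X (n + m))) t - stop V (\<Phi> (X n)) t) 0 V \<le> D * (1 / 2) ^ n / 2"
      using D by (intro contr SX Suc) simp
    then show ?case by (simp add: XS)
  qed
  \<comment> \<open>The geometric decay concerns p-th powers of increments. The root turns it into a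
    uniform distance, since all iterates start at \<open>x0\<close>.\<close>
  define r where "r n = (D * (1 / 2) ^ n) powr (1 / p)" for n :: nat
  have r0: "r \<longlonglongrightarrow> 0"
  proof -
    have "(\<lambda>n. D * (1 / 2) ^ n) \<longlonglongrightarrow> D * 0" by (intro tendsto_mult tendsto_const LIMSEQ_power_zero) simp
    then have "(\<lambda>n. (D * (1 / 2) ^ n) powr (1 / p)) \<longlonglongrightarrow> (D * 0) powr (1 / p)"
      by (rule tendsto_powr'[OF _ tendsto_const]) (use D exponents in auto)
    then show ?thesis by (simp add: r_def[abs_def])
  qed
  have sup_bd: "norm (x t - x' t) \<le> N powr (1 / p)"
    if "path x" "path x'" "fv p (\<lambda>t. x t - x' t) 0 V" "pv p (\<lambda>t. x t - x' t) 0 V \<le> N" "0 \<le> t" "t \<le> V" for x x' N t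
  proof -
    have "norm ((x t - x' t) - (x 0 - x' 0)) \<le> pv p (\<lambda>t. x t - x' t) 0 t powr (1 / p)"
      using incr_le_pv_root[OF that(3), of 0 t] that exponents by simp
    also have "\<dots> \<le> N powr (1 / p)" using that exponents pv_mono[OF that(3), of 0 t]
      by (intro powr_mono2 pv_nonneg fv_subset[OF that(3)]) auto
    finally show ?thesis using pathD(2)[OF that(1)] pathD(2)[OF that(2)] by simp
  qed
  have Xstop: "X n t = X n (max 0 (min t V))" for n t using SX[of n] unfolding S_def stop_def by blast
  have unif: "norm (X (n + m) t - X n t) \<le> r n" for n m t
  proof -
    have "norm (X (n + m) (max 0 (min t V)) - X n (max 0 (min t V))) \<le> (D * (1 / 2) ^ n) powr (1 / p)"
      by (rule sup_bd[OF SP[OF SX] SP[OF SX] fS[OF SX SX] diffX]) (use V in auto)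
    then show ?thesis using Xstop[of "n + m" t] Xstop[of n t] by (simp add: r_def)
  qed
  have "Cauchy (\<lambda>n. X n t)" for t
  proof (rule CauchyI)
    fix e :: real assume "0 < e"
    then have "eventually (\<lambda>n. r n < e / 2) sequentially" using order_tendstoD(2)[OF r0, of "e / 2"] by simp
    then obtain n where n: "r n < e / 2" by (auto dest: eventually_happens)
    have "norm (X i t - X j t) < e" if "n \<le> i" "n \<le> j" for i j
    proof -
      have "norm (X i t - X n t) \<le> r n" "norm (X j t - X n t) \<le> r n"
        using unif[of n "i - n" t] unif[of n "j - n" t] that by auto
      then show ?thesis using n norm_triangle_ineq4[of "X i t - X n t" "X j t - X n t"] by simp
    qed
    then show "\<exists>M. \<forall>i\<ge>M. \<forall>j\<ge>M. norm (X i t - X j t) < e" by blast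
  qed
  then have "\<forall>t. \<exists>L. (\<lambda>n. X n t) \<longlonglongrightarrow> L" using Cauchy_convergent convergent_def by blast
  then obtain y where y: "\<And>t. (\<lambda>n. X n t) \<longlonglongrightarrow> y t" by metis
  have shift: "(\<lambda>m. X (n + m) t) \<longlonglongrightarrow> y t" for n t
    using LIMSEQ_ignore_initial_segment[OF y[of t], of n] by (simp add: add.commute)
  have Xy: "norm (X n t - y t) \<le> r n" for n t
  proof -
    have "(\<lambda>m. norm (X n t - X (n + m) t)) \<longlonglongrightarrow> norm (X n t - y t)" by (intro tendsto_intros shift)
    then show ?thesis by (rule LIMSEQ_le_const2) (use unif[of n _ t] in \<open>auto simp: norm_minus_commute\<close>)
  qed
  have fpX: "fv p (X n) 0 V \<and> pv p (X n) 0 V \<le> B" for n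
    using SX[of n] pathD(3)[of "X n" 0 V] V unfolding S_def by auto
  have yV: "fv p y 0 V" "pv p y 0 V \<le> B"
    using fv_pv_tendsto[where X=X and F=sequentially and x=y and B=B and p=p and s=0 and t=V, OF y] fpX V exponents by auto
  have ystop: "y t = stop V y t" for t
    using LIMSEQ_unique[OF y[of t]] y[of "max 0 (min t V)"] Xstop[of _ t] by (simp add: stop_def)
  have fy: "fv p y 0 T" if "0 \<le> T" for T
  proof -
    have "y = stop V y" using ystop by (intro ext)
    then show ?thesis using fv_pv_stop(1)[OF yV(1) V(1) that] by simp
  qed
  have py: "path y" by (rule path_uniform_limit[OF SP[OF SX] Xy r0 fy])
  have Sy: "S y"
    unfolding S_def
  proof (intro conjI allI impI py ystop yV)
    fix t assume t: "0 \<le> t" "t \<le> U"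
    then have "X n t = xb t" for n by (rule SU[OF SX])
    then have "(\<lambda>n. X n t) \<longlonglongrightarrow> xb t" by simp
    then show "y t = xb t" by (rule LIMSEQ_unique[OF y[of t]])
  qed
  have yX: "pv p (\<lambda>t. y t - X n t) 0 V \<le> D * (1 / 2) ^ n" for n
  proof (rule fv_pv_tendsto(2)[where F=sequentially and X="\<lambda>m t. X (n + m) t - X n t"])
    show "(\<lambda>m. X (n + m) u - X n u) \<longlonglongrightarrow> y u - X n u" for u by (intro tendsto_intros shift)
    show "eventually (\<lambda>m. fv p (\<lambda>t. X (n + m) t - X n t) 0 V \<and> pv p (\<lambda>t. X (n + m) t - X n t) 0 V \<le> D * (1 / 2) ^ n) sequentially"
      using fS[OF SX SX] diffX by (intro always_eventually) blast
  qed (use V exponents in auto)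
  have "fixed y V"
    unfolding fixed_def
  proof (intro allI impI)
    fix t assume t: "0 \<le> t" "t \<le> V"
    \<comment> \<open>\<open>contr\<close> is applied to the limit \<open>y\<close> itself, which is
      why \<open>y\<close> had to be shown to lie in \<open>S\<close>.\<close>
    have "norm (stop V (\<Phi> y) t - X (Suc n) t) \<le> r (Suc n)" for n
    proof -
      have "pv p (\<lambda>t. stop V (\<Phi> y) t - stop V (\<Phi> (X n)) t) 0 V \<le> D * (1 / 2) ^ n / 2"
        using D by (intro contr Sy SX yX) simp
      then have "norm (stop V (\<Phi> y) t - stop V (\<Phi> (X n)) t) \<le> (D * (1 / 2) ^ n / 2) powr (1 / p)"
        by (rule sup_bd[OF SP[OF S\<Phi>[OF Sy]] SP[OF S\<Phi>[OF SX]] fS[OF S\<Phi>[OF Sy] S\<Phi>[OF SX]] _ t])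
      then show ?thesis by (simp add: XS r_def)
    qed
    then have "(\<lambda>n. stop V (\<Phi> y) t - X (Suc n) t) \<longlonglongrightarrow> 0"
      by (intro Lim_null_comparison[OF always_eventually LIMSEQ_Suc[OF r0]]) blast
    then have "(\<lambda>n. stop V (\<Phi> y) t - (stop V (\<Phi> y) t - X (Suc n) t)) \<longlonglongrightarrow> stop V (\<Phi> y) t - 0"
      by (intro tendsto_diff tendsto_const)
    then have "(\<lambda>n. X (Suc n) t) \<longlonglongrightarrow> stop V (\<Phi> y) t" by simp
    then have "stop V (\<Phi> y) t = y t" using LIMSEQ_unique LIMSEQ_Suc[OF y[of t]] by blast
    then show "\<Phi> y t = y t" using t by (simp add: stop_eq)
  qed
  then show ?thesis using py d(1) unfolding V_def by blast
qed

text \<open>Uniqueness glues the solutions on shorter intervals into one path \<open>X\<close>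
  before \<open>\<tau>\<close>. The only danger is variation blowing up at \<open>\<tau>\<close>: it
  occurs on both sides of the a priori bound, but on the right with a factor that small
  \<open>W s v\<close> keeps below one half.\<close>

lemma extend_limit:
  assumes \<tau>: "0 < \<tau>" and ex: "\<And>u. 0 \<le> u \<Longrightarrow> u < \<tau> \<Longrightarrow> \<exists>x. path x \<and> fixed x u"
  shows "\<exists>x. path x \<and> fixed x \<tau>"
proof -
  have "\<forall>u. \<exists>x. 0 \<le> u \<longrightarrow> u < \<tau> \<longrightarrow> path x \<and> fixed x u" using ex by blast
  then obtain xs where xs: "\<And>u. 0 \<le> u \<Longrightarrow> u < \<tau> \<Longrightarrow> path (xs u)" "\<And>u. 0 \<le> u \<Longrightarrow> u < \<tau> \<Longrightarrow> fixed (xs u) u" by metis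
  define X where "X t = xs t t" for t
  have fixed_le: "fixed x u" if "fixed x v" "u \<le> v" for x u v using that by (auto simp: fixed_def)
  have Xeq: "X t = xs u t" if "0 \<le> t" "t \<le> u" "u < \<tau>" for t u
    unfolding X_def by (rule fixed_unique[OF xs(1) xs(1) xs(2) fixed_le[OF xs(2)]]) (use that in auto)
  have fX: "fv p X 0 v" if "0 \<le> v" "v < \<tau>" for v
    using pathD(3)[OF xs(1)[OF that] order_refl that(1)] fv_pv_cong(1)[of 0 v X "xs v" p] Xeq[OF _ _ that(2)] by simp
  obtain c where c: "0 \<le> c" "\<And>x s v b. path x \<Longrightarrow> 0 \<le> s \<Longrightarrow> s \<le> v \<Longrightarrow> (\<And>r. s \<le> r \<Longrightarrow> r \<le> v \<Longrightarrow> norm (l r - l s) \<le> b) \<Longrightarrow>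
     pv p (\<Phi> x) s v \<le> c * (b powr p + (1 + pv p x 0 v) * W s v)"
    using \<Phi>_variation by blast
  obtain b0 where b0: "\<And>t. 0 \<le> t \<Longrightarrow> t \<le> \<tau> \<Longrightarrow> norm (l t) \<le> b0" using cadlag_bounded[OF l(1), of \<tau>] \<tau> by auto
  define b where "b = b0 + b0"
  have lb: "norm (l r - l s) \<le> b" if "0 \<le> s" "s \<le> r" "r \<le> \<tau>" for r s
    using norm_triangle_ineq4[of "l r" "l s"] b0[of r] b0[of s] that unfolding b_def by linarith
  \<comment> \<open>Makes the factor \<open>c * 2 powr p * \<eta>\<close> of the unknown variation
    \<open>q\<close> at most \<open>1 / 2\<close>.\<close>
  define \<eta> where "\<eta> = 1 / (2 * (c + 1) * 2 powr p)"
  have \<eta>: "0 < \<eta>" using c(1) by (simp add: \<eta>_def)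
  obtain s where s: "0 \<le> s" "s < \<tau>" "\<And>v. s \<le> v \<Longrightarrow> v < \<tau> \<Longrightarrow> W s v \<le> \<eta>" using W_left_small[OF \<tau> \<eta>] by blast
  define A where "A = pv p X 0 s"
  have A: "0 \<le> A" using pv_nonneg[OF fX[OF s(1,2)] s(1)] by (simp add: A_def)
  \<comment> \<open>Twice the part of the bound that does not contain \<open>q\<close>, so that
    \<open>q \<le> M / 2 + q / 2\<close> gives \<open>q \<le> M\<close>.\<close>
  define M where "M = 2 * c * (b powr p + (1 + 2 powr p * A) * \<eta>)"
  have bound: "pv p X 0 v \<le> 2 powr p * (A + M)" if v: "s \<le> v" "v < \<tau>" for v
  proof -
    have v0: "0 \<le> v" using s v by simp
    note px = xs(1)[OF v0 v(2)]
    have fsv: "fv p X s v" using fv_subset[OF fX[OF v0 v(2)]] s v by simp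
    define q where "q = pv p X s v"
    have q0: "0 \<le> q" using pv_nonneg[OF fsv v(1)] by (simp add: q_def)
    have cc: "pv p X 0 v \<le> 2 powr p * (A + q)"
      unfolding A_def q_def using fv_pv_concat(2)[OF fX[OF s(1,2)] fsv s(1) v(1)] exponents by simp
    have "q = pv p (\<Phi> (xs v)) s v"
      unfolding q_def using xs(2)[OF v0 v(2)] Xeq[OF _ _ v(2)] s by (intro fv_pv_cong(2)) (simp add: fixed_def)
    also have "\<dots> \<le> c * (b powr p + (1 + pv p (xs v) 0 v) * W s v)"
      using s v by (intro c(2) px lb) auto
    also have "pv p (xs v) 0 v = pv p X 0 v" using Xeq[OF _ _ v(2)] by (intro fv_pv_cong(2)) simp
    also have "c * (b powr p + (1 + pv p X 0 v) * W s v) \<le> c * (b powr p + (1 + 2 powr p * (A + q)) * \<eta>)"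
      using c(1) cc s(3)[OF v] W_nonneg[OF s(1) v(1)] A q0 by (intro mult_left_mono add_left_mono mult_mono) auto
    also have "\<dots> = M / 2 + c * 2 powr p * \<eta> * q" by (simp add: M_def algebra_simps)
    also have "c * 2 powr p * \<eta> * q \<le> 1 / 2 * q"
    proof (rule mult_right_mono[OF _ q0])
      have "c * h * (1 / (2 * k * h)) = (c / k) / 2" if "0 < h" for k h :: real using that by simp
      then have "c * 2 powr p * \<eta> = (c / (c + 1)) / 2" unfolding \<eta>_def by simp
      also have "\<dots> \<le> 1 / 2" using c(1) by (intro divide_right_mono) auto
      finally show "c * 2 powr p * \<eta> \<le> 1 / 2" .
    qed
    finally have "q \<le> M" by simp
    then have "2 powr p * (A + q) \<le> 2 powr p * (A + M)" by (intro mult_left_mono) auto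
    then show ?thesis using cc by linarith
  qed
  define B where "B = 2 powr p * (A + M)"
  have XB: "fv p X 0 v \<and> pv p X 0 v \<le> B" if v: "0 \<le> v" "v < \<tau>" for v
  proof -
    have "pv p X 0 v \<le> pv p X 0 (max s v)" using v s by (intro pv_mono[OF fX]) auto
    also have "\<dots> \<le> B" unfolding B_def using v s by (intro bound) auto
    finally show ?thesis using fX[OF v] by simp
  qed
  obtain L where L: "(X \<longlongrightarrow> L) (at_left \<tau>)" using fv_left_limit[OF XB \<tau> exponents(3)] by blast
  \<comment> \<open>\<open>L\<close> is a provisional value: the solution itself may jump at
    \<open>\<tau>\<close>.\<close>
  define x1 where "x1 t = (if t < \<tau> then X t else L)" for t
  \<comment> \<open>Stopping just before \<open>\<tau>\<close> gives paths with variation at most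
    \<open>B\<close>; their pointwise limit \<open>x1\<close> inherits this bound.\<close>
  have lim1: "((\<lambda>e. stop (\<tau> - e) X u) \<longlongrightarrow> x1 u) (at_right 0)" if u: "0 \<le> u" for u
  proof (cases "u < \<tau>")
    case True
    have "eventually (\<lambda>e. stop (\<tau> - e) X u = x1 u) (at_right 0)"
      using eventually_at_right_real[of 0 "\<tau> - u"] True u by (auto elim!: eventually_mono simp: stop_eq x1_def)
    then show ?thesis by (rule tendsto_eventually)
  next
    case False
    have "filterlim (\<lambda>e. \<tau> - e) (at_left \<tau>) (at_right 0)"
      unfolding filterlim_at using eventually_at_right_less[of "0::real"]
      by (auto intro!: tendsto_eq_intros elim!: eventually_mono)
    then have "((\<lambda>e. X (\<tau> - e)) \<longlongrightarrow> L) (at_right 0)" by (rule filterlim_compose[OF L])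
    moreover have "eventually (\<lambda>e. X (\<tau> - e) = stop (\<tau> - e) X u) (at_right 0)"
      using eventually_at_right_real[OF \<tau>] False by (auto elim!: eventually_mono simp: stop_def min_def)
    ultimately show ?thesis using False by (auto simp: x1_def intro: Lim_transform_eventually)
  qed
  have f1: "fv p x1 0 T" if T: "0 \<le> T" for T
  proof (rule fv_pv_tendsto(1)[where F="at_right (0::real)" and X="\<lambda>e. stop (\<tau> - e) X" and B=B])
    show "eventually (\<lambda>e. fv p (stop (\<tau> - e) X) 0 T \<and> pv p (stop (\<tau> - e) X) 0 T \<le> B) (at_right 0)"
      using eventually_at_right_real[OF \<tau>]
    proof eventually_elim
      case (elim e)
      then have "0 \<le> \<tau> - e" "\<tau> - e < \<tau>" by auto
      then show ?case using fv_pv_stop[of X "\<tau> - e" T] XB[of "\<tau> - e"] T by (meson order_trans)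
    qed
  qed (use lim1 exponents T in auto)
  have x1eq: "x1 t = xs u t" if "0 \<le> t" "t \<le> u" "u < \<tau>" for t u using Xeq[OF that] that by (simp add: x1_def)
  have "cadlag x1"
  proof (rule cadlag_of_fv[OF _ f1 exponents(3)])
    fix t :: real assume t: "0 \<le> t"
    show "(x1 \<longlongrightarrow> x1 t) (at_right t)"
    proof (cases "t < \<tau>")
      case True
      define u where "u = (t + \<tau>) / 2"
      have u: "t < u" "u < \<tau>" "0 \<le> u" using True t by (auto simp: u_def)
      have "eventually (\<lambda>r. xs u r = x1 r) (at_right t)"
        using eventually_at_right_real[OF u(1)]
      proof eventually_elim
        case (elim r)
        then show ?case using x1eq[of r u] u t by simp
      qed
      moreover have "(xs u \<longlongrightarrow> x1 t) (at_right t)"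
        using cadlag_right[OF pathD(1)[OF xs(1)[OF u(3,2)]] t] x1eq[of t u] u t by simp
      ultimately show ?thesis by (rule Lim_transform_eventually[rotated])
    next
      case False
      have "eventually (\<lambda>r. x1 r = x1 t) (at_right t)"
        using eventually_at_right_less[of t] False by (auto elim!: eventually_mono simp: x1_def)
      then show ?thesis by (rule tendsto_eventually)
    qed
  qed
  moreover have "x1 0 = x0" using x1eq[of 0 0] \<tau> pathD(2)[OF xs(1)[of 0]] by simp
  ultimately have p1: "path x1" using f1 by (simp add: path_def)
  have fix1: "\<Phi> x1 t = x1 t" if t: "0 \<le> t" "t < \<tau>" for t
  proof -
    have "\<Phi> x1 t = \<Phi> (xs t) t" using t x1eq[of _ t] by (intro causal(2)[OF p1 xs(1)[OF t] _ t(1) order_refl]) auto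
    also have "\<dots> = xs t t" using xs(2)[OF t] t by (simp add: fixed_def)
    also have "\<dots> = x1 t" using x1eq[of t t] t by simp
    finally show ?thesis .
  qed
  \<comment> \<open>by causality the value at \<open>\<tau>\<close> is repaired by one more application of \<open>\<Phi>\<close>\<close>
  have "fixed (\<Phi> x1) \<tau>"
    unfolding fixed_def
  proof (intro allI impI)
    fix t assume "0 \<le> t" "t \<le> \<tau>"
    then show "\<Phi> (\<Phi> x1) t = \<Phi> x1 t" using fix1 by (intro causal(2)[OF path_\<Phi>[OF p1] p1]) auto
  qed
  then show ?thesis using path_\<Phi>[OF p1] by blast
qed

lemma local_solution:
  assumes "0 \<le> T" shows "\<exists>x. path x \<and> fixed x T"
proof (rule real_induct_nonneg[of "\<lambda>T. \<exists>x. path x \<and> fixed x T", OF _ _ assms])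
  fix t :: real assume t: "0 \<le> t" and IH: "\<And>s. 0 \<le> s \<Longrightarrow> s < t \<Longrightarrow> \<exists>x. path x \<and> fixed x s"
  show "\<exists>x. path x \<and> fixed x t"
  proof (cases "t = 0")
    case True
    \<comment> \<open>Any path serves at time 0, because every \<open>\<Phi> x\<close> starts at
      \<open>x0\<close>.\<close>
    have "fv p (\<lambda>_. x0) 0 T" for T using exponents by (intro fvI[of _ _ _ _ 0]) (simp add: pvar_sum_def)
    then have c: "path (\<lambda>_. x0)" by (simp add: path_def cadlag_const)
    have "fixed (\<lambda>_. x0) 0" unfolding fixed_def using pathD(2)[OF path_\<Phi>[OF c]] by (metis order_antisym)
    then show ?thesis using c True by blast
  qed (use extend_limit IH t in auto)
next
  fix t :: real assume t: "0 \<le> t" and IH: "\<And>s. 0 \<le> s \<Longrightarrow> s \<le> t \<Longrightarrow> \<exists>x. path x \<and> fixed x s"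
  obtain x where "path x" "fixed x t" using IH[OF t order_refl] by blast
  then obtain d x' where d: "0 < d" "path x'" "fixed x' (t + d)" using extend_right[OF _ t] by blast
  have "fixed x' s" if "s \<le> t + d" for s using d(3) that by (auto simp: fixed_def)
  then show "\<exists>d>0. \<forall>s. t \<le> s \<longrightarrow> s \<le> t + d \<longrightarrow> (\<exists>x. path x \<and> fixed x s)" using d by blast
qed

text \<open>Solutions on growing intervals are consistent by uniqueness, so the diagonal
  \<open>xs t t\<close> solves the equation at all times.\<close>

lemma global_solution: "\<exists>x. path x \<and> (\<forall>T. fixed x T)"
proof -
  have "\<forall>T. \<exists>x. 0 \<le> T \<longrightarrow> path x \<and> fixed x T" using local_solution by blast
  then obtain xs where xs: "\<And>T. 0 \<le> T \<Longrightarrow> path (xs T)" "\<And>T. 0 \<le> T \<Longrightarrow> fixed (xs T) T" by metis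
  define X where "X t = xs t t" for t
  have Xeq: "X t = xs u t" if t: "0 \<le> t" "t \<le> u" for t u
  proof -
    have u: "0 \<le> u" using t by simp
    have "fixed (xs u) t" using xs(2)[OF u] t by (auto simp: fixed_def)
    then show ?thesis unfolding X_def using fixed_unique[OF xs(1)[OF t(1)] xs(1)[OF u] xs(2)[OF t(1)]] t by auto
  qed
  have f: "fv p X 0 T" if "0 \<le> T" for T
    using pathD(3)[OF xs(1)[OF that] order_refl that] fv_pv_cong(1)[of 0 T X "xs T" p] Xeq by simp
  have "cadlag X"
  proof (rule cadlag_of_fv[OF _ f exponents(3)])
    fix t :: real assume t: "0 \<le> t"
    then have u: "0 \<le> t + 1" by simp
    have "eventually (\<lambda>r. xs (t + 1) r = X r) (at_right t)"
      using eventually_at_right_real[of t "t + 1"] Xeq[of _ "t + 1"] t by (auto elim!: eventually_mono)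
    moreover have "(xs (t + 1) \<longlongrightarrow> X t) (at_right t)"
      using cadlag_right[OF pathD(1)[OF xs(1)[OF u]] t] Xeq[of t "t + 1"] t by simp
    ultimately show "(X \<longlongrightarrow> X t) (at_right t)" by (rule Lim_transform_eventually[rotated])
  qed
  moreover have "X 0 = x0" using pathD(2)[OF xs(1)[of 0]] by (simp add: X_def)
  ultimately have pX: "path X" using f by (simp add: path_def)
  have "\<Phi> X t = X t" if t: "0 \<le> t" for t
  proof -
    have "\<Phi> X t = \<Phi> (xs t) t" using t Xeq[of _ t] by (intro causal(2)[OF pX xs(1)[OF t] _ t order_refl]) auto
    then show ?thesis using xs(2)[OF t] t Xeq[of t t] by (simp add: fixed_def)
  qed
  then show ?thesis using pX unfolding fixed_def by blast
qed

end

section \<open>Correspondence between solutions and fixed points\<close>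

lemma has_rs_integral_degenerate: "has_rs_integral mul h a s s I \<Longrightarrow> I = 0"
  using has_rs_integral_norm_le[of mul h a s s I 0 0] partition_degenerate by force

lemma skorokhod_cong:
  assumes "\<And>t. 0 \<le> t \<Longrightarrow> y t = y' t" "\<And>t. 0 \<le> t \<Longrightarrow> x t = x' t"
  shows "skorokhod l y x k = skorokhod l y' x' k"
proof -
  have "(\<integral>\<^sup>+ s \<in> {0..t}. ennreal (x s $ i - l s $ i) \<partial>m) = (\<integral>\<^sup>+ s \<in> {0..t}. ennreal (x' s $ i - l s $ i) \<partial>m)" for t i m
    by (intro nn_integral_cong) (auto simp: indicator_def assms(2))
  then show ?thesis unfolding skorokhod_def using assms by simp
qed

context reflected_equation
begin

lemma solution_of_fixed:
  assumes x: "path x" and fx: "\<And>T. fixed x T"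
  shows "is_solution p f g a z l x0 x (kmap (\<lambda>s. l s - Y x s))"
proof -
  let ?k = "kmap (\<lambda>s. l s - Y x s)"
  have eq: "x t = Y x t + ?k t" if "0 \<le> t" for t
    using fx[of t] that by (simp add: fixed_def \<Phi>_def)
  have "skorokhod l (Y x) (\<lambda>t. Y x t + ?k t) ?k"
    by (rule skorokhod_kmap[OF cadlag_Y[OF x] l(1)]) (use l(2) Y_0[OF x] in simp)
  then have sk: "skorokhod l (Y x) x ?k"
    using skorokhod_cong[of "Y x" "Y x" x "\<lambda>t. Y x t + ?k t" l ?k] eq by simp
  have "\<forall>T\<ge>0. pvar p x 0 T < \<infinity>" using pathD(3)[OF x order_refl] pvar_less_infinity_iff[of 0] by blast
  moreover have "\<forall>t\<ge>0. \<exists>I1 I2. has_rs_integral (\<lambda>u v. v *\<^sub>R u) (\<lambda>s. f (left_lim x s)) a 0 t I1 \<and>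
            has_rs_integral (\<lambda>M v. M *v v) (\<lambda>s. g (left_lim x s)) z 0 t I2 \<and> Y x t = x0 + I1 + I2"
    using Ia_has[OF x order_refl] Iz_has(1)[OF x order_refl] unfolding Y_def by blast
  ultimately show ?thesis unfolding is_solution_def
    using pathD(1)[OF x] cadlag_kmap[OF cadlag_lY[OF x]] sk by blast
qed

text \<open>The existential \<open>y\<close> of \<open>is_solution\<close> agrees with
  \<open>Y x\<close> at nonnegative times because integrals are unique, and uniqueness for the
  Skorokhod problem then identifies \<open>k\<close>. At time 0 the integrals and \<open>k\<close>
  vanish, whence \<open>x 0 = x0\<close>.\<close>

lemma fixed_of_solution:
  assumes sol: "is_solution p f g a z l x0 x k"
  shows "path x" "fixed x T" "0 \<le> t \<Longrightarrow> k t = x t - Y x t"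
proof -
  obtain y where c: "cadlag x" "cadlag k" and pv: "\<And>T. 0 \<le> T \<Longrightarrow> pvar p x 0 T < \<infinity>" and sk: "skorokhod l y x k"
    and int: "\<And>t. 0 \<le> t \<Longrightarrow> \<exists>I1 I2. has_rs_integral (\<lambda>u v. v *\<^sub>R u) (\<lambda>s. f (left_lim x s)) a 0 t I1 \<and>
            has_rs_integral (\<lambda>M v. M *v v) (\<lambda>s. g (left_lim x s)) z 0 t I2 \<and> y t = x0 + I1 + I2"
    using sol unfolding is_solution_def by blast
  have yY: "y t = Y x t" if t: "0 \<le> t" for t
  proof -
    obtain I1 I2 where I: "has_rs_integral (\<lambda>u v. v *\<^sub>R u) (\<lambda>s. f (left_lim x s)) a 0 t I1"
      "has_rs_integral (\<lambda>M v. M *v v) (\<lambda>s. g (left_lim x s)) z 0 t I2" "y t = x0 + I1 + I2" using int[OF t] by blast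
    show ?thesis using rsi_eqI[OF I(1)] rsi_eqI[OF I(2)] I(3) by (simp add: Y_def Ia_def Iz_def)
  qed
  obtain I1 I2 where I: "has_rs_integral (\<lambda>u v. v *\<^sub>R u) (\<lambda>s. f (left_lim x s)) a 0 0 I1"
      "has_rs_integral (\<lambda>M v. M *v v) (\<lambda>s. g (left_lim x s)) z 0 0 I2" "y 0 = x0 + I1 + I2" using int[of 0] by blast
  then have "y 0 = x0" using has_rs_integral_degenerate[OF I(1)] has_rs_integral_degenerate[OF I(2)] by simp
  then have "x 0 = x0" using sk by (simp add: skorokhod_def)
  moreover have "fv p x 0 T" if "0 \<le> T" for T using iffD1[OF pvar_less_infinity_iff[OF that] pv[OF that]] .
  ultimately show px: "path x" using c(1) by (simp add: path_def)
  have sk': "skorokhod l (Y x) x k" using sk skorokhod_cong[of y "Y x" x x l k] yY by simp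
  have xk: "x t = Y x t + k t" if "0 \<le> t" for t using sk' that by (simp add: skorokhod_def)
  show "fixed x T" unfolding fixed_def \<Phi>_def
    using skorokhod_unique[OF sk' cadlag_Y[OF px] l(1) c(2)] xk by simp
  show "k t = x t - Y x t" if "0 \<le> t" using xk[OF that] by simp
qed

lemma unique_solution:
  "\<exists>x k. is_solution p f g a z l x0 x k \<and>
     (\<forall>x' k'. is_solution p f g a z l x0 x' k' \<longrightarrow> (\<forall>t\<ge>0. x' t = x t \<and> k' t = k t))"
proof -
  obtain x where x: "path x" "\<And>T. fixed x T" using global_solution by blast
  note sol = solution_of_fixed[OF x]
  have "x' t = x t \<and> k' t = kmap (\<lambda>s. l s - Y x s) t" if sol': "is_solution p f g a z l x0 x' k'" and t: "0 \<le> t" for x' k' t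
  proof -
    note s' = fixed_of_solution[OF sol']
    have eq: "x' s = x s" if "0 \<le> s" for s
      by (rule fixed_unique[OF s'(1) x(1) s'(2) x(2) that order_refl])
    have "Y x' t = Y x t" by (rule causal(1)[OF s'(1) x(1) _ t order_refl]) (simp add: eq)
    then show ?thesis using eq[OF t] s'(3)[OF t] fixed_of_solution(3)[OF sol t] by simp
  qed
  then show ?thesis using sol by blast
qed

end

text \<open>It remains to bring the hypotheses into the form of \<open>reflected_equation\<close>.
  Uniqueness is claimed for \<open>t \<ge> 0\<close>, since values at negative times are
  unconstrained.\<close>

theorem theorem4:
  fixes p :: real
    and f :: "real^'d \<Rightarrow> real^'d"
    and g :: "real^'d \<Rightarrow> real^'d^'d"
    and a :: "real \<Rightarrow> real"
    and z l :: "real \<Rightarrow> real^'d"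
    and x0 :: "real^'d"
  assumes p: "p \<ge> 1"
    and H1_f_cont: "continuous_on UNIV f"
    and H1_f_growth: "\<exists>L>0. \<forall>x. norm (f x) \<le> L * (1 + norm x)"
    and H1_g_hoelder: "\<exists>\<alpha> C. p - 1 < \<alpha> \<and> \<alpha> \<le> 1 \<and> C > 0 \<and>
          (\<forall>x y. onorm (\<lambda>v. (g x - g y) *v v) \<le> C * norm (x - y) powr \<alpha>)"
    and H2_f_loclip: "\<forall>k::nat. \<exists>Lk>0. \<forall>x y. norm x \<le> real k \<and> norm y \<le> real k \<longrightarrow>
          norm (f x - f y) \<le> Lk * norm (x - y)"
    and H2_g_diff: "\<exists>\<gamma> (Dg :: 'd \<Rightarrow> 'd \<Rightarrow> real^'d \<Rightarrow> real^'d).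
          p - 1 < \<gamma> \<and> \<gamma> \<le> 1 \<and>
          (\<forall>i j x. ((\<lambda>y. g y $ i $ j) has_derivative (\<lambda>h. Dg i j x \<bullet> h)) (at x)) \<and>
          (\<forall>k::nat. \<exists>C>0. \<forall>i j x y. norm x \<le> real k \<and> norm y \<le> real k \<longrightarrow>
              norm (Dg i j x - Dg i j y) \<le> C * norm (x - y) powr \<gamma>)"
    and a_cadlag: "cadlag a" and z_cadlag: "cadlag z" and l_cadlag: "cadlag l"
    and a_bv: "\<forall>T\<ge>0. pvar 1 a 0 T < \<infinity>"
    and z_pvar: "\<forall>T\<ge>0. pvar p z 0 T < \<infinity>"
    and x0_ge: "\<forall>i. l 0 $ i \<le> x0 $ i"
  shows "\<exists>x k. is_solution p f g a z l x0 x k \<and>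
           (\<forall>x' k'. is_solution p f g a z l x0 x' k' \<longrightarrow>
               (\<forall>t\<ge>0. x' t = x t \<and> k' t = k t))"
proof -
  obtain Lf where Lf: "0 < Lf" "\<And>x. norm (f x) \<le> Lf * (1 + norm x)" using H1_f_growth by blast
  obtain \<alpha> C where \<alpha>: "p - 1 < \<alpha>" "\<alpha> \<le> 1" "0 < C"
    and gh: "\<And>x y. onorm (\<lambda>v. (g x - g y) *v v) \<le> C * norm (x - y) powr \<alpha>"
    using H1_g_hoelder by blast
  obtain \<gamma> Dg where \<gamma>: "p - 1 < \<gamma>" "\<gamma> \<le> 1"
    and der: "\<And>i j x. ((\<lambda>y. g y $ i $ j) has_derivative (\<lambda>h. Dg i j x \<bullet> h)) (at x)"
    and hold: "\<And>k::nat. \<exists>C>0. \<forall>i j x y. norm x \<le> real k \<and> norm y \<le> real k \<longrightarrow>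
              norm (Dg i j x - Dg i j y) \<le> C * norm (x - y) powr \<gamma>"
    using H2_g_diff by blast
  \<comment> \<open>The dimension factors come from \<open>norm_matrix_le_onorm\<close>.\<close>
  define Cg where "Cg = real CARD('d) * (real CARD('d) * C)"
  have g_hoelder: "norm (g x - g y) \<le> Cg * norm (x - y) powr \<alpha>" for x y
  proof -
    have "norm (g x - g y) \<le> real CARD('d) * (real CARD('d) * onorm (\<lambda>v. (g x - g y) *v v))" by (rule norm_matrix_le_onorm)
    also have "\<dots> \<le> real CARD('d) * (real CARD('d) * (C * norm (x - y) powr \<alpha>))"
      by (intro mult_left_mono gh) auto
    finally show ?thesis by (simp add: Cg_def mult.assoc)
  qed
  have f_lip: "\<exists>M\<ge>0. \<forall>x y. norm x \<le> R \<longrightarrow> norm y \<le> R \<longrightarrow> norm (f x - f y) \<le> M * norm (x - y)" for R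
  proof -
    obtain k :: nat where k: "R \<le> real k" using real_arch_simple by blast
    obtain M where M: "0 < M" "\<And>x y. norm x \<le> real k \<and> norm y \<le> real k \<longrightarrow> norm (f x - f y) \<le> M * norm (x - y)"
      using H2_f_loclip by blast
    show ?thesis using M k by (intro exI[of _ M]) (auto intro: order_trans)
  qed
  have g_diff: "\<exists>M\<ge>0. \<forall>x x' y y'. norm x \<le> R \<longrightarrow> norm x' \<le> R \<longrightarrow> norm y \<le> R \<longrightarrow> norm y' \<le> R \<longrightarrow>
        norm ((g y - g y') - (g x - g x')) \<le> M * (norm ((y - y') - (x - x')) + (norm (y - x) + norm (y' - x')) powr \<gamma> * norm (x - x'))" for R
  proof -
    obtain k :: nat where k: "R \<le> real k" using real_arch_simple by blast
    obtain C' where C': "0 < C'" "\<And>i j x y. norm x \<le> real k \<Longrightarrow> norm y \<le> real k \<Longrightarrow> norm (Dg i j x - Dg i j y) \<le> C' * norm (x - y) powr \<gamma>"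
      using hold[of k] by blast
    \<comment> \<open>The constant of \<open>gradient_second_difference\<close> for the entry
      \<open>i\<close>, \<open>j\<close> on the ball of integer radius \<open>k\<close>; the matrix
      norm is then bounded by the sum over the entries.\<close>
    define c where "c i j = norm (Dg i j 0) + C' * real k powr \<gamma> + C'" for i j
    define M where "M = (\<Sum>i\<in>UNIV. \<Sum>j\<in>UNIV. c i j)"
    have c0: "0 \<le> c i j" for i j using C'(1) by (simp add: c_def)
    have "norm ((g y - g y') - (g x - g x')) \<le> M * (norm ((y - y') - (x - x')) + (norm (y - x) + norm (y' - x')) powr \<gamma> * norm (x - x'))"
      (is "_ \<le> M * ?E") if n: "norm x \<le> R" "norm x' \<le> R" "norm y \<le> R" "norm y' \<le> R" for x x' y y'
    proof -
      have "norm ((g y - g y') - (g x - g x')) \<le> (\<Sum>i\<in>UNIV. \<Sum>j\<in>UNIV. \<bar>((g y - g y') - (g x - g x')) $ i $ j\<bar>)"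
        by (rule norm_matrix_le_sum)
      also have "\<dots> \<le> (\<Sum>i\<in>UNIV. \<Sum>j\<in>UNIV. c i j * ?E)"
      proof (intro sum_mono)
        fix i j
        have "\<bar>(g y $ i $ j - g y' $ i $ j) - (g x $ i $ j - g x' $ i $ j)\<bar> \<le> c i j * ?E"
          unfolding c_def using n k C' p \<gamma>
          by (intro gradient_second_difference[where \<phi>="\<lambda>y. g y $ i $ j" and D="Dg i j"] der C'(2)) auto
        then show "\<bar>((g y - g y') - (g x - g x')) $ i $ j\<bar> \<le> c i j * ?E" by simp
      qed
      also have "\<dots> = M * ?E" by (simp add: M_def sum_distrib_right)
      finally show ?thesis .
    qed
    moreover have "0 \<le> M" unfolding M_def using c0 by (intro sum_nonneg) auto
    ultimately show ?thesis by blast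
  qed
  interpret reflected_equation p \<alpha> \<gamma> Lf Cg f g a z l x0
  proof
    show "fv 1 a 0 T" "fv p z 0 T" if "0 \<le> T" for T
      using a_bv z_pvar that pvar_less_infinity_iff[OF that, of 1 a] pvar_less_infinity_iff[OF that, of p z] by blast+
  qed (use assms Lf \<alpha> \<gamma> g_hoelder f_lip g_diff in \<open>auto simp: Cg_def\<close>)
  show ?thesis by (rule unique_solution)
qed

end
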